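(* Let $I\subset\mathbb{R}$ be an open interval, $(F,g_F)$ a pseudo-Riemannian manifold with $\dim F=l>1$, $f:I\to(0,\infty)$ smooth, and let $M=I\times F$ carry the metric $g=-dt^2+f(t)^2g_F$. Let $\lambda_1,\lambda_2$ be nonzero real constants, $P=\frac{\partial}{\partial t}$, and let $\overline\nabla$ be the quarter-symmetric connection on $M$ determined by $P,\lambda_1,\lambda_2$. Then $(M,\overline\nabla)$ is Einstein with Einstein constant $\alpha$ if and only if $(F,\nabla^F)$ is Einstein with some Einstein constant $\alpha_F$ and one of the following conditions is satisfied (for some real constants $c_0,c_1,c_2$): (1) $\alpha=(\lambda_1^2-\lambda_1\lambda_2)l$, $\alpha_F=c_2^2(l\lambda_1^2-\lambda_2^2)$, $f(t)=c_2$; (2) $\lambda_1=\lambda_2$, $\alpha=0$, $\alpha_F=(l-1)c_2^2\lambda_1^2$, $f(t)=c_1e^{\lambda_1t}+c_2$; (3) $\lambda_2^2-2l\lambda_1^2+l\lambda_1\lambda_2\neq0$, $\lambda_2\neq l\lambda_1$, $\alpha=\dfrac{(3l^2+l)\lambda_1^2\lambda_2^2-(l^2+l)\lambda_1\lambda_2^3-2l^2\lambda_1^3\lambda_2}{(l\lambda_1-\lambda_2)^2}$, $\alpha_F=0$, $f(t)=c_0e^{(l\lambda_1^2-\lambda_2^2)t/(l\lambda_1-\lambda_2)}$; (4) $\lambda_2^2-2l\lambda_1^2+l\lambda_1\lambda_2=0$, $\alpha=l\left(\lambda_1-\frac12\lambda_2\right)^2$, $\alpha_F=0$, $f(t)=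c_1e^{\frac{\lambda_2}{2}t}$.
   Context: On a pseudo-Riemannian manifold $(M,g)$ with Levi-Civita connection $\nabla$, a vector field $P$, the 1-form $\pi(X)=g(X,P)$ and nonzero real constants $\lambda_1,\lambda_2$, the quarter-symmetric connection is $\overline\nabla_XY=\nabla_XY+\lambda_1\pi(Y)X-\lambda_2g(X,Y)P$. Its curvature is $\overline R(X,Y)=\overline\nabla_X\overline\nabla_Y-\overline\nabla_Y\overline\nabla_X-\overline\nabla_{[X,Y]}$ and its Ricci tensor is $\overline{Ric}(X,Y)=\sum_k\varepsilon_k\,g(\overline R(X,E_k)Y,E_k)$, where $(E_k)$ is a local orthonormal frame with $g(E_k,E_k)=\varepsilon_k=\pm1$ (note the sign convention; $\overline{Ric}$ need not be symmetric). The same formulas with the Levi-Civita connection $\nabla^F$ of $(F,g_F)$ define $Ric^F$ (same sign convention). $(M,\overline\nabla)$ is Einstein with Einstein constant $\alpha\in\mathbb{R}$ if $\overline{Ric}(X,Y)=\alpha g(X,Y)$ for all vector fields $X,Y$; $(F,\nabla^F)$ is Einstein with constant $\alpha_F\in\mathbb{R}$ if $Ric^F=\alpha_Fg_F$. *)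

theory Defs
  imports "HOL-Analysis.Analysis"
begin

section \<open>Smooth functions on open subsets of Euclidean spaces\<close>

text \<open>\<open>k_smooth_on k S f\<close> says that \<open>f\<close> is of class \<open>C^k\<close> on \<open>S\<close>; it is meant for open \<open>S\<close>.\<close>

primrec k_smooth_on ::
    "nat \<Rightarrow> 'a::euclidean_space set \<Rightarrow> ('a \<Rightarrow> 'b::euclidean_space) \<Rightarrow> bool" where
  "k_smooth_on 0 S f \<longleftrightarrow> continuous_on S f"
| "k_smooth_on (Suc k) S f \<longleftrightarrow>
     (\<forall>x\<in>S. f differentiable (at x)) \<and>
     (\<forall>v. k_smooth_on k S (\<lambda>x. frechet_derivative f (at x) v))"

definition smooth_on :: "'a::euclidean_space set \<Rightarrow> ('a \<Rightarrow> 'b::euclidean_space) \<Rightarrow> bool" where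
  "smooth_on S f \<longleftrightarrow> (\<forall>k. k_smooth_on k S f)"

section \<open>Smooth manifolds\<close>

text \<open>A chart is a pair of an open domain and a coordinate map. The points of a manifold form
  an open subset, the union of the chart domains, of a Hausdorff second-countable type;
  its dimension is \<open>DIM('e)\<close>. An atlas need not be maximal.\<close>

type_synonym ('a, 'e) chart = "'a set \<times> ('a \<Rightarrow> 'e)"

definition is_chart :: "('a::topological_space, 'e::euclidean_space) chart \<Rightarrow> bool" where
  "is_chart = (\<lambda>(U, \<phi>). open U \<and> open (\<phi> ` U) \<and> (\<exists>\<psi>. homeomorphism U (\<phi> ` U) \<phi> \<psi>))"

definition smoothly_compatible ::
    "('a, 'e::euclidean_space) chart \<Rightarrow> ('a, 'e) chart \<Rightarrow> bool" where
  "smoothly_compatible = (\<lambda>(U, \<phi>) (V, \<psi>). smooth_on (\<phi> ` (U \<inter> V)) (\<psi> \<circ> inv_into U \<phi>))"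

definition points :: "('a, 'e) chart set \<Rightarrow> 'a set" where
  "points A = (\<Union>c\<in>A. fst c)"

definition smooth_manifold ::
    "('a::{t2_space,second_countable_topology}, 'e::euclidean_space) chart set \<Rightarrow> bool" where
  "smooth_manifold A \<longleftrightarrow>
     points A \<noteq> {} \<and> (\<forall>c\<in>A. is_chart c) \<and> (\<forall>c\<in>A. \<forall>d\<in>A. smoothly_compatible c d)"

definition open_part :: "('a::topological_space, 'e) chart set \<Rightarrow> 'a set \<Rightarrow> bool" where
  "open_part A U \<longleftrightarrow> open U \<and> U \<subseteq> points A"

definition smooth_function ::
    "('a, 'e::euclidean_space) chart set \<Rightarrow> 'a set \<Rightarrow> ('a \<Rightarrow> real) \<Rightarrow> bool" where
  "smooth_function A U h \<longleftrightarrow> (\<forall>(V, \<phi>)\<in>A. smooth_on (\<phi> ` (U \<inter> V)) (h \<circ> inv_into V \<phi>))"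

definition smooth_near ::
    "('a::topological_space, 'e::euclidean_space) chart set \<Rightarrow> 'a \<Rightarrow> ('a \<Rightarrow> real) \<Rightarrow> bool" where
  "smooth_near A p h \<longleftrightarrow> (\<exists>U. open_part A U \<and> p \<in> U \<and> smooth_function A U h)"

definition product_atlas ::
    "('a, 'd) chart set \<Rightarrow> ('b, 'e) chart set \<Rightarrow> ('a \<times> 'b, 'd \<times> 'e) chart set" where
  "product_atlas A B = {(U \<times> V, map_prod \<phi> \<psi>) | U \<phi> V \<psi>. (U, \<phi>) \<in> A \<and> (V, \<psi>) \<in> B}"

definition interval_atlas :: "real set \<Rightarrow> (real, real) chart set" where
  "interval_atlas I = {(I, id)}"

section \<open>Tangent vectors and vector fields\<close>

text \<open>A tangent vector at \<open>p\<close> is the velocity at \<open>0\<close> of a smooth curve through \<open>p\<close>, regarded as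
  the directional derivative acting on the functions that are smooth near \<open>p\<close>. On all other
  functions it takes the value \<open>0\<close>, so that equal tangent vectors are equal as HOL functions.
  Linear combinations of tangent vectors are formed pointwise.\<close>

type_synonym 'a tvec = "('a \<Rightarrow> real) \<Rightarrow> real"

type_synonym 'a vfield = "'a \<Rightarrow> 'a tvec"

definition velocity ::
    "('a::topological_space, 'e::euclidean_space) chart set \<Rightarrow> (real \<Rightarrow> 'a) \<Rightarrow> real \<Rightarrow> 'a tvec" where
  "velocity A \<gamma> s = (\<lambda>h. if smooth_near A (\<gamma> s) h then deriv (h \<circ> \<gamma>) s else 0)"

definition smooth_curve ::
    "('a::topological_space, 'e::euclidean_space) chart set \<Rightarrow> real set \<Rightarrow> (real \<Rightarrow> 'a) \<Rightarrow> bool" where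
  "smooth_curve A J \<gamma> \<longleftrightarrow> continuous_on J \<gamma> \<and> \<gamma> ` J \<subseteq> points A \<and>
     (\<forall>(U, \<phi>)\<in>A. smooth_on {s \<in> J. \<gamma> s \<in> U} (\<phi> \<circ> \<gamma>))"

definition tangent_space ::
    "('a::topological_space, 'e::euclidean_space) chart set \<Rightarrow> 'a \<Rightarrow> 'a tvec set" where
  "tangent_space A p =
     {velocity A \<gamma> 0 | \<gamma> \<epsilon>. \<epsilon> > 0 \<and> smooth_curve A {-\<epsilon><..<\<epsilon>} \<gamma> \<and> \<gamma> 0 = p}"

definition vector_field ::
    "('a::topological_space, 'e::euclidean_space) chart set \<Rightarrow> 'a set \<Rightarrow> 'a vfield \<Rightarrow> bool" where
  "vector_field A U X \<longleftrightarrow>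
     (\<forall>p\<in>U. X p \<in> tangent_space A p) \<and>
     (\<forall>V h. open V \<and> V \<subseteq> U \<and> smooth_function A V h \<longrightarrow> smooth_function A V (\<lambda>p. X p h))"

text \<open>The pushforward of a tangent vector at \<open>p\<close> along \<open>F\<close>, whose target has atlas \<open>B\<close>.\<close>

definition pushforward ::
    "('b::topological_space, 'e::euclidean_space) chart set \<Rightarrow> ('a \<Rightarrow> 'b) \<Rightarrow> 'a \<Rightarrow> 'a tvec \<Rightarrow> 'b tvec" where
  "pushforward B F p v = (\<lambda>h. if smooth_near B (F p) h then v (h \<circ> F) else 0)"

definition lie_bracket ::
    "('a::topological_space, 'e::euclidean_space) chart set \<Rightarrow> 'a vfield \<Rightarrow> 'a vfield \<Rightarrow> 'a vfield" where
  "lie_bracket A X Y = (\<lambda>p h. if smooth_near A p h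
      then X p (\<lambda>q. Y q h) - Y p (\<lambda>q. X q h) else 0)"

section \<open>Pseudo-Riemannian metrics and connections\<close>

type_synonym 'a metric = "'a \<Rightarrow> 'a tvec \<Rightarrow> 'a tvec \<Rightarrow> real"

definition pseudo_riemannian_metric ::
    "('a::topological_space, 'e::euclidean_space) chart set \<Rightarrow> 'a metric \<Rightarrow> bool" where
  "pseudo_riemannian_metric A g \<longleftrightarrow>
     (\<forall>p\<in>points A. \<forall>v\<in>tangent_space A p.
        (\<forall>w\<in>tangent_space A p. g p v w = g p w v) \<and>
        (\<forall>w\<in>tangent_space A p. \<forall>u\<in>tangent_space A p. \<forall>a b.
           g p (\<lambda>h. a * v h + b * w h) u = a * g p v u + b * g p w u) \<and>
        ((\<forall>w\<in>tangent_space A p. g p v w = 0) \<longrightarrow> v = (\<lambda>_. 0))) \<and>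
     (\<forall>U X Y. open_part A U \<and> vector_field A U X \<and> vector_field A U Y \<longrightarrow>
        smooth_function A U (\<lambda>p. g p (X p) (Y p)))"

text \<open>Connections act on locally defined vector fields. One operator serves all open parts of
  the manifold; the first clause says that its value on an open part depends only on the
  arguments there.\<close>

type_synonym 'a connection = "'a vfield \<Rightarrow> 'a vfield \<Rightarrow> 'a vfield"

definition affine_connection ::
    "('a::topological_space, 'e::euclidean_space) chart set \<Rightarrow> 'a connection \<Rightarrow> bool" where
  "affine_connection A D \<longleftrightarrow>
    (\<forall>U X Y. open_part A U \<and> vector_field A U X \<and> vector_field A U Y \<longrightarrow>
      (\<forall>X' Y'. (\<forall>p\<in>U. X' p = X p \<and> Y' p = Y p) \<longrightarrow> (\<forall>p\<in>U. D X' Y' p = D X Y p)) \<and>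
      vector_field A U (D X Y) \<and>
      (\<forall>Z. vector_field A U Z \<longrightarrow> (\<forall>p\<in>U.
         D (\<lambda>q h. X q h + Z q h) Y p = (\<lambda>h. D X Y p h + D Z Y p h) \<and>
         D X (\<lambda>q h. Y q h + Z q h) p = (\<lambda>h. D X Y p h + D X Z p h))) \<and>
      (\<forall>u. smooth_function A U u \<longrightarrow> (\<forall>p\<in>U.
         D (\<lambda>q h. u q * X q h) Y p = (\<lambda>h. u p * D X Y p h) \<and>
         D X (\<lambda>q h. u q * Y q h) p = (\<lambda>h. X p u * Y p h + u p * D X Y p h))))"

definition torsion_free ::
    "('a::topological_space, 'e::euclidean_space) chart set \<Rightarrow> 'a connection \<Rightarrow> bool" where
  "torsion_free A D \<longleftrightarrow>
    (\<forall>U X Y. open_part A U \<and> vector_field A U X \<and> vector_field A U Y \<longrightarrow>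
      (\<forall>p\<in>U. (\<lambda>h. D X Y p h - D Y X p h) = lie_bracket A X Y p))"

definition metric_compatible ::
    "('a::topological_space, 'e::euclidean_space) chart set \<Rightarrow> 'a metric \<Rightarrow> 'a connection \<Rightarrow> bool" where
  "metric_compatible A g D \<longleftrightarrow>
    (\<forall>U X Y Z. open_part A U \<and> vector_field A U X \<and> vector_field A U Y \<and> vector_field A U Z \<longrightarrow>
      (\<forall>p\<in>U. X p (\<lambda>q. g q (Y q) (Z q)) = g p (D X Y p) (Z p) + g p (Y p) (D X Z p)))"

definition levi_civita_connection ::
    "('a::topological_space, 'e::euclidean_space) chart set \<Rightarrow> 'a metric \<Rightarrow> 'a connection \<Rightarrow> bool" where
  "levi_civita_connection A g D \<longleftrightarrow>
     affine_connection A D \<and> torsion_free A D \<and> metric_compatible A g D"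

definition quarter_symmetric_connection ::
    "'a metric \<Rightarrow> 'a connection \<Rightarrow> 'a vfield \<Rightarrow> real \<Rightarrow> real \<Rightarrow> 'a connection" where
  "quarter_symmetric_connection g D P lam1 lam2 = (\<lambda>X Y p h.
     D X Y p h + lam1 * g p (Y p) (P p) * X p h - lam2 * g p (X p) (Y p) * P p h)"

section \<open>Curvature, Ricci tensor, Einstein condition\<close>

definition curvature ::
    "('a::topological_space, 'e::euclidean_space) chart set \<Rightarrow> 'a connection \<Rightarrow>
     'a vfield \<Rightarrow> 'a vfield \<Rightarrow> 'a vfield \<Rightarrow> 'a vfield" where
  "curvature A D X Y Z = (\<lambda>p h.
     D X (D Y Z) p h - D Y (D X Z) p h - D (lie_bracket A X Y) Z p h)"

definition orthonormal_frame ::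
    "('a::topological_space, 'e::euclidean_space) chart set \<Rightarrow> 'a metric \<Rightarrow> 'a set \<Rightarrow>
     (nat \<Rightarrow> real) \<Rightarrow> (nat \<Rightarrow> 'a vfield) \<Rightarrow> bool" where
  "orthonormal_frame A g U \<epsilon> E \<longleftrightarrow>
     (\<forall>k<DIM('e). vector_field A U (E k) \<and> (\<epsilon> k = 1 \<or> \<epsilon> k = -1)) \<and>
     (\<forall>p\<in>U. \<forall>i<DIM('e). \<forall>j<DIM('e). g p (E i p) (E j p) = (if i = j then \<epsilon> i else 0))"

text \<open>The trace does not depend on the choice of the local orthonormal frame around \<open>p\<close>.
  In this sign convention the Ricci tensor of a round sphere is negative definite.\<close>

definition ricci ::
    "('a::topological_space, 'e::euclidean_space) chart set \<Rightarrow> 'a metric \<Rightarrow> 'a connection \<Rightarrow>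
     'a vfield \<Rightarrow> 'a vfield \<Rightarrow> 'a \<Rightarrow> real" where
  "ricci A g D X Y p =
     (let (\<epsilon>, E) = (SOME (\<epsilon>, E). \<exists>U. open_part A U \<and> p \<in> U \<and> orthonormal_frame A g U \<epsilon> E)
      in \<Sum>k<DIM('e). \<epsilon> k * g p (curvature A D X (E k) Y p) (E k p))"

definition einstein ::
    "('a::topological_space, 'e::euclidean_space) chart set \<Rightarrow> 'a metric \<Rightarrow> 'a connection \<Rightarrow>
     real \<Rightarrow> bool" where
  "einstein A g D \<alpha> \<longleftrightarrow>
     (\<forall>U X Y. open_part A U \<and> vector_field A U X \<and> vector_field A U Y \<longrightarrow>
        (\<forall>p\<in>U. ricci A g D X Y p = \<alpha> * g p (X p) (Y p)))"

section \<open>The warped product of an interval and a fibre\<close>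

abbreviation warped_atlas ::
    "real set \<Rightarrow> ('a, 'e) chart set \<Rightarrow> (real \<times> 'a, real \<times> 'e) chart set" where
  "warped_atlas I F \<equiv> product_atlas (interval_atlas I) F"

text \<open>The metric \<open>- dt^2 + f(t)^2 g\<^sub>F\<close>: the coordinate \<open>t\<close> is \<open>fst\<close>, so \<open>dt v = v fst\<close>, and
  \<open>g\<^sub>F\<close> is pulled back along the projection \<open>snd\<close>.\<close>

definition warped_metric ::
    "('a::topological_space, 'e::euclidean_space) chart set \<Rightarrow> (real \<Rightarrow> real) \<Rightarrow> 'a metric \<Rightarrow>
     (real \<times> 'a) metric" where
  "warped_metric F f gF = (\<lambda>p v w. - (v fst * w fst) +
     (f (fst p))\<^sup>2 * gF (snd p) (pushforward F snd p v) (pushforward F snd p w))"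

definition del_t ::
    "real set \<Rightarrow> ('a::topological_space, 'e::euclidean_space) chart set \<Rightarrow> (real \<times> 'a) vfield" where
  "del_t I F = (\<lambda>(t, x). velocity (warped_atlas I F) (\<lambda>s. (s, x)) t)"

end

theory Submission
  imports Defs
begin

text \<open>
  Write \<open>h = f'/f\<close>. The Koszul formula gives the Levi-Civita connection of the warped metric on
  \<open>\<partial>\<^sub>t\<close> and on lifts \<open>V, W\<close> of vector fields of the fibre, and hence
  \<open>D \<partial>\<^sub>t \<partial>\<^sub>t = (\<lambda>\<^sub>2 - \<lambda>\<^sub>1) \<partial>\<^sub>t\<close>, \<open>D \<partial>\<^sub>t V = h V\<close>, \<open>D V \<partial>\<^sub>t = (h - \<lambda>\<^sub>1) V\<close> and
  \<open>D V W = \<nabla>\<^sup>F V W + (h - \<lambda>\<^sub>2) g(V, W) \<partial>\<^sub>t\<close> for the quarter-symmetric connection \<open>D\<close>.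
  Since the Ricci tensor is tensorial and does not depend on the orthonormal frame, the Einstein
  condition reduces to these fields: the mixed components vanish, the \<open>\<partial>\<^sub>t \<partial>\<^sub>t\<close> component is a linear
  second-order equation for \<open>f\<close>, and the fibre components say that the fibre is Einstein with
  constant a quadratic form \<open>q(f, f')\<close>. Differentiating \<open>q(f, f')\<close> and substituting the linear equation
  gives a quadratic equation for \<open>h\<close> with constant coefficients. If \<open>\<lambda>\<^sub>1 \<noteq> \<lambda>\<^sub>2\<close>, its leading coefficient
  is nonzero, so the continuous function \<open>h\<close> takes finitely many values on an interval, is constant,
  and \<open>f\<close> is exponential; if \<open>\<lambda>\<^sub>1 = \<lambda>\<^sub>2\<close>, it forces \<open>\<alpha> = 0\<close> and \<open>f'' = \<lambda>\<^sub>1 f'\<close>.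
\<close>

section \<open>Calculus of smooth functions\<close>

text \<open>Of the connections only the axioms are known, so each vector is found by testing it:
  brackets against \<open>fst\<close> and functions pulled back from the fibre, covariant
  derivatives against \<open>dt\<close> and lifts. The coefficients that occur are locally products
  of a function of \<open>t\<close> and a function on the fibre, which keeps the two kinds of
  derivative apart. The constants of the four cases have one source. For
  \<open>f t = c * exp (k * t)\<close> solving the linear equation, the fibre equation collapses to
  \<open>\<alpha>F = (l * lam1^2 - lam2^2 - (l * lam1 - lam2) * k) * f^2\<close>. For
  \<open>k = 0\<close> this is case (1). For \<open>k \<noteq> 0\<close> the right side is constant
  only if the bracket vanishes, which gives \<open>\<alpha>F = 0\<close> and the rate of case (3);
  then \<open>\<alpha>\<close> follows from the characteristic polynomial
  \<open>k^2 - lam2 * k + lam1 * (lam2 - lam1) + \<alpha> / l\<close>. Case (4) is the situation in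
  which this rate is \<open>lam2 / 2\<close>, the double root. The coefficient
  \<open>l * lam1 - lam2\<close> cannot be zero here: the bracket would be
  \<open>l * (1 - l) * lam1^2\<close>.\<close>

lemma k_smooth_on_cong:
  assumes "open S" "\<And>x. x \<in> S \<Longrightarrow> f x = g x" "k_smooth_on k S f"
  shows "k_smooth_on k S g"
  using assms(2,3)
proof (induction k arbitrary: f g)
  case 0
  then show ?case
    using continuous_on_cong by force
next
  case (Suc k)
  have d: "f differentiable (at x)" if "x \<in> S" for x
    using Suc.prems(2) that by simp
  have eq: "frechet_derivative f (at x) = frechet_derivative g (at x)" if "x \<in> S" for x
    by (rule frechet_derivative_transform_within_open[OF d[OF that] assms(1) that])
      (use Suc.prems(1) in auto)
  have "g differentiable (at x)" if "x \<in> S" for x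
    using has_derivative_transform_within_open[OF _ assms(1) that, of f _ UNIV g] Suc.prems(1) d[OF that]
    unfolding differentiable_def by blast
  moreover have "k_smooth_on k S (\<lambda>x. frechet_derivative g (at x) v)" for v
    by (rule Suc.IH[of "\<lambda>x. frechet_derivative f (at x) v"]) (use eq Suc.prems(2) in auto)
  ultimately show ?case by simp
qed

text \<open>Frees later arguments from the chosen operator \<open>frechet_derivative\<close>: by
  uniqueness, any explicitly known derivative is the chosen one.\<close>

lemma k_smooth_on_SucI:
  assumes "open S" "\<And>x. x \<in> S \<Longrightarrow> (f has_derivative f' x) (at x)"
    "\<And>v. k_smooth_on k S (\<lambda>x. f' x v)"
  shows "k_smooth_on (Suc k) S f"
proof -
  have eq: "frechet_derivative f (at x) = f' x" if "x \<in> S" for x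
    using frechet_derivative_at[OF assms(2)[OF that]] by simp
  have "k_smooth_on k S (\<lambda>x. frechet_derivative f (at x) v)" for v
    by (rule k_smooth_on_cong[OF assms(1) _ assms(3)[of v]]) (simp add: eq)
  then show ?thesis
    using assms(2) by (auto simp: differentiable_def)
qed

lemma k_smooth_on_has_derivative:
  "k_smooth_on (Suc k) S f \<Longrightarrow> x \<in> S \<Longrightarrow> (f has_derivative frechet_derivative f (at x)) (at x)"
  using frechet_derivative_works by auto

lemma k_smooth_on_SucD: "k_smooth_on (Suc k) S f \<Longrightarrow> k_smooth_on k S f"
proof (induction k arbitrary: f)
  case 0
  then show ?case
    by (auto intro!: continuous_at_imp_continuous_on differentiable_imp_continuous_within)
qed auto

lemma k_smooth_on_subset: "k_smooth_on k S f \<Longrightarrow> T \<subseteq> S \<Longrightarrow> k_smooth_on k T f"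
  by (induction k arbitrary: f) (auto intro: continuous_on_subset)

text \<open>The derivative \<open>at x\<close> does not mention the set, so shrinking
  \<open>S\<close> leaves the derivative fields unchanged and the induction over \<open>k\<close>
  passes through.\<close>

lemma k_smooth_on_local:
  assumes "open S" "\<And>x. x \<in> S \<Longrightarrow> \<exists>T. open T \<and> x \<in> T \<and> k_smooth_on k (S \<inter> T) f"
  shows "k_smooth_on k S f"
  using assms(2)
proof (induction k arbitrary: f)
  case 0
  show ?case
    unfolding k_smooth_on.simps
  proof (intro continuous_at_imp_continuous_on ballI)
    fix x assume "x \<in> S"
    then obtain T where "open T" "x \<in> T" "continuous_on (S \<inter> T) f"
      using 0 by auto
    then show "isCont f x"
      using \<open>x \<in> S\<close> assms(1) continuous_on_eq_continuous_at[of "S \<inter> T"] by blast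
  qed
next
  case (Suc k)
  have "f differentiable (at x)" if "x \<in> S" for x
    using Suc.prems[OF that] that by auto
  moreover have "k_smooth_on k S (\<lambda>x. frechet_derivative f (at x) v)" for v
  proof (rule Suc.IH)
    fix x assume "x \<in> S"
    from Suc.prems[OF this] obtain T where "open T" "x \<in> T" "k_smooth_on (Suc k) (S \<inter> T) f"
      by blast
    then show "\<exists>T. open T \<and> x \<in> T \<and> k_smooth_on k (S \<inter> T) (\<lambda>x. frechet_derivative f (at x) v)"
      by auto
  qed
  ultimately show ?case by simp
qed

lemma k_smooth_on_const: "open S \<Longrightarrow> k_smooth_on k S (\<lambda>x. c)"
proof (induction k arbitrary: c)
  case (Suc k)
  show ?case
    by (rule k_smooth_on_SucI[OF Suc.prems has_derivative_const]) (rule Suc.IH[OF Suc.prems])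
qed simp

lemma k_smooth_on_bounded_linear:
  assumes "open S" "bounded_linear L"
  shows "k_smooth_on k S L"
proof (cases k)
  case 0
  then show ?thesis
    using assms(2) by (simp add: linear_continuous_on)
next
  case (Suc m)
  show ?thesis
    unfolding Suc
    by (rule k_smooth_on_SucI[OF assms(1) bounded_linear_imp_has_derivative[OF assms(2)]])
      (rule k_smooth_on_const[OF assms(1)])
qed

lemma k_smooth_on_add:
  assumes "open S" "k_smooth_on k S f" "k_smooth_on k S g"
  shows "k_smooth_on k S (\<lambda>x. f x + g x)"
  using assms(2,3)
proof (induction k arbitrary: f g)
  case 0
  then show ?case by (simp add: continuous_on_add)
next
  case (Suc k)
  show ?case
    by (rule k_smooth_on_SucI[OF assms(1) has_derivative_add[OF
          k_smooth_on_has_derivative[OF Suc.prems(1)] k_smooth_on_has_derivative[OF Suc.prems(2)]]])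
      (use Suc in auto)
qed

lemma k_smooth_on_sum:
  assumes "open S" "\<And>i. i \<in> K \<Longrightarrow> k_smooth_on k S (f i)"
  shows "k_smooth_on k S (\<lambda>x. \<Sum>i\<in>K. f i x)"
  using assms(2)
  by (induction K rule: infinite_finite_induct)
    (auto intro: k_smooth_on_const[OF assms(1)] k_smooth_on_add[OF assms(1)])

lemma k_smooth_on_scaleR:
  fixes u :: "'a::euclidean_space \<Rightarrow> real" and f :: "'a \<Rightarrow> 'b::euclidean_space"
  assumes "open S" "k_smooth_on k S u" "k_smooth_on k S f"
  shows "k_smooth_on k S (\<lambda>x. u x *\<^sub>R f x)"
  using assms(2,3)
proof (induction k arbitrary: u f)
  case 0
  then show ?case by (simp add: continuous_on_scaleR)
next
  case (Suc k)
  show ?case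
  proof (rule k_smooth_on_SucI[OF assms(1) has_derivative_scaleR[OF
          k_smooth_on_has_derivative[OF Suc.prems(1)] k_smooth_on_has_derivative[OF Suc.prems(2)]]])
    fix v
    show "k_smooth_on k S (\<lambda>x. u x *\<^sub>R frechet_derivative f (at x) v + frechet_derivative u (at x) v *\<^sub>R f x)"
      using Suc.prems k_smooth_on_SucD[OF Suc.prems(1)] k_smooth_on_SucD[OF Suc.prems(2)]
      by (intro k_smooth_on_add[OF assms(1)] Suc.IH) auto
  qed
qed

lemma k_smooth_on_inner_const:
  assumes "open S" "k_smooth_on k S f"
  shows "k_smooth_on k S (\<lambda>x. f x \<bullet> b)"
  using assms(2)
proof (induction k arbitrary: f)
  case 0
  then show ?case by (auto intro: continuous_intros)
next
  case (Suc k)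
  show ?case
    by (rule k_smooth_on_SucI[OF assms(1) has_derivative_inner_left[OF
          k_smooth_on_has_derivative[OF Suc.prems]]]) (use Suc in auto)
qed

lemma linear_expand:
  fixes L :: "'a::euclidean_space \<Rightarrow> 'b::euclidean_space"
  assumes "linear L"
  shows "L v = (\<Sum>b\<in>Basis. (v \<bullet> b) *\<^sub>R L b)"
proof -
  have "L v = L (\<Sum>b\<in>Basis. (v \<bullet> b) *\<^sub>R b)"
    by (simp add: euclidean_representation)
  then show ?thesis
    using assms by (simp add: linear_sum linear_cmul)
qed

lemma k_smooth_on_compose:
  fixes f :: "'a::euclidean_space \<Rightarrow> 'b::euclidean_space" and g :: "'b \<Rightarrow> 'c::euclidean_space"
  assumes "open S" "open T" "f ` S \<subseteq> T" "k_smooth_on k S f" "k_smooth_on k T g"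
  shows "k_smooth_on k S (\<lambda>x. g (f x))"
  using assms(4,5)
proof (induction k arbitrary: g)
  case 0
  then show ?case
    using continuous_on_compose2[OF _ _ assms(3)] by auto
next
  case (Suc k)
  let ?f' = "\<lambda>x. frechet_derivative f (at x)" and ?g' = "\<lambda>y. frechet_derivative g (at y)"
  have gd: "(g has_derivative ?g' (f x)) (at (f x))" if "x \<in> S" for x
    using k_smooth_on_has_derivative[OF Suc.prems(2)] that assms(3) by auto
  have d: "((\<lambda>x. g (f x)) has_derivative (\<lambda>v. ?g' (f x) (?f' x v))) (at x)" if "x \<in> S" for x
    using has_derivative_compose[OF k_smooth_on_has_derivative[OF Suc.prems(1) that] gd[OF that]] .
  \<comment> \<open>The direction fed into the derivative of \<open>g\<close> varies with
    \<open>x\<close>, while \<open>k_smooth_on\<close> speaks of fixed directions. Expanding it in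
    the basis separates the two dependences.\<close>
  have "k_smooth_on k S (\<lambda>x. \<Sum>b\<in>Basis. (?f' x v \<bullet> b) *\<^sub>R ?g' (f x) b)" for v
    using Suc.prems k_smooth_on_SucD[OF Suc.prems(1)]
    by (intro k_smooth_on_sum k_smooth_on_scaleR k_smooth_on_inner_const assms(1) Suc.IH) auto
  then have "k_smooth_on k S (\<lambda>x. ?g' (f x) (?f' x v))" for v
    by (rule k_smooth_on_cong[OF assms(1), rotated])
      (rule linear_expand[symmetric], rule has_derivative_linear, erule gd)
  from k_smooth_on_SucI[OF assms(1) d this] show ?case
    by simp
qed

lemma k_smooth_on_Pair:
  assumes "open S" "k_smooth_on k S f" "k_smooth_on k S g"
  shows "k_smooth_on k S (\<lambda>x. (f x, g x))"
  using assms(2,3)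
proof (induction k arbitrary: f g)
  case 0
  then show ?case by (simp add: continuous_on_Pair)
next
  case (Suc k)
  show ?case
    by (rule k_smooth_on_SucI[OF assms(1) has_derivative_Pair[OF
          k_smooth_on_has_derivative[OF Suc.prems(1)] k_smooth_on_has_derivative[OF Suc.prems(2)]]])
      (use Suc in auto)
qed

text \<open>The exponent is kept arbitrary so that the induction can pass from \<open>a\<close> to
  \<open>a - 1\<close>. The exponents used later are \<open>-1\<close>, for reciprocals, and
  \<open>-1/2\<close>, for normalising a field.\<close>

lemma k_smooth_on_powr: "k_smooth_on k {0<..} (\<lambda>x::real. x powr a)"
proof (induction k arbitrary: a)
  case 0
  show ?case by (auto intro!: continuous_intros)
next
  case (Suc k)
  have d: "((\<lambda>x. x powr a) has_derivative (\<lambda>v. (a * v) *\<^sub>R x powr (a - 1))) (at x)"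
    if "x \<in> {0<..}" for x :: real
    using that by (auto intro!: derivative_eq_intros simp: powr_diff)
  show ?case
    by (rule k_smooth_on_SucI[OF _ d])
      (use Suc in \<open>auto intro!: k_smooth_on_scaleR k_smooth_on_const simp del: real_scaleR_def\<close>)
qed

section \<open>Functions smooth to every order\<close>

lemma smooth_onD: "smooth_on S f \<Longrightarrow> k_smooth_on k S f"
  by (simp add: smooth_on_def)

lemma smooth_on_imp_continuous_on: "smooth_on S f \<Longrightarrow> continuous_on S f"
  using smooth_onD[where k=0] by auto

lemma smooth_on_imp_differentiable: "smooth_on S f \<Longrightarrow> x \<in> S \<Longrightarrow> f differentiable (at x)"
  using smooth_onD[where k="Suc 0"] by auto

lemma smooth_on_has_derivative:
  "smooth_on S f \<Longrightarrow> x \<in> S \<Longrightarrow> (f has_derivative frechet_derivative f (at x)) (at x)"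
  using smooth_on_imp_differentiable frechet_derivative_works by blast

lemma smooth_on_frechet_derivative:
  "smooth_on S f \<Longrightarrow> smooth_on S (\<lambda>x. frechet_derivative f (at x) v)"
  unfolding smooth_on_def by (metis k_smooth_on.simps(2))

lemma smooth_on_cong:
  "open S \<Longrightarrow> (\<And>x. x \<in> S \<Longrightarrow> f x = g x) \<Longrightarrow> smooth_on S f \<Longrightarrow> smooth_on S g"
  unfolding smooth_on_def using k_smooth_on_cong by blast

lemma smooth_on_subset: "smooth_on S f \<Longrightarrow> T \<subseteq> S \<Longrightarrow> smooth_on T f"
  unfolding smooth_on_def using k_smooth_on_subset by blast

lemma smooth_on_local:
  assumes "open S" "\<And>x. x \<in> S \<Longrightarrow> \<exists>T. open T \<and> x \<in> T \<and> smooth_on (S \<inter> T) f"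
  shows "smooth_on S f"
  unfolding smooth_on_def using k_smooth_on_local[OF assms(1)] assms(2) smooth_onD by metis

lemma smooth_on_compose:
  fixes f :: "'a::euclidean_space \<Rightarrow> 'b::euclidean_space" and g :: "'b \<Rightarrow> 'c::euclidean_space"
  assumes "open S" "open T" "f ` S \<subseteq> T" "smooth_on S f" "smooth_on T g"
  shows "smooth_on S (\<lambda>x. g (f x))"
  unfolding smooth_on_def
  using k_smooth_on_compose[OF assms(1-3) smooth_onD[OF assms(4)] smooth_onD[OF assms(5)]] by blast

lemma
  assumes "open S"
  shows smooth_on_const: "smooth_on S (\<lambda>x. c)"
    and smooth_on_bounded_linear: "bounded_linear L \<Longrightarrow> smooth_on S L"
    and smooth_on_add: "smooth_on S f \<Longrightarrow> smooth_on S g \<Longrightarrow> smooth_on S (\<lambda>x. f x + g x)"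
    and smooth_on_scaleR: "smooth_on S u \<Longrightarrow> smooth_on S f \<Longrightarrow> smooth_on S (\<lambda>x. u x *\<^sub>R f x)"
    and smooth_on_Pair: "smooth_on S p \<Longrightarrow> smooth_on S q \<Longrightarrow> smooth_on S (\<lambda>x. (p x, q x))"
  using assms
  by (simp_all add: smooth_on_def k_smooth_on_const k_smooth_on_bounded_linear k_smooth_on_add
      k_smooth_on_scaleR k_smooth_on_Pair)

lemma smooth_on_mult:
  fixes u v :: "'a::euclidean_space \<Rightarrow> real"
  shows "open S \<Longrightarrow> smooth_on S u \<Longrightarrow> smooth_on S v \<Longrightarrow> smooth_on S (\<lambda>x. u x * v x)"
  using smooth_on_scaleR[of S u v] by simp

lemma smooth_on_powr:
  assumes "open S" "smooth_on S u" "\<And>x. x \<in> S \<Longrightarrow> u x > (0::real)"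
  shows "smooth_on S (\<lambda>x. u x powr a)"
  by (rule smooth_on_compose[OF assms(1), of "{0<..}" u "\<lambda>x. x powr a"])
    (use assms in \<open>auto simp: smooth_on_def k_smooth_on_powr\<close>)

section \<open>Smooth functions and tangent vectors in charts\<close>

text \<open>The field with constant components \<open>w\<close> in the chart \<open>c\<close>. It
  takes the same default value \<open>0\<close> as \<open>velocity\<close>, so that the two can be
  equal as HOL functions.\<close>

definition coordinate_field ::
  "('a::topological_space, 'e::euclidean_space) chart set \<Rightarrow> ('a, 'e) chart \<Rightarrow> 'e \<Rightarrow> 'a vfield" where
  "coordinate_field A c w = (\<lambda>q h. if smooth_near A q h
     then frechet_derivative (h \<circ> inv_into (fst c) (snd c)) (at (snd c q)) w else 0)"

lemma open_part_Int: "open_part A U \<Longrightarrow> open_part A V \<Longrightarrow> open_part A (U \<inter> V)"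
  by (auto simp: open_part_def)

lemma open_part_Int_open: "open_part A U \<Longrightarrow> open V \<Longrightarrow> open_part A (U \<inter> V)"
  by (auto simp: open_part_def)

lemma smooth_function_subset: "smooth_function A W h \<Longrightarrow> T \<subseteq> W \<Longrightarrow> smooth_function A T h"
  unfolding smooth_function_def by (fast intro: smooth_on_subset)

lemma smooth_nearI: "open_part A W \<Longrightarrow> p \<in> W \<Longrightarrow> smooth_function A W h \<Longrightarrow> smooth_near A p h"
  by (auto simp: smooth_near_def)

lemma vector_field_subset: "vector_field A U X \<Longrightarrow> V \<subseteq> U \<Longrightarrow> vector_field A V X"
  unfolding vector_field_def by (meson subset_eq order_trans)

lemma vector_fieldD: "vector_field A U X \<Longrightarrow> p \<in> U \<Longrightarrow> X p \<in> tangent_space A p"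
  by (simp add: vector_field_def)

lemma vector_field_smooth_function:
  "vector_field A U X \<Longrightarrow> open V \<Longrightarrow> V \<subseteq> U \<Longrightarrow> smooth_function A V h \<Longrightarrow> smooth_function A V (\<lambda>p. X p h)"
  by (simp add: vector_field_def)

locale manifold_atlas =
  fixes A :: "('a::{t2_space,second_countable_topology}, 'e::euclidean_space) chart set"
  assumes smooth_manifold: "smooth_manifold A"
begin

lemma
  assumes "(U, \<phi>) \<in> A"
  shows open_chart: "open U" and open_chart_image: "open (\<phi> ` U)" and inj_chart: "inj_on \<phi> U"
    and continuous_chart: "continuous_on U \<phi>"
    and continuous_inv_chart: "continuous_on (\<phi> ` U) (inv_into U \<phi>)"
    and chart_subset_points: "U \<subseteq> points A"
proof -
  have *: "is_chart (U, \<phi>)"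
    using assms smooth_manifold by (auto simp: smooth_manifold_def)
  show "open U" "open (\<phi> ` U)"
    using * by (auto simp: is_chart_def)
  obtain \<psi> where h: "homeomorphism U (\<phi> ` U) \<phi> \<psi>"
    using * by (auto simp: is_chart_def)
  show inj: "inj_on \<phi> U"
    using h by (auto simp: homeomorphism_def intro: inj_on_inverseI)
  show "continuous_on U \<phi>"
    using h by (simp add: homeomorphism_def)
  have "continuous_on (\<phi> ` U) \<psi>"
    using h by (simp add: homeomorphism_def)
  moreover have "\<psi> y = inv_into U \<phi> y" if "y \<in> \<phi> ` U" for y
    using that inj h by (auto simp: homeomorphism_def)
  ultimately show "continuous_on (\<phi> ` U) (inv_into U \<phi>)"
    using continuous_on_cong by force
  show "U \<subseteq> points A"
    using assms by (force simp: points_def)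
qed

lemma chart_inv [simp]: "(U, \<phi>) \<in> A \<Longrightarrow> p \<in> U \<Longrightarrow> inv_into U \<phi> (\<phi> p) = p"
  using inj_chart by simp

lemma open_part_chart: "(U, \<phi>) \<in> A \<Longrightarrow> open_part A U"
  using open_chart chart_subset_points by (simp add: open_part_def)

lemma open_part_all: "open_part A (points A)"
  using open_chart unfolding open_part_def points_def by (auto intro!: open_UN simp: split_def)

lemma chart_at:
  assumes "p \<in> points A"
  obtains U \<phi> where "(U, \<phi>) \<in> A" "p \<in> U"
  using assms by (force simp: points_def)

lemma open_part_points: "open_part A W \<Longrightarrow> p \<in> W \<Longrightarrow> p \<in> points A"
  by (auto simp: open_part_def)

lemma open_chart_image_Int:
  assumes "(U, \<phi>) \<in> A" "open W"
  shows "open (\<phi> ` (W \<inter> U))"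
proof -
  have "\<phi> ` (W \<inter> U) = inv_into U \<phi> -` W \<inter> \<phi> ` U"
    using chart_inv[OF assms(1)] by auto
  then show ?thesis
    using continuous_open_preimage[OF continuous_inv_chart[OF assms(1)] open_chart_image[OF assms(1)] assms(2)]
    by (simp add: Int_commute)
qed

lemma smooth_transition:
  assumes "(U, \<phi>) \<in> A" "(V, \<psi>) \<in> A"
  shows "smooth_on (\<phi> ` (U \<inter> V)) (\<psi> \<circ> inv_into U \<phi>)"
  using assms smooth_manifold by (force simp: smooth_manifold_def smoothly_compatible_def)

text \<open>\<open>smooth_function\<close> quantifies over all charts. Smooth transition maps carry
  smoothness from one chart around each point to all the others.\<close>

lemma smooth_functionI:
  assumes "open W" "\<And>p. p \<in> W \<Longrightarrow> \<exists>U \<phi> N. (U, \<phi>) \<in> A \<and> open N \<and> p \<in> N \<and> p \<in> U \<and>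
      smooth_on (\<phi> ` ((W \<inter> N) \<inter> U)) (h \<circ> inv_into U \<phi>)"
  shows "smooth_function A W h"
  unfolding smooth_function_def
proof safe
  fix V \<psi> assume V: "(V, \<psi>) \<in> A"
  show "smooth_on (\<psi> ` (W \<inter> V)) (h \<circ> inv_into V \<psi>)"
  proof (rule smooth_on_local)
    show "open (\<psi> ` (W \<inter> V))"
      by (rule open_chart_image_Int[OF V assms(1)])
    fix y assume "y \<in> \<psi> ` (W \<inter> V)"
    then obtain p where p: "y = \<psi> p" "p \<in> W" "p \<in> V" by auto
    obtain U \<phi> N where U: "(U, \<phi>) \<in> A" and N: "open N" "p \<in> N" "p \<in> U"
      and sm: "smooth_on (\<phi> ` ((W \<inter> N) \<inter> U)) (h \<circ> inv_into U \<phi>)"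
      using assms(2)[OF p(2)] by blast
    let ?T = "\<psi> ` ((N \<inter> U) \<inter> V)"
    have T: "open ?T"
      using V N(1) open_chart[OF U] by (intro open_chart_image_Int) auto
    have ST: "\<psi> ` (W \<inter> V) \<inter> ?T = \<psi> ` ((W \<inter> N \<inter> U) \<inter> V)"
      using inj_chart[OF V] by (auto simp: inj_on_def)
    have "smooth_on (\<psi> ` ((W \<inter> N \<inter> U) \<inter> V)) (\<lambda>x. (h \<circ> inv_into U \<phi>) ((\<phi> \<circ> inv_into V \<psi>) x))"
    proof (rule smooth_on_compose[OF _ _ _ _ sm])
      show "open (\<psi> ` ((W \<inter> N \<inter> U) \<inter> V))" "open (\<phi> ` ((W \<inter> N) \<inter> U))"
        using U V N(1) assms(1) open_chart[OF U] by (auto intro!: open_chart_image_Int)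
      show "(\<phi> \<circ> inv_into V \<psi>) ` \<psi> ` ((W \<inter> N \<inter> U) \<inter> V) \<subseteq> \<phi> ` (W \<inter> N \<inter> U)"
        using V by auto
      show "smooth_on (\<psi> ` ((W \<inter> N \<inter> U) \<inter> V)) (\<phi> \<circ> inv_into V \<psi>)"
        by (rule smooth_on_subset[OF smooth_transition[OF V U]]) auto
    qed
    then have "smooth_on (\<psi> ` (W \<inter> V) \<inter> ?T) (h \<circ> inv_into V \<psi>)"
      unfolding ST
      by (rule smooth_on_cong[rotated 2])
        (use U V N(1) assms(1) open_chart[OF U] in \<open>auto intro!: open_chart_image_Int\<close>)
    then show "\<exists>T. open T \<and> y \<in> T \<and> smooth_on (\<psi> ` (W \<inter> V) \<inter> T) (h \<circ> inv_into V \<psi>)"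
      using T p N by blast
  qed
qed

lemma smooth_function_local:
  assumes "open_part A W" "\<And>p. p \<in> W \<Longrightarrow> \<exists>N. open N \<and> p \<in> N \<and> smooth_function A (W \<inter> N) h"
  shows "smooth_function A W h"
proof (rule smooth_functionI)
  show "open W" using assms(1) by (simp add: open_part_def)
  fix p assume p: "p \<in> W"
  obtain U \<phi> where U: "(U, \<phi>) \<in> A" "p \<in> U"
    using chart_at[OF open_part_points[OF assms(1) p]] .
  obtain N where "open N" "p \<in> N" "smooth_function A (W \<inter> N) h"
    using assms(2)[OF p] by blast
  then show "\<exists>U \<phi> N. (U, \<phi>) \<in> A \<and> open N \<and> p \<in> N \<and> p \<in> U \<and>
      smooth_on (\<phi> ` ((W \<inter> N) \<inter> U)) (h \<circ> inv_into U \<phi>)"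
    using U unfolding smooth_function_def by blast
qed

lemma smooth_function_cong:
  assumes "open W" "\<And>p. p \<in> W \<Longrightarrow> h p = k p" "smooth_function A W h"
  shows "smooth_function A W k"
  unfolding smooth_function_def
proof safe
  fix V \<psi> assume V: "(V, \<psi>) \<in> A"
  have "smooth_on (\<psi> ` (W \<inter> V)) (h \<circ> inv_into V \<psi>)"
    using V assms(3) by (auto simp: smooth_function_def)
  then show "smooth_on (\<psi> ` (W \<inter> V)) (k \<circ> inv_into V \<psi>)"
    by (rule smooth_on_cong[OF open_chart_image_Int[OF V assms(1)], rotated])
      (use V assms(2) in auto)
qed

lemma smooth_function_const: "open W \<Longrightarrow> smooth_function A W (\<lambda>p. c)"
  by (auto simp: smooth_function_def o_def intro!: smooth_on_const open_chart_image_Int)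

lemma smooth_function_add:
  "open W \<Longrightarrow> smooth_function A W h \<Longrightarrow> smooth_function A W k \<Longrightarrow> smooth_function A W (\<lambda>p. h p + k p)"
  unfolding smooth_function_def o_def
  by (fast intro: smooth_on_add open_chart_image_Int)

lemma smooth_function_mult:
  "open W \<Longrightarrow> smooth_function A W h \<Longrightarrow> smooth_function A W k \<Longrightarrow> smooth_function A W (\<lambda>p. h p * k p)"
  unfolding smooth_function_def o_def
  by (fast intro: smooth_on_mult open_chart_image_Int)

lemma smooth_function_cmult:
  "open W \<Longrightarrow> smooth_function A W h \<Longrightarrow> smooth_function A W (\<lambda>p. c * h p)"
  by (intro smooth_function_mult smooth_function_const)

lemma smooth_function_sum:
  "open W \<Longrightarrow> (\<And>i. i \<in> K \<Longrightarrow> smooth_function A W (h i)) \<Longrightarrow> smooth_function A W (\<lambda>p. \<Sum>i\<in>K. h i p)"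
  by (induction K rule: infinite_finite_induct)
    (auto intro: smooth_function_const smooth_function_add)

lemma smooth_function_powr:
  assumes "open W" "smooth_function A W h" "\<And>p. p \<in> W \<Longrightarrow> h p > 0"
  shows "smooth_function A W (\<lambda>p. h p powr a)"
  unfolding smooth_function_def o_def
proof safe
  fix V \<psi> assume V: "(V, \<psi>) \<in> A"
  have "smooth_on (\<psi> ` (W \<inter> V)) (\<lambda>x. h (inv_into V \<psi> x))"
    using V assms(2) by (auto simp: smooth_function_def o_def)
  then show "smooth_on (\<psi> ` (W \<inter> V)) (\<lambda>x. h (inv_into V \<psi> x) powr a)"
    by (rule smooth_on_powr[OF open_chart_image_Int[OF V assms(1)]]) (use V assms(3) in auto)
qed

lemma smooth_function_coord:
  assumes "(U, \<phi>) \<in> A"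
  shows "smooth_function A U (\<lambda>q. \<phi> q \<bullet> b)"
proof (rule smooth_functionI)
  show "open U" by (rule open_chart[OF assms])
  fix p assume "p \<in> U"
  have "smooth_on (\<phi> ` U) (\<lambda>y. y \<bullet> b)"
    by (rule smooth_on_bounded_linear[OF open_chart_image[OF assms] bounded_linear_inner_left])
  then have "smooth_on (\<phi> ` U) ((\<lambda>q. \<phi> q \<bullet> b) \<circ> inv_into U \<phi>)"
    by (rule smooth_on_cong[OF open_chart_image[OF assms], rotated]) (use assms in auto)
  then show "\<exists>V \<psi> N. (V, \<psi>) \<in> A \<and> open N \<and> p \<in> N \<and> p \<in> V \<and>
      smooth_on (\<psi> ` (U \<inter> N \<inter> V)) ((\<lambda>q. \<phi> q \<bullet> b) \<circ> inv_into V \<psi>)"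
    using \<open>p \<in> U\<close> assms by (intro exI[of _ U] exI[of _ \<phi>] exI[of _ UNIV]) auto
qed

text \<open>Needed in the Gram-Schmidt step, where positivity of a smooth function has to be an open
  condition.\<close>

lemma smooth_function_continuous:
  assumes "open_part A W" "smooth_function A W h"
  shows "continuous_on W h"
proof (rule continuous_at_imp_continuous_on, safe)
  fix p assume p: "p \<in> W"
  obtain U \<phi> where U: "(U, \<phi>) \<in> A" "p \<in> U"
    using chart_at[OF open_part_points[OF assms(1) p]] .
  have o: "open (W \<inter> U)"
    using assms(1) open_chart[OF U(1)] by (auto simp: open_part_def)
  have "continuous_on (\<phi> ` (W \<inter> U)) (h \<circ> inv_into U \<phi>)"
    using U assms(2) smooth_on_imp_continuous_on unfolding smooth_function_def by fast
  moreover have "continuous_on (W \<inter> U) \<phi>"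
    using continuous_chart[OF U(1)] continuous_on_subset by blast
  ultimately have "continuous_on (W \<inter> U) ((h \<circ> inv_into U \<phi>) \<circ> \<phi>)"
    by (rule continuous_on_compose[rotated])
  then have "continuous_on (W \<inter> U) h"
    by (rule continuous_on_eq) (use U in auto)
  then show "isCont h p"
    using o p U continuous_on_eq_continuous_at by blast
qed

section \<open>Functions smooth near a point\<close>

lemma smooth_near_points: "smooth_near A p h \<Longrightarrow> p \<in> points A"
  by (auto simp: smooth_near_def open_part_def)

lemma smooth_near_cong:
  assumes "open N" "p \<in> N" "\<And>q. q \<in> N \<Longrightarrow> h q = k q" "smooth_near A p h"
  shows "smooth_near A p k"
proof -
  obtain W where W: "open_part A W" "p \<in> W" "smooth_function A W h"
    using assms(4) by (auto simp: smooth_near_def)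
  have "smooth_function A (W \<inter> N) k"
    by (rule smooth_function_cong[of _ h])
      (use W assms(1,3) smooth_function_subset[OF W(3)] in \<open>auto simp: open_part_def\<close>)
  then show ?thesis
    using W assms(1,2) by (intro smooth_nearI[of _ "W \<inter> N"] open_part_Int_open) auto
qed

lemma smooth_near_const: "p \<in> points A \<Longrightarrow> smooth_near A p (\<lambda>q. c)"
  by (elim chart_at) (rule smooth_nearI[OF open_part_chart _ smooth_function_const[OF open_chart]])

lemma smooth_near2:
  assumes "smooth_near A p h" "smooth_near A p k"
  obtains W where "open_part A W" "open W" "p \<in> W" "smooth_function A W h" "smooth_function A W k"
proof -
  obtain V W where V: "open_part A V" "p \<in> V" "smooth_function A V h"
    and W: "open_part A W" "p \<in> W" "smooth_function A W k"
    using assms by (auto simp: smooth_near_def)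
  then show thesis
    by (intro that[of "V \<inter> W"] open_part_Int smooth_function_subset[OF V(3)] smooth_function_subset[OF W(3)])
      (auto simp: open_part_def)
qed

lemma smooth_near_add: "smooth_near A p h \<Longrightarrow> smooth_near A p k \<Longrightarrow> smooth_near A p (\<lambda>q. h q + k q)"
  by (erule (1) smooth_near2) (auto intro: smooth_function_add smooth_nearI)

lemma smooth_near_mult: "smooth_near A p h \<Longrightarrow> smooth_near A p k \<Longrightarrow> smooth_near A p (\<lambda>q. h q * k q)"
  by (erule (1) smooth_near2) (auto intro: smooth_function_mult smooth_nearI)

lemma smooth_near_vector_field:
  assumes "open_part A U" "p \<in> U" "vector_field A U X" "smooth_near A p h"
  shows "smooth_near A p (\<lambda>q. X q h)"
proof -
  obtain W where W: "open_part A W" "p \<in> W" "smooth_function A W h"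
    using assms(4) by (auto simp: smooth_near_def)
  have "smooth_function A (W \<inter> U) (\<lambda>q. X q h)"
    by (rule vector_field_smooth_function[OF assms(3)])
      (use W assms(1) smooth_function_subset[OF W(3)] in \<open>auto simp: open_part_def\<close>)
  then show ?thesis
    using W assms(1,2) by (intro smooth_nearI[of _ "W \<inter> U"] open_part_Int) auto
qed

lemma smooth_near_has_derivative:
  assumes "(U, \<phi>) \<in> A" "p \<in> U" "smooth_near A p h"
  shows "((h \<circ> inv_into U \<phi>) has_derivative frechet_derivative (h \<circ> inv_into U \<phi>) (at (\<phi> p))) (at (\<phi> p))"
proof -
  obtain W where W: "open_part A W" "p \<in> W" "smooth_function A W h"
    using assms(3) by (auto simp: smooth_near_def)
  have "smooth_on (\<phi> ` (W \<inter> U)) (h \<circ> inv_into U \<phi>)"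
    using W(3) assms(1) by (auto simp: smooth_function_def)
  then show ?thesis
    by (rule smooth_on_has_derivative) (use W assms in auto)
qed

lemma coordinate_field_linear:
  assumes "(U, \<phi>) \<in> A" "p \<in> U"
  shows "linear (\<lambda>w. coordinate_field A (U, \<phi>) w p h)"
proof (cases "smooth_near A p h")
  case True
  then show ?thesis
    using has_derivative_linear[OF smooth_near_has_derivative[OF assms True]]
    by (simp add: coordinate_field_def)
next
  case False
  then show ?thesis
    by (simp add: coordinate_field_def linear_iff)
qed

text \<open>The coordinate functions recover the components, so \<open>w\<close> is determined by
  the vector it defines.\<close>

lemma coordinate_field_coord:
  assumes "(U, \<phi>) \<in> A" "p \<in> U"
  shows "coordinate_field A (U, \<phi>) w p (\<lambda>q. \<phi> q \<bullet> b) = w \<bullet> b"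
proof -
  have "((\<lambda>q. \<phi> q \<bullet> b) \<circ> inv_into U \<phi> has_derivative (\<lambda>w. w \<bullet> b)) (at (\<phi> p))"
    by (rule has_derivative_transform_within_open[OF _ open_chart_image[OF assms(1)], of "\<lambda>y. y \<bullet> b"])
      (use assms in \<open>auto intro!: derivative_eq_intros\<close>)
  moreover have "smooth_near A p (\<lambda>q. \<phi> q \<bullet> b)"
    by (rule smooth_nearI[OF open_part_chart[OF assms(1)] assms(2) smooth_function_coord[OF assms(1)]])
  ultimately show ?thesis
    by (simp add: coordinate_field_def frechet_derivative_at[symmetric])
qed

text \<open>Chain rule, after factoring \<open>h\<close> along the curve through the chart: the
  velocity depends on the curve only through the derivative of its coordinate expression.\<close>

lemma velocity_eq_coordinate_field:
  assumes "smooth_curve A J \<gamma>" "open J" "s \<in> J" "(U, \<phi>) \<in> A" "\<gamma> s \<in> U"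
  shows "velocity A \<gamma> s = coordinate_field A (U, \<phi>) (frechet_derivative (\<phi> \<circ> \<gamma>) (at s) 1) (\<gamma> s)"
proof
  fix h
  show "velocity A \<gamma> s h = coordinate_field A (U, \<phi>) (frechet_derivative (\<phi> \<circ> \<gamma>) (at s) 1) (\<gamma> s) h"
  proof (cases "smooth_near A (\<gamma> s) h")
    case True
    let ?N = "{s \<in> J. \<gamma> s \<in> U}"
    have cont: "continuous_on J \<gamma>"
      using assms(1) by (simp add: smooth_curve_def)
    have "?N = J \<inter> \<gamma> -` U" by auto
    then have oN: "open ?N"
      using continuous_open_preimage[OF cont assms(2) open_chart[OF assms(4)]] by simp
    have "smooth_on ?N (\<phi> \<circ> \<gamma>)"
      using assms(1,4) by (auto simp: smooth_curve_def)
    then have d1: "((\<phi> \<circ> \<gamma>) has_derivative frechet_derivative (\<phi> \<circ> \<gamma>) (at s)) (at s)"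
      by (rule smooth_on_has_derivative) (use assms in auto)
    let ?f' = "frechet_derivative (\<phi> \<circ> \<gamma>) (at s)"
    let ?h' = "frechet_derivative (h \<circ> inv_into U \<phi>) (at (\<phi> (\<gamma> s)))"
    have "((h \<circ> inv_into U \<phi>) has_derivative ?h') (at ((\<phi> \<circ> \<gamma>) s))"
      using smooth_near_has_derivative[OF assms(4,5) True] by simp
    note d2 = has_derivative_compose[OF d1 this]
    have d3: "((h \<circ> \<gamma>) has_derivative (\<lambda>t. ?h' (?f' t))) (at s)"
      by (rule has_derivative_transform_within_open[OF d2 oN]) (use assms in auto)
    have lin: "linear (\<lambda>t. ?h' (?f' t))"
      by (rule has_derivative_linear[OF d3])
    have "r * ?h' (?f' 1) = ?h' (?f' r)" for r
      using linear_cmul[OF lin, of r 1] by (metis mult.right_neutral real_scaleR_def)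
    then have "((h \<circ> \<gamma>) has_field_derivative ?h' (?f' 1)) (at s)"
      by (rule has_derivative_imp_has_field_derivative[OF d3])
    then show ?thesis
      using True by (simp add: velocity_def coordinate_field_def DERIV_imp_deriv)
  qed (simp add: velocity_def coordinate_field_def)
qed

text \<open>The vector is the velocity of the curve that is a straight line in the chart, run for so
  short a time that it stays in the chart image.\<close>

lemma coordinate_field_in_tangent_space:
  assumes U: "(U, \<phi>) \<in> A" and p: "p \<in> U"
  shows "coordinate_field A (U, \<phi>) w p \<in> tangent_space A p"
proof -
  let ?\<gamma> = "\<lambda>s. inv_into U \<phi> (\<phi> p + s *\<^sub>R w)"
  have "open ((\<lambda>s. \<phi> p + s *\<^sub>R w) -` (\<phi> ` U))"
    by (intro open_vimage open_chart_image[OF U] continuous_intros)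
  then obtain \<epsilon> where \<epsilon>: "\<epsilon> > 0" "ball 0 \<epsilon> \<subseteq> (\<lambda>s. \<phi> p + s *\<^sub>R w) -` (\<phi> ` U)"
    using p by (metis (no_types, lifting) add.right_neutral image_eqI open_contains_ball scale_zero_left vimageI2)
  let ?J = "{-\<epsilon><..<\<epsilon>}"
  have inU: "\<phi> p + s *\<^sub>R w \<in> \<phi> ` U" if "s \<in> ?J" for s
    using \<epsilon>(2) that by (auto simp: subset_iff dist_real_def)
  have cont: "continuous_on ?J ?\<gamma>"
    by (rule continuous_on_compose2[OF continuous_inv_chart[OF U]])
      (use inU in \<open>auto intro!: continuous_intros\<close>)
  have \<gamma>U: "?\<gamma> s \<in> U" "\<phi> (?\<gamma> s) = \<phi> p + s *\<^sub>R w" if "s \<in> ?J" for s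
    using inU[OF that] U by (auto simp: f_inv_into_f intro: inv_into_into)
  have smooth: "smooth_curve A ?J ?\<gamma>"
    unfolding smooth_curve_def
  proof (intro conjI cont ballI, goal_cases)
    case 1
    then show ?case using \<gamma>U(1) chart_subset_points[OF U] by blast
  next
    case (2 c)
    obtain V \<psi> where c: "c = (V, \<psi>)" by fastforce
    have V: "(V, \<psi>) \<in> A" using 2 c by simp
    let ?S = "{s \<in> ?J. ?\<gamma> s \<in> V}"
    have "?S = ?J \<inter> ?\<gamma> -` V" by auto
    then have oS: "open ?S"
      using continuous_open_preimage[OF cont open_greaterThanLessThan open_chart[OF V]] by simp
    have "smooth_on ?S (\<lambda>s. (\<psi> \<circ> inv_into U \<phi>) (\<phi> p + s *\<^sub>R w))"
    proof (rule smooth_on_compose[OF oS _ _ _ smooth_transition[OF U V]])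
      show "open (\<phi> ` (U \<inter> V))"
        using open_chart_image_Int[OF U open_chart[OF V]] by (simp add: Int_commute)
      show "smooth_on ?S (\<lambda>s. \<phi> p + s *\<^sub>R w)"
        by (intro smooth_on_add smooth_on_const smooth_on_bounded_linear oS bounded_linear_scaleR_left)
      show "(\<lambda>s. \<phi> p + s *\<^sub>R w) ` ?S \<subseteq> \<phi> ` (U \<inter> V)"
      proof safe
        fix s assume s: "s \<in> ?J" "?\<gamma> s \<in> V"
        show "\<phi> p + s *\<^sub>R w \<in> \<phi> ` (U \<inter> V)"
          using \<gamma>U[OF s(1)] s(2) by (intro image_eqI[of _ _ "?\<gamma> s"]) auto
      qed
    qed
    then show ?case
      by (simp add: c o_def)
  qed
  have 0: "?\<gamma> 0 = p"
    using U p by simp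
  have "((\<phi> \<circ> ?\<gamma>) has_derivative (\<lambda>s. s *\<^sub>R w)) (at 0)"
    by (rule has_derivative_transform_within_open[of "\<lambda>s. \<phi> p + s *\<^sub>R w" _ _ _ ?J])
      (use \<gamma>U \<epsilon> in \<open>auto intro!: derivative_eq_intros\<close>)
  then have "frechet_derivative (\<phi> \<circ> ?\<gamma>) (at 0) 1 = w"
    by (simp add: frechet_derivative_at[symmetric])
  then have "velocity A ?\<gamma> 0 = coordinate_field A (U, \<phi>) w p"
    using velocity_eq_coordinate_field[OF smooth _ _ U, of 0] p \<epsilon> U by simp
  then show ?thesis
    using \<epsilon>(1) smooth 0 unfolding tangent_space_def by (smt (verit) mem_Collect_eq)
qed

text \<open>A set of velocities shows no linear structure. As the range of a linear map it becomes a
  vector space, and the linear algebra of tangent vectors rests on this equality.\<close>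

lemma tangent_space_eq:
  assumes "(U, \<phi>) \<in> A" "p \<in> U"
  shows "tangent_space A p = range (\<lambda>w. coordinate_field A (U, \<phi>) w p)"
proof
  show "tangent_space A p \<subseteq> range (\<lambda>w. coordinate_field A (U, \<phi>) w p)"
  proof
    fix v assume "v \<in> tangent_space A p"
    then obtain \<gamma> \<epsilon> where "\<epsilon> > 0" "smooth_curve A {-\<epsilon><..<\<epsilon>} \<gamma>" "\<gamma> 0 = p" "v = velocity A \<gamma> 0"
      by (auto simp: tangent_space_def)
    then show "v \<in> range (\<lambda>w. coordinate_field A (U, \<phi>) w p)"
      using velocity_eq_coordinate_field[of "{-\<epsilon><..<\<epsilon>}" \<gamma> 0, OF _ _ _ assms(1)] assms(2) by auto
  qed
qed (use coordinate_field_in_tangent_space assms in auto)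

lemma tangentE:
  assumes "v \<in> tangent_space A p" "p \<in> points A"
  obtains U \<phi> w where "(U, \<phi>) \<in> A" "p \<in> U" "v = coordinate_field A (U, \<phi>) w p"
  using chart_at[OF assms(2)] assms(1) tangent_space_eq by (metis rangeE)

end

section \<open>Vector fields\<close>

context manifold_atlas
begin

lemma tangent_not_smooth:
  "v \<in> tangent_space A p \<Longrightarrow> \<not> smooth_near A p h \<Longrightarrow> v h = 0"
  by (auto simp: tangent_space_def velocity_def)

lemma
  assumes p: "p \<in> points A"
  shows tangent_space_add:
      "v \<in> tangent_space A p \<Longrightarrow> w \<in> tangent_space A p \<Longrightarrow> (\<lambda>h. v h + w h) \<in> tangent_space A p"
    and tangent_space_cmult: "v \<in> tangent_space A p \<Longrightarrow> (\<lambda>h. c * v h) \<in> tangent_space A p"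
    and tangent_space_zero: "(\<lambda>h. 0) \<in> tangent_space A p"
proof -
  obtain U \<phi> where U: "(U, \<phi>) \<in> A" "p \<in> U" using chart_at[OF p] .
  let ?c = "\<lambda>w. coordinate_field A (U, \<phi>) w p"
  note lin = coordinate_field_linear[OF U]
  have 1: "(\<lambda>h. ?c a h + ?c b h) = ?c (a + b)" for a b
    using linear_add[OF lin] by (intro ext) simp
  have 2: "(\<lambda>h. c * ?c a h) = ?c (c *\<^sub>R a)" for c a
    using linear_cmul[OF lin] by (intro ext) simp
  have 3: "(\<lambda>h. 0) = ?c 0"
    using linear_0[OF lin] by (intro ext) simp
  show "v \<in> tangent_space A p \<Longrightarrow> w \<in> tangent_space A p \<Longrightarrow> (\<lambda>h. v h + w h) \<in> tangent_space A p"
    unfolding tangent_space_eq[OF U] using 1 by auto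
  show "v \<in> tangent_space A p \<Longrightarrow> (\<lambda>h. c * v h) \<in> tangent_space A p"
    unfolding tangent_space_eq[OF U] using 2 by auto
  show "(\<lambda>h. 0) \<in> tangent_space A p"
    unfolding tangent_space_eq[OF U] using 3 by auto
qed

lemma tangent_space_sum:
  assumes "p \<in> points A" "\<And>i. i \<in> K \<Longrightarrow> v i \<in> tangent_space A p"
  shows "(\<lambda>h. \<Sum>i\<in>K. c i * v i h) \<in> tangent_space A p"
  using assms(2)
proof (induction K rule: infinite_finite_induct)
  case (insert x F)
  then show ?case
    using tangent_space_add[OF assms(1) tangent_space_cmult[OF assms(1), of "v x" "c x"], of "\<lambda>h. \<Sum>i\<in>F. c i * v i h"]
    by simp
qed (simp_all add: tangent_space_zero[OF assms(1)])

text \<open>The components of a vector are its values on the coordinate functions. For a vector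
  field they are therefore smooth functions.\<close>

lemma tangent_expand:
  assumes U: "(U, \<phi>) \<in> A" "p \<in> U" and v: "v \<in> tangent_space A p"
  shows "v h = (\<Sum>b\<in>Basis. v (\<lambda>q. \<phi> q \<bullet> b) * coordinate_field A (U, \<phi>) b p h)"
proof -
  obtain w where w: "v = coordinate_field A (U, \<phi>) w p"
    using v tangent_space_eq[OF U] by auto
  show ?thesis
    unfolding w coordinate_field_coord[OF U]
    using linear_expand[OF coordinate_field_linear[OF U], of w h] by (simp only: real_scaleR_def)
qed

text \<open>A tangent vector takes functions on the whole type but sees only germs: smoothness near
  \<open>p\<close> and the derivative at \<open>p\<close> are both local. Locally defined data
  therefore suffice, without cut-off functions.\<close>

lemma tangent_local:
  assumes v: "v \<in> tangent_space A p" and N: "open N" "p \<in> N" and p: "p \<in> points A"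
    and eq: "\<And>q. q \<in> N \<Longrightarrow> h q = k q"
  shows "v h = v k"
proof -
  obtain U \<phi> w where U: "(U, \<phi>) \<in> A" "p \<in> U" and w: "v = coordinate_field A (U, \<phi>) w p"
    using tangentE[OF v p] .
  have sm: "smooth_near A p h \<longleftrightarrow> smooth_near A p k"
    using smooth_near_cong[OF N] eq by metis
  have "frechet_derivative (h \<circ> inv_into U \<phi>) (at (\<phi> p)) = frechet_derivative (k \<circ> inv_into U \<phi>) (at (\<phi> p))"
    if "smooth_near A p h"
  proof (rule frechet_derivative_transform_within_open)
    show "(h \<circ> inv_into U \<phi>) differentiable at (\<phi> p)"
      using smooth_near_has_derivative[OF U that] by (auto simp: differentiable_def)
    show "open (\<phi> ` (N \<inter> U))" "\<phi> p \<in> \<phi> ` (N \<inter> U)"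
      using open_chart_image_Int[OF U(1) N(1)] N U by auto
  qed (use U eq in auto)
  then show ?thesis
    using sm by (simp add: w coordinate_field_def)
qed

lemma tangent_const:
  assumes v: "v \<in> tangent_space A p" and p: "p \<in> points A"
  shows "v (\<lambda>q. c) = 0"
proof -
  obtain U \<phi> w where U: "(U, \<phi>) \<in> A" "p \<in> U" and w: "v = coordinate_field A (U, \<phi>) w p"
    using tangentE[OF v p] .
  show ?thesis
    by (simp add: w coordinate_field_def o_def)
qed

lemma tangent_add:
  assumes v: "v \<in> tangent_space A p" and h: "smooth_near A p h" and k: "smooth_near A p k"
  shows "v (\<lambda>q. h q + k q) = v h + v k"
proof -
  obtain U \<phi> w where U: "(U, \<phi>) \<in> A" "p \<in> U" and w: "v = coordinate_field A (U, \<phi>) w p"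
    using tangentE[OF v smooth_near_points[OF h]] .
  note d = has_derivative_add[OF smooth_near_has_derivative[OF U h] smooth_near_has_derivative[OF U k]]
  show ?thesis
    using frechet_derivative_at[OF d, symmetric] h k smooth_near_add[OF h k]
    by (simp add: w coordinate_field_def o_def)
qed

lemma tangent_mult:
  assumes v: "v \<in> tangent_space A p" and h: "smooth_near A p h" and k: "smooth_near A p k"
  shows "v (\<lambda>q. h q * k q) = v h * k p + h p * v k"
proof -
  obtain U \<phi> w where U: "(U, \<phi>) \<in> A" "p \<in> U" and w: "v = coordinate_field A (U, \<phi>) w p"
    using tangentE[OF v smooth_near_points[OF h]] .
  note d = has_derivative_mult[OF smooth_near_has_derivative[OF U h] smooth_near_has_derivative[OF U k]]
  show ?thesis
    using frechet_derivative_at[OF d, symmetric] h k smooth_near_mult[OF h k] U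
    by (simp add: w coordinate_field_def o_def)
qed

lemma vector_field_coordinate_field:
  assumes U: "(U, \<phi>) \<in> A"
  shows "vector_field A U (coordinate_field A (U, \<phi>) w)"
  unfolding vector_field_def
proof (intro conjI ballI allI impI; (elim conjE)?)
  fix p assume "p \<in> U"
  then show "coordinate_field A (U, \<phi>) w p \<in> tangent_space A p"
    by (rule coordinate_field_in_tangent_space[OF U])
next
  fix V h assume V: "open V" "V \<subseteq> U" and h: "smooth_function A V h"
  let ?k = "\<lambda>p. coordinate_field A (U, \<phi>) w p h"
  have "open_part A V"
    using V open_part_chart[OF U] by (auto simp: open_part_def)
  then have near: "smooth_near A q h" if "q \<in> V" for q
    using that h by (rule smooth_nearI)
  show "smooth_function A V ?k"
  proof (rule smooth_functionI[OF V(1)])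
    fix p assume p: "p \<in> V"
    have "smooth_on (\<phi> ` (V \<inter> U)) (h \<circ> inv_into U \<phi>)"
      using U h unfolding smooth_function_def by fast
    then have "smooth_on (\<phi> ` (V \<inter> U)) (\<lambda>y. frechet_derivative (h \<circ> inv_into U \<phi>) (at y) w)"
      by (rule smooth_on_frechet_derivative)
    then have "smooth_on (\<phi> ` (V \<inter> U)) (?k \<circ> inv_into U \<phi>)"
      by (rule smooth_on_cong[OF open_chart_image_Int[OF U V(1)], rotated])
        (use U near in \<open>auto simp: coordinate_field_def\<close>)
    then show "\<exists>U \<phi> N. (U, \<phi>) \<in> A \<and> open N \<and> p \<in> N \<and> p \<in> U \<and>
      smooth_on (\<phi> ` (V \<inter> N \<inter> U)) (?k \<circ> inv_into U \<phi>)"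
      using U p V by (intro exI[of _ U] exI[of _ \<phi>] exI[of _ UNIV]) auto
  qed
qed

text \<open>The extension has constant components over a chart domain. A local extension is enough
  because connections act on fields over open parts.\<close>

lemma vector_field_extension:
  assumes "p \<in> points A" "v \<in> tangent_space A p"
  obtains U X where "open_part A U" "p \<in> U" "vector_field A U X" "X p = v"
proof -
  obtain U \<phi> w where "(U, \<phi>) \<in> A" "p \<in> U" "v = coordinate_field A (U, \<phi>) w p"
    using tangentE[OF assms(2,1)] .
  then show thesis
    using that open_part_chart vector_field_coordinate_field by blast
qed

lemma vector_field_add:
  assumes W: "open_part A W" and "vector_field A W X" "vector_field A W Y"
  shows "vector_field A W (\<lambda>q h. X q h + Y q h)"
  using assms(2,3) open_part_points[OF W] unfolding vector_field_def
  by (auto intro!: tangent_space_add smooth_function_add)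

lemma vector_field_mult:
  assumes W: "open_part A W" and u: "smooth_function A W u" and X: "vector_field A W X"
  shows "vector_field A W (\<lambda>q h. u q * X q h)"
  using X open_part_points[OF W] unfolding vector_field_def
  by (auto intro!: tangent_space_cmult smooth_function_mult intro: smooth_function_subset[OF u])

lemma vector_field_zero: "open_part A W \<Longrightarrow> vector_field A W (\<lambda>q h. 0)"
  using open_part_points unfolding vector_field_def
  by (auto intro!: tangent_space_zero smooth_function_const)

lemma vector_field_sum:
  assumes W: "open_part A W" and "\<And>i. i \<in> K \<Longrightarrow> smooth_function A W (u i)"
    "\<And>i. i \<in> K \<Longrightarrow> vector_field A W (X i)"
  shows "vector_field A W (\<lambda>q h. \<Sum>i\<in>K. u i q * X i q h)"
  using assms(2,3)
proof (induction K rule: infinite_finite_induct)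
  case (insert x F)
  then show ?case
    using vector_field_add[OF W vector_field_mult[OF W, of "u x" "X x"], of "\<lambda>q h. \<Sum>i\<in>F. u i q * X i q h"]
    by simp
qed (simp_all add: vector_field_zero[OF W])

lemma vector_field_cong:
  assumes "\<And>p. p \<in> W \<Longrightarrow> X p = Y p" "vector_field A W X"
  shows "vector_field A W Y"
  unfolding vector_field_def
proof (intro conjI ballI allI impI; (elim conjE)?)
  fix p assume "p \<in> W"
  then show "Y p \<in> tangent_space A p"
    using assms vector_fieldD by metis
next
  fix V h assume V: "open V" "V \<subseteq> W" and h: "smooth_function A V h"
  show "smooth_function A V (\<lambda>p. Y p h)"
    by (rule smooth_function_cong[OF V(1) _ vector_field_smooth_function[OF assms(2) V h]])
      (use V assms(1) in auto)
qed

lemma vector_field_local: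
  assumes W: "open_part A W" and "\<And>p. p \<in> W \<Longrightarrow> \<exists>N. open N \<and> p \<in> N \<and> vector_field A (W \<inter> N) X"
  shows "vector_field A W X"
  unfolding vector_field_def
proof (intro conjI ballI allI impI; (elim conjE)?)
  fix p assume "p \<in> W"
  then show "X p \<in> tangent_space A p"
    using assms(2) vector_fieldD by blast
next
  fix V h assume V: "open V" "V \<subseteq> W" and h: "smooth_function A V h"
  show "smooth_function A V (\<lambda>p. X p h)"
  proof (rule smooth_function_local)
    show "open_part A V"
      using V W by (auto simp: open_part_def)
    fix p assume "p \<in> V"
    then obtain N where N: "open N" "p \<in> N" and X: "vector_field A (W \<inter> N) X"
      using assms(2) V by blast
    have "smooth_function A (V \<inter> N) (\<lambda>p. X p h)"
      by (rule vector_field_smooth_function[OF X])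
        (use V N smooth_function_subset[OF h] in auto)
    then show "\<exists>N. open N \<and> p \<in> N \<and> smooth_function A (V \<inter> N) (\<lambda>p. X p h)"
      using N by blast
  qed
qed

end

section \<open>Linear algebra of indefinite bilinear forms\<close>

lemma bilinear_sum_left: "bilinear B \<Longrightarrow> B (\<Sum>i\<in>K. c i *\<^sub>R x i) y = (\<Sum>i\<in>K. c i *\<^sub>R B (x i) y)"
  by (simp add: bilinear_def linear_sum[of "\<lambda>x. B x y"] linear_cmul[of "\<lambda>x. B x y"])

lemma bilinear_orthonormal_coeff:
  fixes B :: "'e::euclidean_space \<Rightarrow> 'e \<Rightarrow> real" and m :: nat
  assumes B: "bilinear B" and e: "\<And>i j. i < m \<Longrightarrow> j < m \<Longrightarrow> B (e i) (e j) = (if i = j then \<epsilon> i else 0)"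
    and "j < m"
  shows "B (\<Sum>i<m. c i *\<^sub>R e i) (e j) = c j * \<epsilon> j"
proof -
  have "B (\<Sum>i<m. c i *\<^sub>R e i) (e j) = (\<Sum>i<m. c i * B (e i) (e j))"
    using bilinear_sum_left[OF B] by simp
  also have "\<dots> = (\<Sum>i<m. if i = j then c j * \<epsilon> j else 0)"
    by (rule sum.cong) (use e assms(3) in auto)
  finally show ?thesis
    using assms(3) by simp
qed

text \<open>Pairing a linear combination with \<open>e i\<close> isolates its coefficient times
  \<open>\<epsilon> i\<close>, which is nonzero; so these \<open>DIM('e)\<close> vectors are
  independent and span. As \<open>\<epsilon> k\<close> is its own inverse, multiplying by it is
  dividing by \<open>B (e k) (e k)\<close>.\<close>

lemma orthonormal_expand:
  fixes B :: "'e::euclidean_space \<Rightarrow> 'e \<Rightarrow> real"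
  defines "n \<equiv> DIM('e)"
  assumes B: "bilinear B"
    and e: "\<And>i j. i < n \<Longrightarrow> j < n \<Longrightarrow> B (e i) (e j) = (if i = j then \<epsilon> i else 0)"
    and \<epsilon>: "\<And>i. i < n \<Longrightarrow> \<epsilon> i = 1 \<or> \<epsilon> i = -1"
  shows "w = (\<Sum>k<n. (\<epsilon> k * B w (e k)) *\<^sub>R e k)"
proof -
  have nz: "\<epsilon> i \<noteq> 0" if "i < n" for i
    using \<epsilon>[OF that] by auto
  have inj: "inj_on e {..<n}"
  proof (rule inj_onI)
    fix i j assume ij: "i \<in> {..<n}" "j \<in> {..<n}" "e i = e j"
    show "i = j"
      using e[of i i] e[of i j] nz[of i] ij by (auto split: if_splits)
  qed
  have ind: "independent (e ` {..<n})"
  proof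
    assume "dependent (e ` {..<n})"
    then obtain u i where u: "(\<Sum>v\<in>e ` {..<n}. u v *\<^sub>R v) = 0" and i: "i < n" "u (e i) \<noteq> 0"
      by (subst (asm) dependent_finite) auto
    have "(\<Sum>k<n. u (e k) *\<^sub>R e k) = 0"
      using u by (simp add: sum.reindex[OF inj])
    then have "u (e i) * \<epsilon> i = B 0 (e i)"
      using bilinear_orthonormal_coeff[OF B e i(1), of "\<lambda>k. u (e k)"] by simp
    then show False
      using i nz bilinear_lzero[OF B] by simp
  qed
  have "UNIV \<subseteq> span (e ` {..<n})"
    by (rule card_ge_dim_independent[OF _ ind]) (use card_image[OF inj] in \<open>simp_all add: n_def\<close>)
  then have "w \<in> span (e ` {..<n})" by auto
  then obtain u where "w = (\<Sum>v\<in>e ` {..<n}. u v *\<^sub>R v)"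
    by (subst (asm) span_finite) auto
  then have w: "w = (\<Sum>k<n. u (e k) *\<^sub>R e k)"
    by (simp add: sum.reindex[OF inj])
  have "\<epsilon> k * B w (e k) = u (e k)" if "k < n" for k
    using bilinear_orthonormal_coeff[OF B e that, of "\<lambda>k. u (e k)"] \<epsilon>[OF that] w by auto
  then show ?thesis
    using w by simp
qed

text \<open>For an indefinite form a vector orthogonal to all \<open>e i\<close> may be null, so the
  next one must be chosen with care. If all of them were null, polarisation would make the form
  vanish on the orthogonal complement, nondegeneracy would make the complement trivial, and fewer
  than \<open>DIM('e)\<close> vectors would span the space.\<close>

lemma orthonormal_step:
  fixes B :: "'e::euclidean_space \<Rightarrow> 'e \<Rightarrow> real" and m :: nat
  assumes B: "bilinear B" and sym: "\<And>v w. B v w = B w v"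
    and nondeg: "\<And>v. (\<And>w. B v w = 0) \<Longrightarrow> v = 0"
    and e: "\<And>i j. i < m \<Longrightarrow> j < m \<Longrightarrow> B (e i) (e j) = (if i = j then \<epsilon> i else 0)"
    and \<epsilon>: "\<And>i. i < m \<Longrightarrow> \<epsilon> i = 1 \<or> \<epsilon> i = -1"
    and m: "m < DIM('e)"
  obtains v where "\<And>i. i < m \<Longrightarrow> B v (e i) = 0" "B v v \<noteq> 0"
proof (rule ccontr)
  note intro = that
  assume contr: "\<not> thesis"
  have null: "B v v = 0" if "\<And>i. i < m \<Longrightarrow> B v (e i) = 0" for v
    using contr intro that by blast
  \<comment> \<open>Orthogonal projection onto the span of the \<open>e k\<close>; the difference
    \<open>w - pr w\<close> lies in the complement.\<close>
  define pr where "pr w = (\<Sum>k<m. (\<epsilon> k * B w (e k)) *\<^sub>R e k)" for w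
  have orth: "B (w - pr w) (e j) = 0" if "j < m" for w j
    using bilinear_orthonormal_coeff[OF B e that, of "\<lambda>k. \<epsilon> k * B w (e k)"] \<epsilon>[OF that]
    by (auto simp: pr_def bilinear_lsub[OF B])
  have zero: "v = 0" if v: "\<And>i. i < m \<Longrightarrow> B v (e i) = 0" for v
  proof (rule nondeg)
    fix w
    \<comment> \<open>Polarisation: \<open>v\<close>, \<open>w - pr w\<close> and their sum are
      null, so the mixed term \<open>2 * B v (w - pr w)\<close> vanishes.\<close>
    have "B (v + (w - pr w)) (v + (w - pr w)) = 0"
      by (rule null) (simp add: bilinear_ladd[OF B] v orth)
    then have "B v (w - pr w) = 0"
      using null[OF v] null[OF orth, of w] sym[of v "w - pr w"]
      by (simp add: bilinear_ladd[OF B] bilinear_radd[OF B])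
    moreover have "B (pr w) v = 0"
      unfolding pr_def bilinear_sum_left[OF B] using v by (simp add: sym[of "e _" v])
    ultimately show "B v w = 0"
      using sym[of v "pr w"] by (simp add: bilinear_rsub[OF B])
  qed
  have "w \<in> span (e ` {..<m})" for w
  proof -
    have "w = pr w"
      using zero[OF orth, of w] by simp
    moreover have "pr w \<in> span (e ` {..<m})"
      unfolding pr_def by (intro span_sum span_scale span_base) auto
    ultimately show ?thesis by simp
  qed
  then have "dim (UNIV::'e set) \<le> card (e ` {..<m})"
    by (intro dim_le_card) auto
  also have "\<dots> \<le> m"
    using card_image_le[of "{..<m}" e] by simp
  finally show False
    using m by simp
qed

section \<open>Tensoriality and orthonormal frames\<close>

text \<open>The argument is a whole field because curvature differentiates it; linearity over
  functions is what reduces the value to the vector at \<open>p\<close>. The last clause is a demand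
  of its own since an operator also receives HOL functions that are fields only near
  \<open>p\<close>.\<close>

definition tensorial_at ::
  "('a::topological_space, 'e::euclidean_space) chart set \<Rightarrow> 'a \<Rightarrow> ('a vfield \<Rightarrow> real) \<Rightarrow> bool" where
  "tensorial_at A p T \<longleftrightarrow>
    (\<forall>U X Y. open_part A U \<and> p \<in> U \<and> vector_field A U X \<and> vector_field A U Y \<longrightarrow>
       T (\<lambda>q h. X q h + Y q h) = T X + T Y) \<and>
    (\<forall>U X u. open_part A U \<and> p \<in> U \<and> vector_field A U X \<and> smooth_function A U u \<longrightarrow>
       T (\<lambda>q h. u q * X q h) = u p * T X) \<and>
    (\<forall>U X X'. open_part A U \<and> p \<in> U \<and> vector_field A U X \<and> (\<forall>q\<in>U. X' q = X q) \<longrightarrow> T X' = T X)"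

context manifold_atlas
begin

text \<open>The other arguments of \<open>T\<close> are typically fields on \<open>V\<close> only;
  the restriction to \<open>U \<subseteq> V\<close> lets each clause be checked where all arguments
  live.\<close>

lemma tensorial_atI:
  assumes V: "open_part A V" "p \<in> V"
    and "\<And>U X Y. open_part A U \<Longrightarrow> U \<subseteq> V \<Longrightarrow> p \<in> U \<Longrightarrow> vector_field A U X \<Longrightarrow> vector_field A U Y \<Longrightarrow>
       T (\<lambda>q h. X q h + Y q h) = T X + T Y"
    and "\<And>U X u. open_part A U \<Longrightarrow> U \<subseteq> V \<Longrightarrow> p \<in> U \<Longrightarrow> vector_field A U X \<Longrightarrow> smooth_function A U u \<Longrightarrow>
       T (\<lambda>q h. u q * X q h) = u p * T X"
    and "\<And>U X X'. open_part A U \<Longrightarrow> U \<subseteq> V \<Longrightarrow> p \<in> U \<Longrightarrow> vector_field A U X \<Longrightarrow> (\<And>q. q \<in> U \<Longrightarrow> X' q = X q) \<Longrightarrow>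
       T X' = T X"
  shows "tensorial_at A p T"
  unfolding tensorial_at_def
proof (intro conjI allI impI; elim conjE)
  fix U X Y
  assume U: "open_part A U" "p \<in> U" and X: "vector_field A U X" "vector_field A U Y"
  have U': "open_part A (U \<inter> V)" "U \<inter> V \<subseteq> V" "p \<in> U \<inter> V"
    using U V open_part_Int by auto
  show "T (\<lambda>q h. X q h + Y q h) = T X + T Y"
    by (rule assms(3)[OF U' vector_field_subset[OF X(1)] vector_field_subset[OF X(2)]]) auto
next
  fix U X u
  assume U: "open_part A U" "p \<in> U" and X: "vector_field A U X" "smooth_function A U u"
  have U': "open_part A (U \<inter> V)" "U \<inter> V \<subseteq> V" "p \<in> U \<inter> V"
    using U V open_part_Int by auto
  show "T (\<lambda>q h. u q * X q h) = u p * T X"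
    by (rule assms(4)[OF U' vector_field_subset[OF X(1)] smooth_function_subset[OF X(2)]]) auto
next
  fix U X X'
  assume U: "open_part A U" "p \<in> U" and X: "vector_field A U X" "\<forall>q\<in>U. X' q = X q"
  have U': "open_part A (U \<inter> V)" "U \<inter> V \<subseteq> V" "p \<in> U \<inter> V"
    using U V open_part_Int by auto
  show "T X' = T X"
    by (rule assms(5)[OF U' vector_field_subset[OF X(1)]]) (use X(2) in auto)
qed

lemma
  assumes T: "tensorial_at A p T" and U: "open_part A U" "p \<in> U"
  shows tensorial_at_add: "vector_field A U X \<Longrightarrow> vector_field A U Y \<Longrightarrow> T (\<lambda>q h. X q h + Y q h) = T X + T Y"
    and tensorial_at_mult: "vector_field A U X \<Longrightarrow> smooth_function A U u \<Longrightarrow> T (\<lambda>q h. u q * X q h) = u p * T X"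
    and tensorial_at_cong: "vector_field A U X \<Longrightarrow> (\<And>q. q \<in> U \<Longrightarrow> X' q = X q) \<Longrightarrow> T X' = T X"
proof -
  note T' = T[unfolded tensorial_at_def]
  show "vector_field A U X \<Longrightarrow> vector_field A U Y \<Longrightarrow> T (\<lambda>q h. X q h + Y q h) = T X + T Y"
    using T'[THEN conjunct1] U by simp
  show "vector_field A U X \<Longrightarrow> smooth_function A U u \<Longrightarrow> T (\<lambda>q h. u q * X q h) = u p * T X"
    using T'[THEN conjunct2, THEN conjunct1] U by simp
  show "vector_field A U X \<Longrightarrow> (\<And>q. q \<in> U \<Longrightarrow> X' q = X q) \<Longrightarrow> T X' = T X"
    using T'[THEN conjunct2, THEN conjunct2] U by metis
qed

lemma tensorial_at_sum:
  assumes T: "tensorial_at A p T" and U: "open_part A U" "p \<in> U"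
    and "finite K" "\<And>k. k \<in> K \<Longrightarrow> smooth_function A U (c k)" "\<And>k. k \<in> K \<Longrightarrow> vector_field A U (B k)"
  shows "T (\<lambda>q h. \<Sum>k\<in>K. c k q * B k q h) = (\<Sum>k\<in>K. c k p * T (B k))"
  using assms(4-6)
proof (induction K)
  case empty
  show ?case
    using tensorial_at_mult[OF T U vector_field_zero[OF U(1)], of "\<lambda>q. 0"] U smooth_function_const
    by (simp add: open_part_def)
next
  case (insert x F)
  have 1: "vector_field A U (\<lambda>q h. c x q * B x q h)"
    using insert.prems by (intro vector_field_mult[OF U(1)]) auto
  have 2: "vector_field A U (\<lambda>q h. \<Sum>k\<in>F. c k q * B k q h)"
    using insert.prems by (intro vector_field_sum[OF U(1)]) auto
  show ?case
    using tensorial_at_add[OF T U 1 2] tensorial_at_mult[OF T U, of "B x" "c x"] insert by simp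
qed

text \<open>Only the coefficients at \<open>p\<close> enter, whatever they do nearby. Curvature and
  Ricci tensor are evaluated in frames this way.\<close>

lemma tensorial_at_expand:
  assumes T: "tensorial_at A p T" and U: "open_part A U" "p \<in> U"
    and K: "finite K" "\<And>k. k \<in> K \<Longrightarrow> smooth_function A U (c k)" "\<And>k. k \<in> K \<Longrightarrow> vector_field A U (B k)"
    and X: "\<And>q h. q \<in> U \<Longrightarrow> X q h = (\<Sum>k\<in>K. c k q * B k q h)"
  shows "T X = (\<Sum>k\<in>K. c k p * T (B k))"
proof -
  have "T X = T (\<lambda>q h. \<Sum>k\<in>K. c k q * B k q h)"
    by (rule tensorial_at_cong[OF T U vector_field_sum[OF U(1)]]) (use K X in auto)
  then show ?thesis
    using tensorial_at_sum[OF T U K] by simp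
qed

end

section \<open>Metrics and their local orthonormal frames\<close>

locale pseudo_riemannian = manifold_atlas A
  for A :: "('a::{t2_space,second_countable_topology}, 'e::euclidean_space) chart set" +
  fixes g :: "'a metric"
  assumes metric: "pseudo_riemannian_metric A g"
begin

lemma
  assumes "p \<in> points A" and "v \<in> tangent_space A p" "w \<in> tangent_space A p"
  shows metric_sym: "g p v w = g p w v"
    and metric_lincomb: "u \<in> tangent_space A p \<Longrightarrow>
      g p (\<lambda>h. a * v h + b * w h) u = a * g p v u + b * g p w u"
proof -
  note m = metric[unfolded pseudo_riemannian_metric_def, THEN conjunct1, THEN bspec, OF assms(1),
      THEN bspec, OF assms(2)]
  show "g p v w = g p w v"
    using m[THEN conjunct1] assms(3) by simp
  show "u \<in> tangent_space A p \<Longrightarrow> g p (\<lambda>h. a * v h + b * w h) u = a * g p v u + b * g p w u"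
    using m[THEN conjunct2, THEN conjunct1] assms(3) by simp
qed

lemma metric_nondegenerate:
  assumes "p \<in> points A" "v \<in> tangent_space A p" "\<And>w. w \<in> tangent_space A p \<Longrightarrow> g p v w = 0"
  shows "v = (\<lambda>h. 0)"
proof -
  note m = metric[unfolded pseudo_riemannian_metric_def, THEN conjunct1, THEN bspec, OF assms(1),
      THEN bspec, OF assms(2)]
  have "\<forall>w\<in>tangent_space A p. g p v w = 0"
    using assms(3) by (rule ballI)
  with m[THEN conjunct2, THEN conjunct2] show ?thesis
    by (rule mp)
qed

lemma metric_smooth:
  "open_part A U \<Longrightarrow> vector_field A U X \<Longrightarrow> vector_field A U Y \<Longrightarrow> smooth_function A U (\<lambda>p. g p (X p) (Y p))"
  using metric[unfolded pseudo_riemannian_metric_def, THEN conjunct2] by simp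

lemma
  assumes "p \<in> points A" and "v \<in> tangent_space A p" "w \<in> tangent_space A p" "u \<in> tangent_space A p"
  shows metric_add_left: "g p (\<lambda>h. v h + w h) u = g p v u + g p w u"
    and metric_add_right: "g p u (\<lambda>h. v h + w h) = g p u v + g p u w"
    and metric_cmult_left: "g p (\<lambda>h. c * v h) u = c * g p v u"
    and metric_cmult_right: "g p u (\<lambda>h. c * v h) = c * g p u v"
proof -
  show 1: "g p (\<lambda>h. v h + w h) u = g p v u + g p w u"
    using metric_lincomb[OF assms, of 1 1] by simp
  show 2: "g p (\<lambda>h. c * v h) u = c * g p v u"
    using metric_lincomb[OF assms, of c 0] by simp
  show "g p u (\<lambda>h. v h + w h) = g p u v + g p u w"
    using 1 metric_sym[OF assms(1,4) tangent_space_add[OF assms(1-3)]]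
      metric_sym[OF assms(1,2,4)] metric_sym[OF assms(1,3,4)] by simp
  show "g p u (\<lambda>h. c * v h) = c * g p u v"
    using 2 metric_sym[OF assms(1,4) tangent_space_cmult[OF assms(1,2)]]
      metric_sym[OF assms(1,2,4)] by simp
qed

lemma metric_zero_left: "p \<in> points A \<Longrightarrow> u \<in> tangent_space A p \<Longrightarrow> g p (\<lambda>h. 0) u = 0"
  using metric_cmult_left[of p u u u 0] by simp

lemma metric_sum_left:
  assumes p: "p \<in> points A" and u: "u \<in> tangent_space A p"
    and "\<And>i. i \<in> K \<Longrightarrow> v i \<in> tangent_space A p"
  shows "g p (\<lambda>h. \<Sum>i\<in>K. c i * v i h) u = (\<Sum>i\<in>K. c i * g p (v i) u)"
  using assms(3)
proof (induction K rule: infinite_finite_induct)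
  case (insert x F)
  have 1: "(\<lambda>h. c x * v x h) \<in> tangent_space A p"
    by (rule tangent_space_cmult[OF p]) (use insert.prems in simp)
  have 2: "(\<lambda>h. \<Sum>i\<in>F. c i * v i h) \<in> tangent_space A p"
    by (rule tangent_space_sum[OF p]) (use insert.prems in simp)
  show ?case
    using insert metric_add_left[OF p 1 2 u] metric_cmult_left[OF p _ u u, of "v x" "c x"] by simp
qed (simp_all add: metric_zero_left[OF p u])

lemma metric_sum_right:
  assumes p: "p \<in> points A" and u: "u \<in> tangent_space A p"
    and v: "\<And>i. i \<in> K \<Longrightarrow> v i \<in> tangent_space A p"
  shows "g p u (\<lambda>h. \<Sum>i\<in>K. c i * v i h) = (\<Sum>i\<in>K. c i * g p u (v i))"
proof -
  have "g p u (\<lambda>h. \<Sum>i\<in>K. c i * v i h) = g p (\<lambda>h. \<Sum>i\<in>K. c i * v i h) u"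
    by (rule metric_sym[OF p u tangent_space_sum[OF p v]])
  also have "\<dots> = (\<Sum>i\<in>K. c i * g p (v i) u)"
    by (rule metric_sum_left[OF p u v])
  also have "\<dots> = (\<Sum>i\<in>K. c i * g p u (v i))"
    using metric_sym[OF p u v] by simp
  finally show ?thesis .
qed

text \<open>Transports the metric at \<open>p\<close> to the model space \<open>'e\<close>, where
  the linear algebra of bilinear forms applies.\<close>

lemma chart_form:
  assumes U: "(U, \<phi>) \<in> A" "p \<in> U"
  defines "B \<equiv> \<lambda>a b. g p (coordinate_field A (U, \<phi>) a p) (coordinate_field A (U, \<phi>) b p)"
  shows "bilinear B" "B a b = B b a" "(\<And>b. B a b = 0) \<Longrightarrow> a = 0"
proof -
  let ?c = "\<lambda>w. coordinate_field A (U, \<phi>) w p"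
  have p: "p \<in> points A" using open_part_points[OF open_part_chart[OF U(1)] U(2)] .
  have T: "?c a \<in> tangent_space A p" for a
    by (rule coordinate_field_in_tangent_space[OF U])
  note lin = coordinate_field_linear[OF U]
  have 1: "?c (a + b) = (\<lambda>h. ?c a h + ?c b h)" for a b
    using linear_add[OF lin] by (intro ext) simp
  have 2: "?c (c *\<^sub>R a) = (\<lambda>h. c * ?c a h)" for c a
    using linear_cmul[OF lin] by (intro ext) simp
  show "bilinear B"
    unfolding bilinear_def B_def
    by (auto intro!: linearI simp: 1 2 metric_add_left[OF p T T T] metric_add_right[OF p T T T]
        metric_cmult_left[OF p T T T] metric_cmult_right[OF p T T T])
  show "B a b = B b a"
    unfolding B_def by (rule metric_sym[OF p T T])
  assume "\<And>b. B a b = 0"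
  then have "?c a = (\<lambda>h. 0)"
    by (intro metric_nondegenerate[OF p T]) (auto simp: tangent_space_eq[OF U] B_def)
  then have "a \<bullet> b = 0" for b
    using coordinate_field_coord[OF U, of a b] by simp
  then show "a = 0"
    using inner_eq_zero_iff by blast
qed

lemma orthonormal_frame_expand:
  assumes E: "orthonormal_frame A g U \<epsilon> E" and U: "open_part A U" "p \<in> U" and v: "v \<in> tangent_space A p"
  shows "v h = (\<Sum>k<DIM('e). \<epsilon> k * g p v (E k p) * E k p h)"
proof -
  obtain V \<phi> where V: "(V, \<phi>) \<in> A" "p \<in> V"
    using chart_at open_part_points[OF U] by blast
  let ?c = "\<lambda>w. coordinate_field A (V, \<phi>) w p"
  have "\<forall>k<DIM('e). \<exists>w. E k p = ?c w"
    using E U(2) vector_fieldD unfolding orthonormal_frame_def tangent_space_eq[OF V, symmetric]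
    by (metis rangeE tangent_space_eq[OF V])
  then obtain e where e: "\<And>k. k < DIM('e) \<Longrightarrow> E k p = ?c (e k)"
    by metis
  obtain w where w: "v = ?c w"
    using v tangent_space_eq[OF V] by auto
  have "w = (\<Sum>k<DIM('e). (\<epsilon> k * g p (?c w) (?c (e k))) *\<^sub>R e k)"
    by (rule orthonormal_expand[OF chart_form(1)[OF V]])
      (use E e U(2) in \<open>auto simp: orthonormal_frame_def\<close>)
  then have "v h = coordinate_field A (V, \<phi>) (\<Sum>k<DIM('e). (\<epsilon> k * g p (?c w) (?c (e k))) *\<^sub>R e k) p h"
    using w by metis
  also have "\<dots> = (\<Sum>k<DIM('e). \<epsilon> k * g p (?c w) (?c (e k)) * ?c (e k) h)"
    by (simp add: linear_sum[OF coordinate_field_linear[OF V]] linear_cmul[OF coordinate_field_linear[OF V]])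
  finally show ?thesis
    using e w by simp
qed

text \<open>Induction on the number of fields. The next field starts from a coordinate field that at
  \<open>p\<close> is orthogonal to the earlier ones and not null. Its correction is still not null
  on a smaller neighbourhood, where it is normalised up to the sign \<open>\<delta>\<close>.\<close>

lemma gram_schmidt:
  assumes p: "p \<in> points A" and "m \<le> DIM('e)"
  shows "\<exists>U \<epsilon> E. open_part A U \<and> p \<in> U \<and> (\<forall>k<m. vector_field A U (E k) \<and> (\<epsilon> k = 1 \<or> \<epsilon> k = -1)) \<and>
    (\<forall>q\<in>U. \<forall>i<m. \<forall>j<m. g q (E i q) (E j q) = (if i = j then \<epsilon> i else (0::real)))"
  using assms(2)
proof (induction m)
  case 0
  obtain U \<phi> where "(U, \<phi>) \<in> A" "p \<in> U" using chart_at[OF p] .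
  then show ?case
    using open_part_chart by auto
next
  case (Suc m)
  then obtain U \<epsilon> E where U: "open_part A U" "p \<in> U"
    and E: "\<And>k. k < m \<Longrightarrow> vector_field A U (E k)" and \<epsilon>: "\<And>k. k < m \<Longrightarrow> \<epsilon> k = 1 \<or> \<epsilon> k = (-1::real)"
    and on: "\<And>q i j. q \<in> U \<Longrightarrow> i < m \<Longrightarrow> j < m \<Longrightarrow> g q (E i q) (E j q) = (if i = j then \<epsilon> i else (0::real))"
    by (metis Suc_leD)
  obtain V \<phi> where V: "(V, \<phi>) \<in> A" "p \<in> V"
    using chart_at[OF p] .
  let ?c = "\<lambda>w. coordinate_field A (V, \<phi>) w p"
  have "\<forall>k<m. \<exists>w. E k p = ?c w"
    using E[THEN vector_fieldD, OF _ U(2)] tangent_space_eq[OF V] by auto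
  then obtain e where e: "\<And>k. k < m \<Longrightarrow> E k p = ?c (e k)"
    by metis
  obtain w where w: "\<And>i. i < m \<Longrightarrow> g p (?c w) (?c (e i)) = 0" "g p (?c w) (?c w) \<noteq> 0"
    by (rule orthonormal_step[OF chart_form[OF V], of m e \<epsilon>]) (use \<epsilon> on[OF U(2)] e Suc.prems in auto)
  let ?X = "coordinate_field A (V, \<phi>) w"
  let ?W = "U \<inter> V"
  have W: "open_part A ?W" "p \<in> ?W"
    using open_part_Int[OF U(1) open_part_chart[OF V(1)]] U V by auto
  have X: "vector_field A ?W ?X"
    using vector_field_subset[OF vector_field_coordinate_field[OF V(1)]] by auto
  have EW: "vector_field A ?W (E k)" if "k < m" for k
    using vector_field_subset[OF E[OF that]] by auto
  \<comment> \<open>Coefficients of minus the projection onto the earlier fields;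
    \<open>\<epsilon> k\<close> stands for division by the norm of \<open>E k\<close>.\<close>
  define c where "c k q = - \<epsilon> k * g q (?X q) (E k q)" for k q
  have c: "smooth_function A ?W (c k)" if "k < m" for k
    unfolding c_def using W metric_smooth[OF W(1) X EW[OF that]]
    by (intro smooth_function_cmult) (auto simp: open_part_def)
  define S where "S = (\<lambda>q h. \<Sum>k<m. c k q * E k q h)"
  define Y where "Y = (\<lambda>q h. ?X q h + S q h)"
  have S: "vector_field A ?W S"
    unfolding S_def by (rule vector_field_sum[OF W(1)]) (use c EW in auto)
  have Y: "vector_field A ?W Y"
    unfolding Y_def by (rule vector_field_add[OF W(1) X S])
  have Y0: "g q (Y q) (E j q) = 0" if q: "q \<in> ?W" and j: "j < m" for q j
  proof -
    have qp: "q \<in> points A" by (rule open_part_points[OF W(1) q])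
    note T = vector_fieldD[OF X q] vector_fieldD[OF S q] vector_fieldD[OF EW q]
    have "g q (S q) (E j q) = (\<Sum>k<m. c k q * g q (E k q) (E j q))"
      unfolding S_def by (rule metric_sum_left[OF qp]) (use T(3) j in auto)
    also have "\<dots> = (\<Sum>k<m. if k = j then c j q * \<epsilon> j else 0)"
      by (rule sum.cong) (use on q j in auto)
    also have "\<dots> = - g q (?X q) (E j q)"
      using j \<epsilon>[OF j] by (auto simp: c_def)
    finally show ?thesis
      unfolding Y_def using metric_add_left[OF qp T(1,2) T(3)[OF j]] by simp
  qed
  \<comment> \<open>At \<open>p\<close> the correction vanishes because \<open>w\<close> was chosen
    orthogonal there; so \<open>Y\<close> inherits being non-null.\<close>
  have "Y p = ?X p"
    using w(1) e by (auto simp: Y_def S_def c_def)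
  then have Yp: "g p (Y p) (Y p) \<noteq> 0"
    using w(2) by simp
  define \<delta> where "\<delta> = sgn (g p (Y p) (Y p))"
  have \<delta>: "\<delta> = 1 \<or> \<delta> = -1" "\<delta> * g p (Y p) (Y p) > 0"
    using Yp by (auto simp: \<delta>_def sgn_if)
  define s where "s q = \<delta> * g q (Y q) (Y q)" for q
  have s: "smooth_function A ?W s"
    unfolding s_def using W metric_smooth[OF W(1) Y Y]
    by (intro smooth_function_cmult) (auto simp: open_part_def)
  \<comment> \<open>Where \<open>s\<close> is positive it can be raised to the power
    \<open>-1/2\<close>; \<open>p\<close> lies there by the choice of
    \<open>\<delta>\<close>.\<close>
  let ?N = "?W \<inter> s -` {0<..}"
  have "open ?N"
    using continuous_open_preimage[OF smooth_function_continuous[OF W(1) s]] W(1)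
    by (auto simp: open_part_def)
  then have N: "open_part A ?N" "p \<in> ?N" "?N \<subseteq> ?W"
    using W \<delta>(2) by (auto simp: open_part_def s_def)
  have r: "smooth_function A ?N (\<lambda>q. s q powr (-1/2))"
    using N by (intro smooth_function_powr smooth_function_subset[OF s]) (auto simp: open_part_def)
  define Z where "Z = (\<lambda>q h. s q powr (-1/2) * Y q h)"
  have Z: "vector_field A ?N Z"
    unfolding Z_def by (rule vector_field_mult[OF N(1) r vector_field_subset[OF Y N(3)]])
  have Z0: "g q (Z q) (E j q) = 0" "g q (E j q) (Z q) = 0" if q: "q \<in> ?N" and j: "j < m" for q j
  proof -
    have qW: "q \<in> ?W" using q by simp
    have qp: "q \<in> points A" by (rule open_part_points[OF N(1) q])
    note T = vector_fieldD[OF Y qW] vector_fieldD[OF EW[OF j] qW]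
    show 1: "g q (Z q) (E j q) = 0"
      unfolding Z_def metric_cmult_left[OF qp T(1,2,2)] using Y0[OF qW j] by simp
    show "g q (E j q) (Z q) = 0"
      using 1 metric_sym[OF qp T(2) vector_fieldD[OF Z q]] by simp
  qed
  have Z1: "g q (Z q) (Z q) = \<delta>" if q: "q \<in> ?N" for q
  proof -
    have qW: "q \<in> ?W" using q by simp
    have qp: "q \<in> points A" by (rule open_part_points[OF N(1) q])
    note T = vector_fieldD[OF Y qW]
    have "g q (Z q) (Z q) = s q powr (-1/2) * (s q powr (-1/2) * g q (Y q) (Y q))"
      unfolding Z_def metric_cmult_left[OF qp T tangent_space_cmult[OF qp T] tangent_space_cmult[OF qp T]]
        metric_cmult_right[OF qp T T T] by simp
    also have "\<dots> = s q powr (-1) * (\<delta> * s q)"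
      using \<delta>(1) by (auto simp: s_def powr_add[symmetric] mult.assoc[symmetric])
    also have "\<dots> = \<delta>"
      using q by (simp add: powr_minus divide_simps)
    finally show ?thesis .
  qed
  show ?case
    by (rule exI[of _ ?N], rule exI[of _ "\<epsilon>(m := \<delta>)"], rule exI[of _ "E(m := Z)"])
      (use N Z Z0 Z1 on \<delta>(1) \<epsilon> vector_field_subset[OF EW N(3)] in \<open>auto simp: less_Suc_eq\<close>)
qed

lemma orthonormal_frame_exists:
  assumes "p \<in> points A"
  obtains U \<epsilon> E where "open_part A U" "p \<in> U" "orthonormal_frame A g U \<epsilon> E"
  using gram_schmidt[OF assms order_refl] unfolding orthonormal_frame_def by blast

end

section \<open>Curvature and Ricci tensor of a connection\<close>

context manifold_atlas
begin

lemma
  assumes U: "open_part A U" "p \<in> U" and X: "vector_field A U X" and Y: "vector_field A U Y"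
  shows lie_bracket_antisym: "lie_bracket A X Y p h = - lie_bracket A Y X p h"
    and lie_bracket_add_left: "vector_field A U Z \<Longrightarrow>
      lie_bracket A (\<lambda>q h. X q h + Z q h) Y p h = lie_bracket A X Y p h + lie_bracket A Z Y p h"
    and lie_bracket_mult_left: "smooth_function A U u \<Longrightarrow>
      lie_bracket A (\<lambda>q h. u q * X q h) Y p h = u p * lie_bracket A X Y p h - Y p u * X p h"
    and lie_bracket_cong: "(\<And>q. q \<in> U \<Longrightarrow> X' q = X q) \<Longrightarrow> (\<And>q. q \<in> U \<Longrightarrow> Y' q = Y q) \<Longrightarrow>
      lie_bracket A X' Y' p = lie_bracket A X Y p"
proof -
  have p: "p \<in> points A" by (rule open_part_points[OF U])
  note TX = vector_fieldD[OF X U(2)] and TY = vector_fieldD[OF Y U(2)]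
  show "lie_bracket A X Y p h = - lie_bracket A Y X p h"
    by (simp add: lie_bracket_def)
  show "lie_bracket A (\<lambda>q h. X q h + Z q h) Y p h = lie_bracket A X Y p h + lie_bracket A Z Y p h"
    if Z: "vector_field A U Z"
    using tangent_add[OF TY smooth_near_vector_field[OF U X] smooth_near_vector_field[OF U Z]]
    by (auto simp: lie_bracket_def)
  show "lie_bracket A (\<lambda>q h. u q * X q h) Y p h = u p * lie_bracket A X Y p h - Y p u * X p h"
    if u: "smooth_function A U u"
    \<comment> \<open>If \<open>h\<close> is not smooth near \<open>p\<close>, the brackets are
      \<open>0\<close> by definition and \<open>X p h\<close> is \<open>0\<close> by the convention
      for tangent vectors.\<close>
    using tangent_mult[OF TY smooth_nearI[OF U u] smooth_near_vector_field[OF U X]]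
      tangent_not_smooth[OF TX]
    by (auto simp: lie_bracket_def algebra_simps)
  show "lie_bracket A X' Y' p = lie_bracket A X Y p"
    if X': "\<And>q. q \<in> U \<Longrightarrow> X' q = X q" and Y': "\<And>q. q \<in> U \<Longrightarrow> Y' q = Y q"
  proof
    fix h
    have o: "open U" using U by (simp add: open_part_def)
    have "X p (\<lambda>q. Y' q h) = X p (\<lambda>q. Y q h)" "Y p (\<lambda>q. X' q h) = Y p (\<lambda>q. X q h)"
      by (rule tangent_local[OF _ o U(2) p]; use TX TY X' Y' in simp)+
    then show "lie_bracket A X' Y' p h = lie_bracket A X Y p h"
      using X'[OF U(2)] Y'[OF U(2)] by (simp add: lie_bracket_def)
  qed
qed

end

text \<open>Closure of vector fields under the Lie bracket is an assumption here. On a manifold that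
  carries a torsion-free connection it is automatic, without the symmetry of second derivatives.\<close>

locale manifold_connection = manifold_atlas A
  for A :: "('a::{t2_space,second_countable_topology}, 'e::euclidean_space) chart set" +
  fixes D :: "'a connection"
  assumes affine: "affine_connection A D"
    and vector_field_lie_bracket:
      "open_part A U \<Longrightarrow> vector_field A U X \<Longrightarrow> vector_field A U Y \<Longrightarrow> vector_field A U (lie_bracket A X Y)"
begin

lemma
  assumes U: "open_part A U" and X: "vector_field A U X" "vector_field A U Y"
  shows connection_vector_field: "vector_field A U (D X Y)"
    and connection_cong: "(\<And>q. q \<in> U \<Longrightarrow> X' q = X q) \<Longrightarrow> (\<And>q. q \<in> U \<Longrightarrow> Y' q = Y q) \<Longrightarrow> p \<in> U \<Longrightarrow>
      D X' Y' p = D X Y p"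
    and connection_add_left: "vector_field A U Z \<Longrightarrow> p \<in> U \<Longrightarrow>
      D (\<lambda>q h. X q h + Z q h) Y p h = D X Y p h + D Z Y p h"
    and connection_add_right: "vector_field A U Z \<Longrightarrow> p \<in> U \<Longrightarrow>
      D X (\<lambda>q h. Y q h + Z q h) p h = D X Y p h + D X Z p h"
    and connection_mult_left: "smooth_function A U u \<Longrightarrow> p \<in> U \<Longrightarrow>
      D (\<lambda>q h. u q * X q h) Y p h = u p * D X Y p h"
    and connection_mult_right: "smooth_function A U u \<Longrightarrow> p \<in> U \<Longrightarrow>
      D X (\<lambda>q h. u q * Y q h) p h = X p u * Y p h + u p * D X Y p h"
proof -
  note a = affine[unfolded affine_connection_def, THEN spec, THEN spec, THEN spec, THEN mp,
      of U X Y, OF conjI[OF U conjI[OF X]]]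
  show "vector_field A U (D X Y)"
    using a[THEN conjunct2, THEN conjunct1] .
  show "(\<And>q. q \<in> U \<Longrightarrow> X' q = X q) \<Longrightarrow> (\<And>q. q \<in> U \<Longrightarrow> Y' q = Y q) \<Longrightarrow> p \<in> U \<Longrightarrow> D X' Y' p = D X Y p"
    by (rule a[THEN conjunct1, THEN spec, THEN spec, THEN mp, THEN bspec]) auto
  note b = a[THEN conjunct2, THEN conjunct2, THEN conjunct1, THEN spec, THEN mp, THEN bspec]
  show "vector_field A U Z \<Longrightarrow> p \<in> U \<Longrightarrow> D (\<lambda>q h. X q h + Z q h) Y p h = D X Y p h + D Z Y p h"
    by (rule b[THEN conjunct1, THEN fun_cong])
  show "vector_field A U Z \<Longrightarrow> p \<in> U \<Longrightarrow> D X (\<lambda>q h. Y q h + Z q h) p h = D X Y p h + D X Z p h"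
    by (rule b[THEN conjunct2, THEN fun_cong])
  note c = a[THEN conjunct2, THEN conjunct2, THEN conjunct2, THEN spec, THEN mp, THEN bspec]
  show "smooth_function A U u \<Longrightarrow> p \<in> U \<Longrightarrow> D (\<lambda>q h. u q * X q h) Y p h = u p * D X Y p h"
    by (rule c[THEN conjunct1, THEN fun_cong])
  show "smooth_function A U u \<Longrightarrow> p \<in> U \<Longrightarrow> D X (\<lambda>q h. u q * Y q h) p h = X p u * Y p h + u p * D X Y p h"
    by (rule c[THEN conjunct2, THEN fun_cong])
qed

lemma vector_field_curvature:
  assumes U: "open_part A U" and X: "vector_field A U X" "vector_field A U Y" "vector_field A U Z"
  shows "vector_field A U (curvature A D X Y Z)"
proof -
  have o: "open U" using U by (simp add: open_part_def)
  have 1: "vector_field A U (\<lambda>q h. (-1) * W q h)" if "vector_field A U W" for W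
    by (rule vector_field_mult[OF U smooth_function_const[OF o] that])
  note c = connection_vector_field[OF U] and l = vector_field_lie_bracket[OF U]
  have "vector_field A U (\<lambda>q h. D X (D Y Z) q h + (-1) * D Y (D X Z) q h + (-1) * D (lie_bracket A X Y) Z q h)"
    by (intro vector_field_add[OF U] 1 c l X)
  then show ?thesis
    by (simp add: curvature_def)
qed

text \<open>Linearity over functions holds because derivative terms cancel. In the first argument
  \<open>Y p u * D X Z p h\<close> arises both from the iterated derivative and from the bracket. In
  the third argument the first-order terms cancel in pairs, and the second derivatives of
  \<open>u\<close> form \<open>lie_bracket A X Y p u\<close>, which the last term removes.\<close>

lemma
  assumes U: "open_part A U" "p \<in> U"
    and X: "vector_field A U X" and Y: "vector_field A U Y" and Z: "vector_field A U Z"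
  shows curvature_cong: "(\<And>q. q \<in> U \<Longrightarrow> X' q = X q) \<Longrightarrow> (\<And>q. q \<in> U \<Longrightarrow> Y' q = Y q) \<Longrightarrow>
      (\<And>q. q \<in> U \<Longrightarrow> Z' q = Z q) \<Longrightarrow> curvature A D X' Y' Z' p = curvature A D X Y Z p"
    and curvature_antisym: "curvature A D X Y Z p h = - curvature A D Y X Z p h"
    and curvature_add_1: "vector_field A U W \<Longrightarrow>
      curvature A D (\<lambda>q h. X q h + W q h) Y Z p h = curvature A D X Y Z p h + curvature A D W Y Z p h"
    and curvature_add_3: "vector_field A U W \<Longrightarrow>
      curvature A D X Y (\<lambda>q h. Z q h + W q h) p h = curvature A D X Y Z p h + curvature A D X Y W p h"
    and curvature_mult_1: "smooth_function A U u \<Longrightarrow>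
      curvature A D (\<lambda>q h. u q * X q h) Y Z p h = u p * curvature A D X Y Z p h"
    and curvature_mult_3: "smooth_function A U u \<Longrightarrow>
      curvature A D X Y (\<lambda>q h. u q * Z q h) p h = u p * curvature A D X Y Z p h"
proof -
  have o: "open U" using U by (simp add: open_part_def)
  note c = connection_vector_field[OF U(1)] and l = vector_field_lie_bracket[OF U(1)]
    and m = vector_field_mult[OF U(1)] and a = vector_field_add[OF U(1)]
  show "curvature A D X' Y' Z' p = curvature A D X Y Z p"
    if X': "\<And>q. q \<in> U \<Longrightarrow> X' q = X q" and Y': "\<And>q. q \<in> U \<Longrightarrow> Y' q = Y q" and Z': "\<And>q. q \<in> U \<Longrightarrow> Z' q = Z q"
  proof -
    have "D X' (D Y' Z') p = D X (D Y Z) p" "D Y' (D X' Z') p = D Y (D X Z) p"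
      by (intro connection_cong[OF U(1)] X Y Z c X' Y' Z' U(2); assumption)+
    moreover have "D (lie_bracket A X' Y') Z' p = D (lie_bracket A X Y) Z p"
      by (intro connection_cong[OF U(1)] lie_bracket_cong[OF U(1)] X Y Z l X' Y' Z' U(2); assumption)
    ultimately show ?thesis
      by (simp add: curvature_def)
  qed
  have neg: "D (lie_bracket A X Y) Z p h = - D (lie_bracket A Y X) Z p h" for h
  proof -
    have "D (lie_bracket A X Y) Z p = D (\<lambda>q h. (-1) * lie_bracket A Y X q h) Z p"
      by (rule connection_cong[OF U(1) m[OF smooth_function_const[OF o] l[OF Y X]] Z])
        (use lie_bracket_antisym[OF U(1) _ X Y] U(2) in auto)
    then show ?thesis
      using connection_mult_left[OF U(1) l[OF Y X] Z smooth_function_const[OF o, of "-1"] U(2)] by simp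
  qed
  show "curvature A D X Y Z p h = - curvature A D Y X Z p h"
    unfolding curvature_def neg by simp
  show "curvature A D (\<lambda>q h. X q h + W q h) Y Z p h = curvature A D X Y Z p h + curvature A D W Y Z p h"
    if W: "vector_field A U W"
  proof -
    let ?S = "\<lambda>q h. X q h + W q h"
    have "D ?S (D Y Z) p h = D X (D Y Z) p h + D W (D Y Z) p h"
      by (rule connection_add_left[OF U(1) X c[OF Y Z] W U(2)])
    moreover have "D Y (D ?S Z) p h = D Y (D X Z) p h + D Y (D W Z) p h"
    proof -
      have "D Y (D ?S Z) p = D Y (\<lambda>q h. D X Z q h + D W Z q h) p"
        by (rule connection_cong[OF U(1) Y a[OF c[OF X Z] c[OF W Z]]])
          (use connection_add_left[OF U(1) X Z W] U(2) in auto)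
      then show ?thesis
        using connection_add_right[OF U(1) Y c[OF X Z] c[OF W Z] U(2)] by simp
    qed
    moreover have "D (lie_bracket A ?S Y) Z p h = D (lie_bracket A X Y) Z p h + D (lie_bracket A W Y) Z p h"
    proof -
      have "D (lie_bracket A ?S Y) Z p = D (\<lambda>q h. lie_bracket A X Y q h + lie_bracket A W Y q h) Z p"
        by (rule connection_cong[OF U(1) a[OF l[OF X Y] l[OF W Y]] Z])
          (use lie_bracket_add_left[OF U(1) _ X Y W] U(2) in auto)
      then show ?thesis
        using connection_add_left[OF U(1) l[OF X Y] Z l[OF W Y] U(2)] by simp
    qed
    ultimately show ?thesis
      by (simp add: curvature_def)
  qed
  show "curvature A D X Y (\<lambda>q h. Z q h + W q h) p h = curvature A D X Y Z p h + curvature A D X Y W p h"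
    if W: "vector_field A U W"
  proof -
    let ?S = "\<lambda>q h. Z q h + W q h"
    have 1: "D X (D Y ?S) p h = D X (D Y Z) p h + D X (D Y W) p h"
      if X: "vector_field A U X" and Y: "vector_field A U Y" for X Y
    proof -
      have "D X (D Y ?S) p = D X (\<lambda>q h. D Y Z q h + D Y W q h) p"
        by (rule connection_cong[OF U(1) X a[OF c[OF Y Z] c[OF Y W]]])
          (use connection_add_right[OF U(1) Y Z W] U(2) in auto)
      then show ?thesis
        using connection_add_right[OF U(1) X c[OF Y Z] c[OF Y W] U(2)] by simp
    qed
    show ?thesis
      using 1[OF X Y] 1[OF Y X] connection_add_right[OF U(1) l[OF X Y] Z W U(2)]
      by (simp add: curvature_def)
  qed
  show "curvature A D (\<lambda>q h. u q * X q h) Y Z p h = u p * curvature A D X Y Z p h"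
    if u: "smooth_function A U u"
  proof -
    let ?S = "\<lambda>q h. u q * X q h"
    have "D ?S (D Y Z) p h = u p * D X (D Y Z) p h"
      by (rule connection_mult_left[OF U(1) X c[OF Y Z] u U(2)])
    moreover have "D Y (D ?S Z) p h = Y p u * D X Z p h + u p * D Y (D X Z) p h"
    proof -
      have "D Y (D ?S Z) p = D Y (\<lambda>q h. u q * D X Z q h) p"
        by (rule connection_cong[OF U(1) Y m[OF u c[OF X Z]]])
          (use connection_mult_left[OF U(1) X Z u] U(2) in auto)
      then show ?thesis
        using connection_mult_right[OF U(1) Y c[OF X Z] u U(2)] by simp
    qed
    moreover have "D (lie_bracket A ?S Y) Z p h = u p * D (lie_bracket A X Y) Z p h - Y p u * D X Z p h"
    proof -
      have "smooth_function A U (\<lambda>q. Y q u)"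
        by (rule vector_field_smooth_function[OF Y o _ u]) simp
      then have v: "smooth_function A U (\<lambda>q. (-1) * Y q u)"
        by (rule smooth_function_cmult[OF o])
      have "D (lie_bracket A ?S Y) Z p = D (\<lambda>q h. u q * lie_bracket A X Y q h + (-1) * Y q u * X q h) Z p"
        by (rule connection_cong[OF U(1) a[OF m[OF u l[OF X Y]] m[OF v X]] Z])
          (use lie_bracket_mult_left[OF U(1) _ X Y u] U(2) in auto)
      then show ?thesis
        using connection_add_left[OF U(1) m[OF u l[OF X Y]] Z m[OF v X] U(2)]
          connection_mult_left[OF U(1) l[OF X Y] Z u U(2)] connection_mult_left[OF U(1) X Z v U(2)] by simp
    qed
    ultimately show ?thesis
      by (simp add: curvature_def algebra_simps)
  qed
  show "curvature A D X Y (\<lambda>q h. u q * Z q h) p h = u p * curvature A D X Y Z p h"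
    if u: "smooth_function A U u"
  proof -
    let ?S = "\<lambda>q h. u q * Z q h"
    have 1: "D X (D Y ?S) p h = X p (\<lambda>q. Y q u) * Z p h + Y p u * D X Z p h + X p u * D Y Z p h
        + u p * D X (D Y Z) p h"
      if X: "vector_field A U X" and Y: "vector_field A U Y" for X Y
    proof -
      have v: "smooth_function A U (\<lambda>q. Y q u)"
        by (rule vector_field_smooth_function[OF Y o _ u]) simp
      have "D X (D Y ?S) p = D X (\<lambda>q h. Y q u * Z q h + u q * D Y Z q h) p"
        by (rule connection_cong[OF U(1) X a[OF m[OF v Z] m[OF u c[OF Y Z]]]])
          (use connection_mult_right[OF U(1) Y Z u] U(2) in auto)
      then show ?thesis
        using connection_add_right[OF U(1) X m[OF v Z] m[OF u c[OF Y Z]] U(2)]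
          connection_mult_right[OF U(1) X Z v U(2)] connection_mult_right[OF U(1) X c[OF Y Z] u U(2)] by simp
    qed
    have lb: "lie_bracket A X Y p u = X p (\<lambda>q. Y q u) - Y p (\<lambda>q. X q u)"
      using smooth_nearI[OF U u] by (simp add: lie_bracket_def)
    show ?thesis
      by (simp add: curvature_def lb 1[OF X Y] 1[OF Y X] connection_mult_right[OF U(1) l[OF X Y] Z u U(2)]
          algebra_simps)
  qed
qed

end

text \<open>Metric and connection are kept independent, since the locale also has to cover the
  quarter-symmetric connection, which need not preserve the metric.\<close>

locale metric_connection = pseudo_riemannian A g + manifold_connection A D
  for A :: "('a::{t2_space,second_countable_topology}, 'e::euclidean_space) chart set"
    and g :: "'a metric" and D :: "'a connection"
begin

lemma
  assumes V: "open_part A V" "p \<in> V" and Y: "vector_field A V Y" and Z: "vector_field A V Z"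
    and w: "w \<in> tangent_space A p"
  shows curvature_tensorial_1: "tensorial_at A p (\<lambda>X. g p (curvature A D X Y Z p) w)"
    and curvature_tensorial_2: "tensorial_at A p (\<lambda>X. g p (curvature A D Y X Z p) w)"
    and curvature_tensorial_3: "tensorial_at A p (\<lambda>X. g p (curvature A D Y Z X p) w)"
proof -
  have p: "p \<in> points A" by (rule open_part_points[OF V])
  have T: "curvature A D X Y Z p \<in> tangent_space A p"
    if "open_part A U" "p \<in> U" "vector_field A U X" "vector_field A U Y" "vector_field A U Z" for U X Y Z
    using vector_fieldD[OF vector_field_curvature] that by blast
  note sub = vector_field_subset
  have 1: "tensorial_at A p (\<lambda>X. g p (curvature A D X Y Z p) w)"
    if Y: "vector_field A V Y" and Z: "vector_field A V Z" for Y Z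
  proof (rule tensorial_atI[OF V])
    fix U X X' assume U: "open_part A U" "U \<subseteq> V" "p \<in> U" and X: "vector_field A U X" "vector_field A U X'"
    note c = sub[OF Y U(2)] sub[OF Z U(2)]
    have "curvature A D (\<lambda>q h. X q h + X' q h) Y Z p =
        (\<lambda>h. curvature A D X Y Z p h + curvature A D X' Y Z p h)"
      using curvature_add_1[OF U(1,3) X(1) c X(2)] by (intro ext)
    then show "g p (curvature A D (\<lambda>q h. X q h + X' q h) Y Z p) w =
        g p (curvature A D X Y Z p) w + g p (curvature A D X' Y Z p) w"
      using metric_add_left[OF p T[OF U(1,3) X(1) c] T[OF U(1,3) X(2) c] w] by simp
  next
    fix U X u assume U: "open_part A U" "U \<subseteq> V" "p \<in> U" and X: "vector_field A U X" and u: "smooth_function A U u"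
    note c = sub[OF Y U(2)] sub[OF Z U(2)]
    have "curvature A D (\<lambda>q h. u q * X q h) Y Z p = (\<lambda>h. u p * curvature A D X Y Z p h)"
      using curvature_mult_1[OF U(1,3) X c u] by (intro ext)
    then show "g p (curvature A D (\<lambda>q h. u q * X q h) Y Z p) w = u p * g p (curvature A D X Y Z p) w"
      using metric_cmult_left[OF p T[OF U(1,3) X c] w w] by simp
  next
    fix U X X' assume U: "open_part A U" "U \<subseteq> V" "p \<in> U" and X: "vector_field A U X"
      and X': "\<And>q. q \<in> U \<Longrightarrow> X' q = X q"
    show "g p (curvature A D X' Y Z p) w = g p (curvature A D X Y Z p) w"
      using curvature_cong[OF U(1,3) X sub[OF Y U(2)] sub[OF Z U(2)] X'] by simp
  qed
  show "tensorial_at A p (\<lambda>X. g p (curvature A D X Y Z p) w)"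
    by (rule 1[OF Y Z])
  note * = 1[OF Y Z]
  \<comment> \<open>Antisymmetry reduces the second argument to the first.\<close>
  have neg: "g p (curvature A D Y X Z p) w = - g p (curvature A D X Y Z p) w"
    if U: "open_part A U" "U \<subseteq> V" "p \<in> U" and X: "vector_field A U X" for U X
  proof -
    note c = sub[OF Y U(2)] sub[OF Z U(2)]
    have "curvature A D Y X Z p = (\<lambda>h. (-1) * curvature A D X Y Z p h)"
      using curvature_antisym[OF U(1,3) c(1) X c(2)] by (intro ext) simp
    then show ?thesis
      using metric_cmult_left[OF p T[OF U(1,3) X c] w w, of "-1"] by simp
  qed
  show "tensorial_at A p (\<lambda>X. g p (curvature A D Y X Z p) w)"
  proof (rule tensorial_atI[OF V], goal_cases)
    case (1 U X X')
    show ?case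
      using neg[OF 1(1-3)] tensorial_at_add[OF * 1(1,3-5)]
        vector_field_add[OF 1(1,4,5)] 1(4,5) by simp
  next
    case (2 U X u)
    show ?case
      using neg[OF 2(1-3)] tensorial_at_mult[OF * 2(1,3-5)]
        vector_field_mult[OF 2(1,5,4)] 2(4) by simp
  next
    case (3 U X X')
    then show ?case
      using curvature_cong[OF 3(1,3) sub[OF Y 3(2)] 3(4) sub[OF Z 3(2)], of Y X' Z] by simp
  qed
  show "tensorial_at A p (\<lambda>X. g p (curvature A D Y Z X p) w)"
  proof (rule tensorial_atI[OF V])
    fix U X X' assume U: "open_part A U" "U \<subseteq> V" "p \<in> U" and X: "vector_field A U X" "vector_field A U X'"
    note c = sub[OF Y U(2)] sub[OF Z U(2)]
    have "curvature A D Y Z (\<lambda>q h. X q h + X' q h) p =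
        (\<lambda>h. curvature A D Y Z X p h + curvature A D Y Z X' p h)"
      using curvature_add_3[OF U(1,3) c X] by (intro ext)
    then show "g p (curvature A D Y Z (\<lambda>q h. X q h + X' q h) p) w =
        g p (curvature A D Y Z X p) w + g p (curvature A D Y Z X' p) w"
      using metric_add_left[OF p T[OF U(1,3) c X(1)] T[OF U(1,3) c X(2)] w] by simp
  next
    fix U X u assume U: "open_part A U" "U \<subseteq> V" "p \<in> U" and X: "vector_field A U X" and u: "smooth_function A U u"
    note c = sub[OF Y U(2)] sub[OF Z U(2)]
    have "curvature A D Y Z (\<lambda>q h. u q * X q h) p = (\<lambda>h. u p * curvature A D Y Z X p h)"
      using curvature_mult_3[OF U(1,3) c X u] by (intro ext)
    then show "g p (curvature A D Y Z (\<lambda>q h. u q * X q h) p) w = u p * g p (curvature A D Y Z X p) w"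
      using metric_cmult_left[OF p T[OF U(1,3) c X] w w] by simp
  next
    fix U X X' assume U: "open_part A U" "U \<subseteq> V" "p \<in> U" and X: "vector_field A U X"
      and X': "\<And>q. q \<in> U \<Longrightarrow> X' q = X q"
    show "g p (curvature A D Y Z X' p) w = g p (curvature A D Y Z X p) w"
      using curvature_cong[OF U(1,3) sub[OF Y U(2)] sub[OF Z U(2)] X, of Y Z X'] X' by simp
  qed
qed

text \<open>The matrix \<open>a\<close> that expands one frame in the other relates the two diagonal
  sign matrices, so the signed traces of a bilinear form agree. The sign sequences of the two frames
  may be different.\<close>

lemma frame_trace_unique:
  assumes U: "open_part A U" "p \<in> U" "orthonormal_frame A g U \<epsilon> E"
    and U': "open_part A U'" "p \<in> U'" "orthonormal_frame A g U' \<epsilon>' E'"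
    and V: "open_part A V" "p \<in> V" "vector_field A V X" "vector_field A V Y"
  shows "(\<Sum>k<DIM('e). \<epsilon> k * g p (curvature A D X (E k) Y p) (E k p)) =
    (\<Sum>k<DIM('e). \<epsilon>' k * g p (curvature A D X (E' k) Y p) (E' k p))"
proof -
  let ?N = "{..<DIM('e)}"
  let ?W = "U \<inter> U' \<inter> V"
  have W: "open_part A ?W" "p \<in> ?W"
    using U U' V by (auto intro: open_part_Int)
  have oW: "open ?W" using W(1) by (simp add: open_part_def)
  have p: "p \<in> points A" by (rule open_part_points[OF W])
  have E: "vector_field A ?W (E k)" and E': "vector_field A ?W (E' k)" if "k \<in> ?N" for k
    using U(3) U'(3) that by (auto simp: orthonormal_frame_def intro: vector_field_subset)
  note EW = vector_fieldD[OF E W(2)] and EW' = vector_fieldD[OF E' W(2)]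
  have X: "vector_field A ?W X" and Y: "vector_field A ?W Y"
    using V(3,4) by (auto intro: vector_field_subset)
  define a where "a j k q = \<epsilon>' k * g q (E j q) (E' k q)" for j k q
  have a: "smooth_function A ?W (a j k)" if "j \<in> ?N" "k \<in> ?N" for j k
    unfolding a_def by (rule smooth_function_cmult[OF oW metric_smooth[OF W(1) E E']]) (use that in auto)
  have expand: "E j q h = (\<Sum>k<DIM('e). a j k q * E' k q h)" if "j \<in> ?N" "q \<in> ?W" for j q h
    unfolding a_def
    by (rule orthonormal_frame_expand[OF U'(3,1)]) (use that vector_fieldD[OF E] in auto)
  define G where "G k m = g p (curvature A D X (E' k) Y p) (E' m p)" for k m
  have R: "curvature A D X (E' k) Y p \<in> tangent_space A p" if "k \<in> ?N" for k
    by (rule vector_fieldD[OF vector_field_curvature[OF W(1) X E'[OF that] Y] W(2)])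
  have 1: "g p (curvature A D X (E j) Y p) (E j p) = (\<Sum>k\<in>?N. \<Sum>m\<in>?N. a j k p * (a j m p * G k m))"
    if j: "j \<in> ?N" for j
  proof -
    have "g p (curvature A D X (E j) Y p) (E j p)
        = (\<Sum>k\<in>?N. a j k p * g p (curvature A D X (E' k) Y p) (E j p))"
      by (rule tensorial_at_expand[OF curvature_tensorial_2[OF W X Y EW[OF j]] W _ a[OF j] E' expand[OF j]])
        auto
    also have "\<dots> = (\<Sum>k\<in>?N. a j k p * (\<Sum>m\<in>?N. a j m p * G k m))"
    proof (rule sum.cong[OF refl])
      fix k assume k: "k \<in> ?N"
      have "E j p = (\<lambda>h. \<Sum>m\<in>?N. a j m p * E' m p h)"
        using expand[OF j W(2)] by (intro ext)
      then show "a j k p * g p (curvature A D X (E' k) Y p) (E j p) = a j k p * (\<Sum>m\<in>?N. a j m p * G k m)"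
        using metric_sum_right[OF p R[OF k], of ?N "\<lambda>m. E' m p" "\<lambda>m. a j m p"] EW'
        by (simp add: G_def)
    qed
    finally show ?thesis
      by (simp add: sum_distrib_left)
  qed
  \<comment> \<open>Pseudo-orthogonality of \<open>a\<close>: expand \<open>E' k\<close> in the
    frame \<open>E\<close> and pair with \<open>E' m\<close>. The factors
    \<open>\<epsilon>' k * \<epsilon>' m\<close> hidden in \<open>a\<close> are harmless, being 1
    for \<open>k = m\<close>, while for \<open>k \<noteq> m\<close> both sides are 0.\<close>
  have 2: "(\<Sum>j\<in>?N. \<epsilon> j * (a j k p * a j m p)) = (if k = m then \<epsilon>' k else 0)" if k: "k \<in> ?N" and m: "m \<in> ?N" for k m
  proof -
    have "g p (E' k p) (E' m p) = g p (\<lambda>h. \<Sum>j\<in>?N. (\<epsilon> j * g p (E' k p) (E j p)) * E j p h) (E' m p)"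
      using orthonormal_frame_expand[OF U(3,1,2) EW'[OF k]] by metis
    also have "\<dots> = (\<Sum>j\<in>?N. \<epsilon> j * g p (E' k p) (E j p) * g p (E j p) (E' m p))"
      by (rule metric_sum_left[OF p EW'[OF m]]) (use EW in auto)
    also have "\<dots> = (\<Sum>j\<in>?N. \<epsilon> j * (g p (E j p) (E' k p) * g p (E j p) (E' m p)))"
      by (rule sum.cong) (use metric_sym[OF p EW EW'[OF k]] in auto)
    finally have "\<epsilon>' k * \<epsilon>' m * g p (E' k p) (E' m p) = (\<Sum>j\<in>?N. \<epsilon> j * (a j k p * a j m p))"
      by (simp add: a_def sum_distrib_left algebra_simps)
    moreover have "g p (E' k p) (E' m p) = (if k = m then \<epsilon>' k else 0)" "\<epsilon>' k = 1 \<or> \<epsilon>' k = -1"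
      using U'(2,3) k m by (auto simp: orthonormal_frame_def)
    ultimately show ?thesis by auto
  qed
  have "(\<Sum>j\<in>?N. \<epsilon> j * g p (curvature A D X (E j) Y p) (E j p)) =
      (\<Sum>j\<in>?N. \<Sum>k\<in>?N. \<Sum>m\<in>?N. \<epsilon> j * (a j k p * a j m p) * G k m)"
    using 1 by (simp add: sum_distrib_left mult.assoc)
  also have "\<dots> = (\<Sum>k\<in>?N. \<Sum>j\<in>?N. \<Sum>m\<in>?N. \<epsilon> j * (a j k p * a j m p) * G k m)"
    by (rule sum.swap)
  also have "\<dots> = (\<Sum>k\<in>?N. \<Sum>m\<in>?N. (\<Sum>j\<in>?N. \<epsilon> j * (a j k p * a j m p)) * G k m)"
    unfolding sum_distrib_right by (intro sum.cong refl sum.swap)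
  also have "\<dots> = (\<Sum>k\<in>?N. \<Sum>m\<in>?N. if m = k then \<epsilon>' k * G k k else 0)"
    by (intro sum.cong refl) (use 2 in auto)
  also have "\<dots> = (\<Sum>k\<in>?N. \<epsilon>' k * G k k)"
    by simp
  finally show ?thesis
    by (simp add: G_def)
qed

text \<open>Eliminates the \<open>SOME\<close> in the definition of \<open>ricci\<close>: the given
  frame shows that the choice succeeds, and independence of the frame makes the chosen one
  irrelevant.\<close>

lemma ricci_frame:
  assumes U: "open_part A U" "p \<in> U" "orthonormal_frame A g U \<epsilon> E"
    and V: "open_part A V" "p \<in> V" "vector_field A V X" "vector_field A V Y"
  shows "ricci A g D X Y p = (\<Sum>k<DIM('e). \<epsilon> k * g p (curvature A D X (E k) Y p) (E k p))"
proof -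
  let ?P = "\<lambda>(\<epsilon>, E). \<exists>U. open_part A U \<and> p \<in> U \<and> orthonormal_frame A g U \<epsilon> E"
  obtain \<epsilon>' E' where some: "(SOME z. ?P z) = (\<epsilon>', E')"
    by fastforce
  have "?P (\<epsilon>, E)" using U by auto
  then have "?P (\<epsilon>', E')"
    unfolding some[symmetric] by (rule someI)
  then obtain U' where U': "open_part A U'" "p \<in> U'" "orthonormal_frame A g U' \<epsilon>' E'"
    by auto
  have "ricci A g D X Y p = (\<Sum>k<DIM('e). \<epsilon>' k * g p (curvature A D X (E' k) Y p) (E' k p))"
    unfolding ricci_def some by simp
  then show ?thesis
    using frame_trace_unique[OF U' U V] by simp
qed

text \<open>The formula for \<open>S\<close> is demanded only of fields near \<open>p\<close>,
  because only for these does \<open>ricci\<close> have its expression in a frame.\<close>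

lemma tensorial_at_linear_combination:
  assumes V: "open_part A V" "p \<in> V"
    and T: "\<And>k. k \<in> K \<Longrightarrow> tensorial_at A p (T k)"
    and S: "\<And>U X. open_part A U \<Longrightarrow> p \<in> U \<Longrightarrow> vector_field A U X \<Longrightarrow> S X = (\<Sum>k\<in>K. c k * T k X)"
  shows "tensorial_at A p S"
proof (rule tensorial_atI[OF V])
  fix U X Y assume U: "open_part A U" "p \<in> U" and X: "vector_field A U X" "vector_field A U Y"
  show "S (\<lambda>q h. X q h + Y q h) = S X + S Y"
    unfolding S[OF U X(1)] S[OF U X(2)] S[OF U vector_field_add[OF U(1) X]]
    using tensorial_at_add[OF T U X] by (simp add: sum.distrib algebra_simps)
next
  fix U X u assume U: "open_part A U" "p \<in> U" and X: "vector_field A U X" "smooth_function A U u"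
  show "S (\<lambda>q h. u q * X q h) = u p * S X"
    unfolding S[OF U X(1)] S[OF U vector_field_mult[OF U(1) X(2,1)]]
    using tensorial_at_mult[OF T U X] by (simp add: sum_distrib_left algebra_simps)
next
  fix U X X' assume U: "open_part A U" "p \<in> U" and X: "vector_field A U X" "\<And>q. q \<in> U \<Longrightarrow> X' q = X q"
  have X': "vector_field A U X'"
    by (rule vector_field_cong[OF _ X(1)]) (use X(2) in simp)
  show "S X' = S X"
    unfolding S[OF U X(1)] S[OF U X']
    using tensorial_at_cong[OF T U X] by simp
qed

lemma
  assumes V: "open_part A V" "p \<in> V" and Y: "vector_field A V Y"
  shows ricci_tensorial_1: "tensorial_at A p (\<lambda>X. ricci A g D X Y p)"
    and ricci_tensorial_2: "tensorial_at A p (\<lambda>X. ricci A g D Y X p)"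
proof -
  obtain U \<epsilon> E where U: "open_part A U" "p \<in> U" "orthonormal_frame A g U \<epsilon> E"
    using orthonormal_frame_exists[OF open_part_points[OF V]] .
  let ?W = "U \<inter> V"
  have W: "open_part A ?W" "p \<in> ?W"
    using U V open_part_Int by auto
  have E: "vector_field A ?W (E k)" if "k \<in> {..<DIM('e)}" for k
    using U(3) that by (auto simp: orthonormal_frame_def intro: vector_field_subset)
  have YW: "vector_field A ?W Y"
    using Y by (rule vector_field_subset) auto
  note EW = vector_fieldD[OF E W(2)]
  show "tensorial_at A p (\<lambda>X. ricci A g D X Y p)"
  proof (rule tensorial_at_linear_combination[OF W curvature_tensorial_1[OF W E YW EW]])
    fix U' X assume U': "open_part A U'" "p \<in> U'" "vector_field A U' X"
    show "ricci A g D X Y p = (\<Sum>k\<in>{..<DIM('e)}. \<epsilon> k * g p (curvature A D X (E k) Y p) (E k p))"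
      by (rule ricci_frame[OF U open_part_Int[OF U'(1) V(1)]])
        (use U' V vector_field_subset[OF U'(3)] vector_field_subset[OF Y] in auto)
  qed
  show "tensorial_at A p (\<lambda>X. ricci A g D Y X p)"
  proof (rule tensorial_at_linear_combination[OF W curvature_tensorial_3[OF W YW E EW]])
    fix U' X assume U': "open_part A U'" "p \<in> U'" "vector_field A U' X"
    show "ricci A g D Y X p = (\<Sum>k\<in>{..<DIM('e)}. \<epsilon> k * g p (curvature A D Y (E k) X p) (E k p))"
      by (rule ricci_frame[OF U open_part_Int[OF U'(1) V(1)]])
        (use U' V vector_field_subset[OF U'(3)] vector_field_subset[OF Y] in auto)
  qed
qed

end

section \<open>The product of an interval and a manifold\<close>

definition lift_vector ::
  "real set \<Rightarrow> ('a::topological_space, 'e::euclidean_space) chart set \<Rightarrow> real \<Rightarrow> 'a \<Rightarrow> 'a tvec \<Rightarrow> (real \<times> 'a) tvec" where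
  "lift_vector I F t x = pushforward (warped_atlas I F) (Pair t) x"

definition lift_field ::
  "real set \<Rightarrow> ('a::topological_space, 'e::euclidean_space) chart set \<Rightarrow> 'a vfield \<Rightarrow> (real \<times> 'a) vfield" where
  "lift_field I F X = (\<lambda>(t, x). lift_vector I F t x (X x))"

locale interval_product = F: manifold_atlas F
  for F :: "('a::{t2_space,second_countable_topology}, 'e::euclidean_space) chart set" +
  fixes I :: "real set"
  assumes open_interval: "open I" and interval_nonempty: "I \<noteq> {}"
begin

abbreviation "M \<equiv> warped_atlas I F"

abbreviation "dt \<equiv> del_t I F"

abbreviation "lift \<equiv> lift_field I F"

lemma product_chart_iff: "c \<in> M \<longleftrightarrow> (\<exists>V \<psi>. (V, \<psi>) \<in> F \<and> c = (I \<times> V, map_prod id \<psi>))"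
  by (auto simp: product_atlas_def interval_atlas_def)

lemma product_chart: "(V, \<psi>) \<in> F \<Longrightarrow> (I \<times> V, map_prod id \<psi>) \<in> M"
  by (auto simp: product_chart_iff)

lemma product_chart_inv:
  assumes "(V, \<psi>) \<in> F" "t \<in> I" "y \<in> \<psi> ` V"
  shows "inv_into (I \<times> V) (map_prod id \<psi>) (t, y) = (t, inv_into V \<psi> y)"
proof -
  have "inj_on (map_prod id \<psi>) (I \<times> V)"
    using F.inj_chart[OF assms(1)] by (auto simp: inj_on_def)
  moreover have "(t, y) = map_prod id \<psi> (t, inv_into V \<psi> y)" "(t, inv_into V \<psi> y) \<in> I \<times> V"
    using assms by (auto simp: f_inv_into_f intro: inv_into_into)
  ultimately show ?thesis
    by (metis inv_into_f_f)
qed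

lemma product_chart_image: "map_prod id \<psi> ` (I \<times> V) = I \<times> \<psi> ` V"
  by (auto simp: map_prod_def)

lemma points_product: "points M = I \<times> points F"
proof
  show "points M \<subseteq> I \<times> points F"
    by (auto simp: points_def product_chart_iff) force
  show "I \<times> points F \<subseteq> points M"
  proof safe
    fix t x assume "t \<in> I" "x \<in> points F"
    then show "(t, x) \<in> points M"
      using F.chart_at product_chart unfolding points_def by (metis SigmaI UN_I fst_conv)
  qed
qed

lemma smooth_manifold_product: "smooth_manifold M"
  unfolding smooth_manifold_def
proof (intro conjI ballI)
  show "points M \<noteq> {}"
    using interval_nonempty F.smooth_manifold by (auto simp: points_product smooth_manifold_def)
next
  fix c assume "c \<in> M"
  then obtain V \<psi> where V: "(V, \<psi>) \<in> F" and c: "c = (I \<times> V, map_prod id \<psi>)"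
    by (auto simp: product_chart_iff)
  have "homeomorphism (I \<times> V) (I \<times> \<psi> ` V) (map_prod id \<psi>) (map_prod id (inv_into V \<psi>))"
    unfolding homeomorphism_def
  proof (intro conjI)
    show "continuous_on (I \<times> V) (map_prod id \<psi>)"
      unfolding map_prod_def split_def id_def
      by (intro continuous_intros continuous_on_compose2[OF F.continuous_chart[OF V]]) auto
    show "continuous_on (I \<times> \<psi> ` V) (map_prod id (inv_into V \<psi>))"
      unfolding map_prod_def split_def id_def
      by (intro continuous_intros continuous_on_compose2[OF F.continuous_inv_chart[OF V]]) auto
    show "map_prod id (inv_into V \<psi>) ` (I \<times> \<psi> ` V) = I \<times> V"
      using V by (auto simp: image_iff inv_into_into)
  qed (use V in \<open>auto simp: product_chart_image f_inv_into_f\<close>)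
  then show "is_chart c"
    using F.open_chart[OF V] F.open_chart_image[OF V] open_interval
    by (auto simp: c is_chart_def product_chart_image intro: open_Times)
next
  fix c d assume "c \<in> M" "d \<in> M"
  then obtain V \<phi> W \<psi> where V: "(V, \<phi>) \<in> F" and c: "c = (I \<times> V, map_prod id \<phi>)"
    and W: "(W, \<psi>) \<in> F" and d: "d = (I \<times> W, map_prod id \<psi>)"
    by (auto simp: product_chart_iff)
  let ?S = "I \<times> \<phi> ` (V \<inter> W)"
  have oVW: "open (\<phi> ` (V \<inter> W))"
    using F.open_chart_image_Int[OF V F.open_chart[OF W]] by (simp add: Int_commute)
  then have o: "open ?S"
    by (intro open_Times open_interval)
  have "smooth_on ?S (\<lambda>z. (\<psi> \<circ> inv_into V \<phi>) (snd z))"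
    by (rule smooth_on_compose[OF o oVW _ _ F.smooth_transition[OF V W]])
      (auto intro: smooth_on_bounded_linear[OF o bounded_linear_snd])
  then have "smooth_on ?S (\<lambda>z. (fst z, (\<psi> \<circ> inv_into V \<phi>) (snd z)))"
    by (rule smooth_on_Pair[OF o smooth_on_bounded_linear[OF o bounded_linear_fst]])
  then have "smooth_on ?S (map_prod id \<psi> \<circ> inv_into (I \<times> V) (map_prod id \<phi>))"
  proof (rule smooth_on_cong[OF o, rotated])
    fix z assume "z \<in> ?S"
    then obtain t y where "z = (t, y)" "t \<in> I" "y \<in> \<phi> ` V" by auto
    then show "(fst z, (\<psi> \<circ> inv_into V \<phi>) (snd z)) = (map_prod id \<psi> \<circ> inv_into (I \<times> V) (map_prod id \<phi>)) z"
      by (simp add: product_chart_inv[OF V])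
  qed
  moreover have "(I \<times> V) \<inter> (I \<times> W) = I \<times> (V \<inter> W)" by auto
  ultimately show "smoothly_compatible c d"
    by (simp add: smoothly_compatible_def c d product_chart_image)
qed

sublocale M: manifold_atlas M
  by (unfold_locales) (rule smooth_manifold_product)

lemma open_part_product: "open_part F U \<Longrightarrow> open_part M (I \<times> U)"
  using open_interval by (auto simp: open_part_def points_product intro: open_Times)

lemma smooth_function_snd:
  assumes "open U" "smooth_function F U u"
  shows "smooth_function M (I \<times> U) (\<lambda>q. u (snd q))"
  unfolding smooth_function_def
proof (rule ballI)
  fix c assume "c \<in> M"
  then obtain V \<psi> where V: "(V, \<psi>) \<in> F" and c: "c = (I \<times> V, map_prod id \<psi>)"
    by (auto simp: product_chart_iff)
  let ?S = "I \<times> \<psi> ` (U \<inter> V)"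
  have oU: "open (\<psi> ` (U \<inter> V))"
    by (rule F.open_chart_image_Int[OF V assms(1)])
  then have o: "open ?S"
    by (intro open_Times open_interval)
  have sm: "smooth_on (\<psi> ` (U \<inter> V)) (u \<circ> inv_into V \<psi>)"
    using V assms(2) by (auto simp: smooth_function_def)
  have "smooth_on ?S (\<lambda>z. (u \<circ> inv_into V \<psi>) (snd z))"
    by (rule smooth_on_compose[OF o oU _ _ sm])
      (auto intro: smooth_on_bounded_linear[OF o bounded_linear_snd])
  then have "smooth_on ?S ((\<lambda>q. u (snd q)) \<circ> inv_into (I \<times> V) (map_prod id \<psi>))"
  proof (rule smooth_on_cong[OF o, rotated])
    fix z assume "z \<in> ?S"
    then obtain t y where "z = (t, y)" "t \<in> I" "y \<in> \<psi> ` V" by auto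
    then show "(u \<circ> inv_into V \<psi>) (snd z) = ((\<lambda>q. u (snd q)) \<circ> inv_into (I \<times> V) (map_prod id \<psi>)) z"
      by (simp add: product_chart_inv[OF V])
  qed
  moreover have "(I \<times> U) \<inter> (I \<times> V) = I \<times> (U \<inter> V)" by auto
  ultimately show "case c of (V, \<phi>) \<Rightarrow> smooth_on (\<phi> ` ((I \<times> U) \<inter> V)) ((\<lambda>q. u (snd q)) \<circ> inv_into V \<phi>)"
    by (simp add: c product_chart_image)
qed

lemma smooth_function_fst:
  assumes "open U" "smooth_on I k"
  shows "smooth_function M (I \<times> U) (\<lambda>q. k (fst q))"
  unfolding smooth_function_def
proof (rule ballI)
  fix c assume "c \<in> M"
  then obtain V \<psi> where V: "(V, \<psi>) \<in> F" and c: "c = (I \<times> V, map_prod id \<psi>)"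
    by (auto simp: product_chart_iff)
  let ?S = "I \<times> \<psi> ` (U \<inter> V)"
  have o: "open ?S"
    by (intro open_Times open_interval F.open_chart_image_Int[OF V assms(1)])
  have "smooth_on ?S (\<lambda>z. k (fst z))"
    by (rule smooth_on_compose[OF o open_interval _ _ assms(2)])
      (auto intro: smooth_on_bounded_linear[OF o bounded_linear_fst])
  then have "smooth_on ?S ((\<lambda>q. k (fst q)) \<circ> inv_into (I \<times> V) (map_prod id \<psi>))"
  proof (rule smooth_on_cong[OF o, rotated])
    fix z assume "z \<in> ?S"
    then obtain t y where "z = (t, y)" "t \<in> I" "y \<in> \<psi> ` V" by auto
    then show "k (fst z) = ((\<lambda>q. k (fst q)) \<circ> inv_into (I \<times> V) (map_prod id \<psi>)) z"
      by (simp add: product_chart_inv[OF V])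
  qed
  moreover have "(I \<times> U) \<inter> (I \<times> V) = I \<times> (U \<inter> V)" by auto
  ultimately show "case c of (V, \<phi>) \<Rightarrow> smooth_on (\<phi> ` ((I \<times> U) \<inter> V)) ((\<lambda>q. k (fst q)) \<circ> inv_into V \<phi>)"
    by (simp add: c product_chart_image)
qed

lemma smooth_near_snd: "smooth_near F x u \<Longrightarrow> t \<in> I \<Longrightarrow> smooth_near M (t, x) (\<lambda>q. u (snd q))"
  unfolding smooth_near_def using open_part_product smooth_function_snd
  by (metis SigmaI open_part_def)

text \<open>The inclusion of the slice at \<open>t\<close> is smooth. So a fibre vector does not
  fall back to its default value when its lift is applied to a smooth function.\<close>

lemma smooth_near_slice:
  assumes "smooth_near M (t, x) h"
  shows "smooth_near F x (\<lambda>y. h (t, y))"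
proof -
  obtain W where W: "open_part M W" "(t, x) \<in> W" "smooth_function M W h"
    using assms by (auto simp: smooth_near_def)
  have t: "t \<in> I" and sub: "W \<subseteq> I \<times> points F"
    using W by (auto simp: open_part_def points_product)
  have oW: "open W" using W by (simp add: open_part_def)
  let ?W = "Pair t -` W"
  have oS: "open ?W"
    by (intro open_vimage oW continuous_intros)
  have "smooth_function F ?W (\<lambda>y. h (t, y))"
    unfolding smooth_function_def
  proof safe
    fix V \<psi> assume V: "(V, \<psi>) \<in> F"
    let ?c = "map_prod id \<psi>"
    note MV = product_chart[OF V]
    have o: "open (\<psi> ` (?W \<inter> V))"
      by (rule F.open_chart_image_Int[OF V oS])
    have sm: "smooth_on (?c ` (W \<inter> (I \<times> V))) (h \<circ> inv_into (I \<times> V) ?c)"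
      using W(3) MV unfolding smooth_function_def by fast
    have "smooth_on (\<psi> ` (?W \<inter> V)) (\<lambda>y. (h \<circ> inv_into (I \<times> V) ?c) (t, y))"
    proof (rule smooth_on_compose[OF o M.open_chart_image_Int[OF MV oW] _ _ sm])
      show "Pair t ` \<psi> ` (?W \<inter> V) \<subseteq> ?c ` (W \<inter> I \<times> V)"
        using t by (auto simp: image_iff map_prod_def split_def) force
      show "smooth_on (\<psi> ` (?W \<inter> V)) (Pair t)"
        using smooth_on_Pair[OF o smooth_on_const[OF o] smooth_on_bounded_linear[OF o bounded_linear_ident]] .
    qed
    then show "smooth_on (\<psi> ` (?W \<inter> V)) ((\<lambda>y. h (t, y)) \<circ> inv_into V \<psi>)"
      by (rule smooth_on_cong[OF o, rotated]) (use t in \<open>auto simp: product_chart_inv[OF V]\<close>)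
  qed
  moreover have "open_part F ?W" "x \<in> ?W"
    using oS sub W(2) by (auto simp: open_part_def)
  ultimately show ?thesis
    by (auto simp: smooth_near_def)
qed

section \<open>Tangent vectors of the product\<close>

lemma lift_vector_apply:
  "lift_vector I F t x v h = (if smooth_near M (t, x) h then v (\<lambda>y. h (t, y)) else 0)"
  by (simp add: lift_vector_def pushforward_def o_def)

lemma del_t_apply:
  "dt (t, x) h = (if smooth_near M (t, x) h then deriv (\<lambda>s. h (s, x)) t else 0)"
  by (simp add: del_t_def velocity_def o_def)

lemma del_t_eq_coordinate_field:
  assumes V: "(V, \<psi>) \<in> F" "x \<in> V" and t: "t \<in> I"
  shows "dt (t, x) = coordinate_field M (I \<times> V, map_prod id \<psi>) (1, 0) (t, x)"
proof -
  let ?\<gamma> = "\<lambda>s. (s, x)"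
  have "smooth_curve M I ?\<gamma>"
    unfolding smooth_curve_def
  proof (intro conjI ballI)
    show "continuous_on I ?\<gamma>" by (intro continuous_intros)
    show "?\<gamma> ` I \<subseteq> points M"
      using F.chart_subset_points[OF V(1)] V(2) by (auto simp: points_product)
    fix c assume "c \<in> M"
    then obtain W \<phi> where W: "(W, \<phi>) \<in> F" and c: "c = (I \<times> W, map_prod id \<phi>)"
      by (auto simp: product_chart_iff)
    have "smooth_on I (\<lambda>s. (s, \<phi> x))"
      by (intro smooth_on_Pair open_interval smooth_on_const smooth_on_bounded_linear bounded_linear_ident)
    then show "case c of (U, \<phi>) \<Rightarrow> smooth_on {s \<in> I. ?\<gamma> s \<in> U} (\<phi> \<circ> ?\<gamma>)"
      by (auto simp: c o_def intro: smooth_on_subset)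
  qed
  note * = M.velocity_eq_coordinate_field[OF this open_interval t product_chart[OF V(1)]]
  have "((\<lambda>s. (s, \<psi> x)) has_derivative (\<lambda>s. (s, 0))) (at t)"
    by (intro derivative_intros)
  then have "frechet_derivative (map_prod id \<psi> \<circ> ?\<gamma>) (at t) 1 = (1, 0)"
    by (simp add: o_def frechet_derivative_at[symmetric])
  then show ?thesis
    using * t V by (simp add: del_t_def)
qed

lemma lift_vector_coordinate_field:
  assumes V: "(V, \<psi>) \<in> F" "x \<in> V" and t: "t \<in> I"
  shows "lift_vector I F t x (coordinate_field F (V, \<psi>) w x) =
    coordinate_field M (I \<times> V, map_prod id \<psi>) (0, w) (t, x)"
proof
  fix h
  let ?c = "map_prod id \<psi>"
  show "lift_vector I F t x (coordinate_field F (V, \<psi>) w x) h =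
    coordinate_field M (I \<times> V, map_prod id \<psi>) (0, w) (t, x) h"
  proof (cases "smooth_near M (t, x) h")
    case True
    let ?h' = "frechet_derivative (h \<circ> inv_into (I \<times> V) ?c) (at (t, \<psi> x))"
    have d1: "((h \<circ> inv_into (I \<times> V) ?c) has_derivative ?h') (at (t, \<psi> x))"
      using M.smooth_near_has_derivative[OF product_chart[OF V(1)] _ True] V(2) t by simp
    have "(Pair t has_derivative (\<lambda>y. (0, y))) (at (\<psi> x))"
      by (intro derivative_intros)
    note d2 = has_derivative_compose[OF this d1]
    have "((\<lambda>y. h (t, y)) \<circ> inv_into V \<psi> has_derivative (\<lambda>y. ?h' (0, y))) (at (\<psi> x))"
      by (rule has_derivative_transform_within_open[OF d2 F.open_chart_image[OF V(1)]])
        (use V t in \<open>auto simp: product_chart_inv[OF V(1)]\<close>)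
    then show ?thesis
      using True smooth_near_slice[OF True]
      by (simp add: lift_vector_apply coordinate_field_def frechet_derivative_at[symmetric])
  qed (simp add: lift_vector_apply coordinate_field_def)
qed

lemma coordinate_field_fst:
  assumes V: "(V, \<psi>) \<in> F" "x \<in> V" and t: "t \<in> I"
  shows "coordinate_field M (I \<times> V, map_prod id \<psi>) (a, w) (t, x) fst = a"
proof -
  have "coordinate_field M (I \<times> V, map_prod id \<psi>) (a, w) (t, x) (\<lambda>q. map_prod id \<psi> q \<bullet> (1, 0)) = (a, w) \<bullet> (1, 0)"
    using M.coordinate_field_coord[OF product_chart[OF V(1)]] V(2) t by blast
  then show ?thesis
    by (simp add: map_prod_def split_def inner_prod_def)
qed

lemma pushforward_coordinate_field:
  assumes V: "(V, \<psi>) \<in> F" "x \<in> V" and t: "t \<in> I"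
  shows "pushforward F snd (t, x) (coordinate_field M (I \<times> V, map_prod id \<psi>) (a, w) (t, x)) =
    coordinate_field F (V, \<psi>) w x"
proof
  fix u
  let ?c = "map_prod id \<psi>"
  show "pushforward F snd (t, x) (coordinate_field M (I \<times> V, ?c) (a, w) (t, x)) u =
    coordinate_field F (V, \<psi>) w x u"
  proof (cases "smooth_near F x u")
    case True
    let ?u' = "frechet_derivative (u \<circ> inv_into V \<psi>) (at (\<psi> x))"
    have d1: "((u \<circ> inv_into V \<psi>) has_derivative ?u') (at (snd (t, \<psi> x)))"
      using F.smooth_near_has_derivative[OF V True] by simp
    have "(snd has_derivative snd) (at (t, \<psi> x))"
      by (intro derivative_intros)
    note d2 = has_derivative_compose[OF this d1]
    have "((u \<circ> snd) \<circ> inv_into (I \<times> V) ?c has_derivative (\<lambda>z. ?u' (snd z))) (at (t, \<psi> x))"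
      by (rule has_derivative_transform_within_open[OF d2, of "I \<times> \<psi> ` V"])
        (use F.open_chart_image[OF V(1)] open_interval V t in
          \<open>auto simp: product_chart_inv[OF V(1)] intro: open_Times\<close>)
    moreover have "smooth_near M (t, x) (u \<circ> snd)"
      using smooth_near_snd[OF True t] by (simp add: o_def)
    ultimately show ?thesis
      using True by (simp add: pushforward_def coordinate_field_def frechet_derivative_at[symmetric])
  qed (simp add: pushforward_def coordinate_field_def)
qed

lemma pushforward_lincomb:
  "pushforward F snd p (\<lambda>h. a * v h + b * w h) = (\<lambda>h. a * pushforward F snd p v h + b * pushforward F snd p w h)"
  by (auto simp: pushforward_def)

lemma product_tangentE:
  assumes "v \<in> tangent_space M (t, x)" "t \<in> I" "x \<in> points F"
  obtains V \<psi> a w where "(V, \<psi>) \<in> F" "x \<in> V" "v = coordinate_field M (I \<times> V, map_prod id \<psi>) (a, w) (t, x)"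
proof -
  obtain V \<psi> where V: "(V, \<psi>) \<in> F" "x \<in> V"
    using F.chart_at[OF assms(3)] .
  then show thesis
    using M.tangent_space_eq[OF product_chart[OF V(1)], of "(t, x)"] assms that by auto
qed

lemma pushforward_in_tangent_space:
  assumes "v \<in> tangent_space M (t, x)" "t \<in> I" "x \<in> points F"
  shows "pushforward F snd (t, x) v \<in> tangent_space F x"
  using product_tangentE[OF assms] pushforward_coordinate_field[OF _ _ assms(2)]
    F.coordinate_field_in_tangent_space by metis

text \<open>The tangent space splits into the line of \<open>dt\<close> and the lifted fibre
  vectors. In a product chart these are the coordinate vectors with components \<open>(1, 0)\<close>
  and \<open>(0, w)\<close>, where every claim is linear algebra.\<close>

lemma
  assumes t: "t \<in> I" and x: "x \<in> points F"
  shows del_t_in_tangent_space: "dt (t, x) \<in> tangent_space M (t, x)"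
    and del_t_fst: "dt (t, x) fst = 1"
    and pushforward_del_t: "pushforward F snd (t, x) (dt (t, x)) = (\<lambda>h. 0)"
    and lift_vector_in_tangent_space:
      "w \<in> tangent_space F x \<Longrightarrow> lift_vector I F t x w \<in> tangent_space M (t, x)"
    and lift_vector_fst: "w \<in> tangent_space F x \<Longrightarrow> lift_vector I F t x w fst = 0"
    and pushforward_lift_vector:
      "w \<in> tangent_space F x \<Longrightarrow> pushforward F snd (t, x) (lift_vector I F t x w) = w"
    and product_tangent_decompose: "v \<in> tangent_space M (t, x) \<Longrightarrow>
      v h = v fst * dt (t, x) h + lift_vector I F t x (pushforward F snd (t, x) v) h"
proof -
  obtain V \<psi> where V: "(V, \<psi>) \<in> F" "x \<in> V"
    using F.chart_at[OF x] .
  note MV = product_chart[OF V(1)]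
  have tx: "(t, x) \<in> I \<times> V" using t V by simp
  let ?c = "\<lambda>w. coordinate_field M (I \<times> V, map_prod id \<psi>) w (t, x)"
  note cM = M.coordinate_field_in_tangent_space[OF MV tx] and lin = M.coordinate_field_linear[OF MV tx]
  note dt = del_t_eq_coordinate_field[OF V t] and l = lift_vector_coordinate_field[OF V t]
    and pf = pushforward_coordinate_field[OF V t] and cf = coordinate_field_fst[OF V t]
  have 0: "coordinate_field F (V, \<psi>) 0 x = (\<lambda>h. 0)"
    using linear_0[OF F.coordinate_field_linear[OF V]] by (intro ext)
  show "dt (t, x) \<in> tangent_space M (t, x)" "dt (t, x) fst = 1"
    "pushforward F snd (t, x) (dt (t, x)) = (\<lambda>h. 0)"
    unfolding dt cf pf 0 using cM by auto
  show "lift_vector I F t x w \<in> tangent_space M (t, x)" "lift_vector I F t x w fst = 0"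
    "pushforward F snd (t, x) (lift_vector I F t x w) = w"
    if "w \<in> tangent_space F x" for w
    using that cM l pf cf unfolding F.tangent_space_eq[OF V] by auto
  show "v h = v fst * dt (t, x) h + lift_vector I F t x (pushforward F snd (t, x) v) h"
    if v: "v \<in> tangent_space M (t, x)"
  proof -
    obtain z where "v = ?c z"
      using v M.tangent_space_eq[OF MV tx] by auto
    then obtain a w where w: "v = ?c (a, w)"
      by (cases z) auto
    have "(a, w) = a *\<^sub>R (1, 0) + (0, w)" by simp
    then have "v h = a * ?c (1, 0) h + ?c (0, w) h"
      unfolding w using linear_add[OF lin] linear_cmul[OF lin] by (metis real_scaleR_def)
    then show ?thesis
      by (simp add: w dt l pf cf)
  qed
qed

text \<open>Tangent vectors need be compared only on \<open>fst\<close> and on functions pulled back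
  from the fibre. Brackets are computed with this test and never evaluated on general
  functions.\<close>

lemma product_tangent_eqI:
  assumes "t \<in> I" "x \<in> points F" and "v \<in> tangent_space M (t, x)" "w \<in> tangent_space M (t, x)"
    and "v fst = w fst" "pushforward F snd (t, x) v = pushforward F snd (t, x) w"
  shows "v = w"
proof
  fix h
  show "v h = w h"
    unfolding product_tangent_decompose[OF assms(1-3), of h] product_tangent_decompose[OF assms(1,2,4), of h] assms(5,6) ..
qed

lemma vector_field_del_t: "vector_field M (points M) dt"
proof (rule M.vector_field_local)
  show "open_part M (points M)"
    by (rule M.open_part_all)
  fix p assume "p \<in> points M"
  then obtain t x where p: "p = (t, x)" "t \<in> I" "x \<in> points F"
    by (auto simp: points_product)
  obtain V \<psi> where V: "(V, \<psi>) \<in> F" "x \<in> V"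
    using F.chart_at[OF p(3)] .
  have "vector_field M (I \<times> V) dt"
    by (rule M.vector_field_cong[OF _ M.vector_field_coordinate_field[OF product_chart[OF V(1)]]])
      (use del_t_eq_coordinate_field[OF V(1)] in auto)
  then show "\<exists>N. open N \<and> p \<in> N \<and> vector_field M (points M \<inter> N) dt"
    using p V open_interval F.open_chart[OF V(1)] by (intro exI[of _ "I \<times> V"]) (auto intro: open_Times vector_field_subset)
qed

text \<open>Over a fibre chart the lift is a combination of coordinate fields of the product chart
  with coefficients pulled back from the fibre, and both ingredients are smooth.\<close>

lemma vector_field_lift:
  assumes U: "open_part F U" and X: "vector_field F U X"
  shows "vector_field M (I \<times> U) (lift X)"
proof (rule M.vector_field_local)
  show "open_part M (I \<times> U)"
    by (rule open_part_product[OF U])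
  fix p assume "p \<in> I \<times> U"
  then obtain t x where p: "p = (t, x)" "t \<in> I" "x \<in> U" by auto
  obtain V \<psi> where V: "(V, \<psi>) \<in> F" "x \<in> V"
    using F.chart_at[OF F.open_part_points[OF U p(3)]] .
  let ?W = "I \<times> (U \<inter> V)"
  let ?c = "coordinate_field M (I \<times> V, map_prod id \<psi>)"
  have oUV: "open_part F (U \<inter> V)"
    by (rule open_part_Int[OF U F.open_part_chart[OF V(1)]])
  then have oW: "open_part M ?W" by (rule open_part_product)
  define Y where "Y = (\<lambda>q h. \<Sum>b\<in>Basis. X (snd q) (\<lambda>y. \<psi> y \<bullet> b) * ?c (0, b) q h)"
  have "vector_field M ?W Y"
    unfolding Y_def
  proof (rule M.vector_field_sum[OF oW])
    fix b :: 'e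
    show "smooth_function M ?W (\<lambda>q. X (snd q) (\<lambda>y. \<psi> y \<bullet> b))"
    proof (rule smooth_function_snd)
      show "open (U \<inter> V)" using oUV by (simp add: open_part_def)
      then show "smooth_function F (U \<inter> V) (\<lambda>q. X q (\<lambda>y. \<psi> y \<bullet> b))"
        by (intro vector_field_smooth_function[OF X] smooth_function_subset[OF F.smooth_function_coord[OF V(1)]]) auto
    qed
    show "vector_field M ?W (?c (0, b))"
      by (rule vector_field_subset[OF M.vector_field_coordinate_field[OF product_chart[OF V(1)]]]) auto
  qed
  then have "vector_field M ?W (lift X)"
  proof (rule M.vector_field_cong[rotated])
    fix q assume "q \<in> ?W"
    then obtain s y where q: "q = (s, y)" "s \<in> I" "y \<in> U" "y \<in> V" by auto
    note lin = M.coordinate_field_linear[OF product_chart[OF V(1)], of "(s, y)"]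
    show "Y q = lift X q"
    proof
      fix h
      have X: "X y k = (\<Sum>b\<in>Basis. X y (\<lambda>y. \<psi> y \<bullet> b) * coordinate_field F (V, \<psi>) b y k)" for k
        by (rule F.tangent_expand[OF V(1) q(4) vector_fieldD[OF X q(3)]])
      have "lift X q h = (\<Sum>b\<in>Basis. X y (\<lambda>y. \<psi> y \<bullet> b) * lift_vector I F s y (coordinate_field F (V, \<psi>) b y) h)"
        using X[of "\<lambda>y. h (s, y)"] by (simp add: q(1) lift_field_def lift_vector_apply)
      then show "Y q h = lift X q h"
        by (simp add: Y_def q(1) lift_vector_coordinate_field[OF V(1) q(4,2)])
    qed
  qed
  moreover have "(I \<times> U) \<inter> (I \<times> V) = ?W" by auto
  ultimately show "\<exists>N. open N \<and> p \<in> N \<and> vector_field M ((I \<times> U) \<inter> N) (lift X)"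
    using p V open_interval F.open_chart[OF V(1)] by (intro exI[of _ "I \<times> V"]) (auto intro: open_Times)
qed

end

section \<open>The warped metric\<close>

lemma (in manifold_atlas) torsion_free_vector_field_lie_bracket:
  assumes D: "affine_connection A D" "torsion_free A D"
    and U: "open_part A U" and X: "vector_field A U X" "vector_field A U Y"
  shows "vector_field A U (lie_bracket A X Y)"
proof -
  have DV: "vector_field A U (D X Y)" if "vector_field A U X" "vector_field A U Y" for X Y
    using D(1)[unfolded affine_connection_def, THEN spec, THEN spec, THEN spec, THEN mp,
        OF conjI[OF U conjI[OF that]], THEN conjunct2, THEN conjunct1] .
  have "open U" using U by (simp add: open_part_def)
  note neg = vector_field_mult[OF U smooth_function_const[OF this, of "-1"]]
  have "vector_field A U (\<lambda>q h. D X Y q h + (-1) * D Y X q h)"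
    by (intro vector_field_add[OF U] neg DV X)
  then show ?thesis
  proof (rule vector_field_cong[rotated])
    fix q assume "q \<in> U"
    then show "(\<lambda>h. D X Y q h + (-1) * D Y X q h) = lie_bracket A X Y q"
      using D(2) U X unfolding torsion_free_def by simp
  qed
qed

lemma (in pseudo_riemannian) metric_diff_left:
  assumes p: "p \<in> points A" and "v \<in> tangent_space A p" "w \<in> tangent_space A p" "u \<in> tangent_space A p"
  shows "g p (\<lambda>h. v h - w h) u = g p v u - g p w u"
  using metric_lincomb[OF assms, of 1 "-1"] by simp

text \<open>Add metric compatibility along \<open>X\<close> and along \<open>Y\<close>, subtract it
  along \<open>Z\<close>, and exchange arguments by torsion-freeness until only \<open>D X Y\<close>
  is left. The right side is free of \<open>D\<close>, so with nondegeneracy it determines the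
  connection.\<close>

lemma (in pseudo_riemannian) koszul:
  assumes D: "levi_civita_connection A g D" and U: "open_part A U" "p \<in> U"
    and X: "vector_field A U X" and Y: "vector_field A U Y" and Z: "vector_field A U Z"
  shows "2 * g p (D X Y p) (Z p) = X p (\<lambda>q. g q (Y q) (Z q)) + Y p (\<lambda>q. g q (X q) (Z q)) - Z p (\<lambda>q. g q (X q) (Y q))
    + g p (lie_bracket A X Y p) (Z p) - g p (lie_bracket A X Z p) (Y p) - g p (lie_bracket A Y Z p) (X p)"
proof -
  have aff: "affine_connection A D" and tf: "torsion_free A D" and mc: "metric_compatible A g D"
    using D by (auto simp: levi_civita_connection_def)
  interpret manifold_connection A D
    by unfold_locales (use aff torsion_free_vector_field_lie_bracket[OF aff tf] in auto)
  have p: "p \<in> points A" by (rule open_part_points[OF U])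
  have T: "D X Y p \<in> tangent_space A p" if "vector_field A U X" "vector_field A U Y" for X Y
    by (rule vector_fieldD[OF connection_vector_field[OF U(1) that] U(2)])
  note V = vector_fieldD[OF _ U(2)]
  have compat: "X p (\<lambda>q. g q (Y q) (Z q)) = g p (D X Y p) (Z p) + g p (D X Z p) (Y p)"
    if X: "vector_field A U X" and Y: "vector_field A U Y" and Z: "vector_field A U Z" for X Y Z
    using mc[unfolded metric_compatible_def, THEN spec, THEN spec, THEN spec, THEN spec, THEN mp,
        OF conjI[OF U(1) conjI[OF X conjI[OF Y Z]]]] U(2) metric_sym[OF p V[OF Y] T[OF X Z]] by simp
  have tors: "g p (lie_bracket A X Y p) (Z p) = g p (D X Y p) (Z p) - g p (D Y X p) (Z p)"
    if X: "vector_field A U X" and Y: "vector_field A U Y" and Z: "vector_field A U Z" for X Y Z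
  proof -
    have "lie_bracket A X Y p = (\<lambda>h. D X Y p h - D Y X p h)"
      using tf[unfolded torsion_free_def, THEN spec, THEN spec, THEN spec, THEN mp,
        OF conjI[OF U(1) conjI[OF X Y]]] U(2) by simp
    then show ?thesis
      using metric_diff_left[OF p T[OF X Y] T[OF Y X] V[OF Z]] by simp
  qed
  show ?thesis
    using compat[OF X Y Z] compat[OF Y X Z] compat[OF Z X Y] tors[OF X Y Z] tors[OF X Z Y] tors[OF Y Z X]
    by simp
qed

text \<open>The two added terms are linear over functions in both arguments, so the Leibniz rule is
  still carried by \<open>D\<close> alone.\<close>

lemma (in metric_connection) affine_quarter_symmetric_connection:
  assumes P: "\<And>U. open_part A U \<Longrightarrow> vector_field A U P"
  shows "affine_connection A (quarter_symmetric_connection g D P l1 l2)"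
  unfolding affine_connection_def
proof (intro allI impI; elim conjE)
  fix U X Y assume U: "open_part A U" and X: "vector_field A U X" and Y: "vector_field A U Y"
  let ?Q = "quarter_symmetric_connection g D P l1 l2"
  have oU: "open U" using U by (simp add: open_part_def)
  note V = vector_fieldD and pt = open_part_points[OF U] and sm = metric_smooth[OF U]
  note PU = P[OF U]
  have 1: "vector_field A U (?Q X Y)"
  proof -
    have "vector_field A U (\<lambda>q h. D X Y q h + (l1 * g q (Y q) (P q)) * X q h + (-l2 * g q (X q) (Y q)) * P q h)"
      by (intro vector_field_add[OF U] vector_field_mult[OF U] connection_vector_field[OF U X Y] X PU
          smooth_function_cmult[OF oU] sm Y)
    then show ?thesis
      by (simp add: quarter_symmetric_connection_def)
  qed
  show "(\<forall>X' Y'. (\<forall>p\<in>U. X' p = X p \<and> Y' p = Y p) \<longrightarrow> (\<forall>p\<in>U. ?Q X' Y' p = ?Q X Y p)) \<and>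
      vector_field A U (?Q X Y) \<and>
      (\<forall>Z. vector_field A U Z \<longrightarrow> (\<forall>p\<in>U.
         ?Q (\<lambda>q h. X q h + Z q h) Y p = (\<lambda>h. ?Q X Y p h + ?Q Z Y p h) \<and>
         ?Q X (\<lambda>q h. Y q h + Z q h) p = (\<lambda>h. ?Q X Y p h + ?Q X Z p h))) \<and>
      (\<forall>u. smooth_function A U u \<longrightarrow> (\<forall>p\<in>U.
         ?Q (\<lambda>q h. u q * X q h) Y p = (\<lambda>h. u p * ?Q X Y p h) \<and>
         ?Q X (\<lambda>q h. u q * Y q h) p = (\<lambda>h. X p u * Y p h + u p * ?Q X Y p h)))"
  proof (intro conjI 1 allI impI ballI)
    fix X' Y' p assume "\<forall>p\<in>U. X' p = X p \<and> Y' p = Y p" "p \<in> U"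
    then show "?Q X' Y' p = ?Q X Y p"
      using connection_cong[OF U X Y, of X' Y' p] by (simp add: quarter_symmetric_connection_def)
  next
    fix Z p assume Z: "vector_field A U Z" and p: "p \<in> U"
    note t = V[OF X p] V[OF Y p] V[OF Z p] V[OF PU p]
    show "?Q (\<lambda>q h. X q h + Z q h) Y p = (\<lambda>h. ?Q X Y p h + ?Q Z Y p h)"
      using connection_add_left[OF U X Y Z p] metric_add_left[OF pt[OF p] t(1,3,2)]
      by (intro ext) (simp add: quarter_symmetric_connection_def algebra_simps)
    show "?Q X (\<lambda>q h. Y q h + Z q h) p = (\<lambda>h. ?Q X Y p h + ?Q X Z p h)"
      using connection_add_right[OF U X Y Z p] metric_add_left[OF pt[OF p] t(2,3,4)]
        metric_add_right[OF pt[OF p] t(2,3,1)]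
      by (intro ext) (simp add: quarter_symmetric_connection_def algebra_simps)
  next
    fix u p assume u: "smooth_function A U u" and p: "p \<in> U"
    note t = V[OF X p] V[OF Y p] V[OF PU p]
    show "?Q (\<lambda>q h. u q * X q h) Y p = (\<lambda>h. u p * ?Q X Y p h)"
      using connection_mult_left[OF U X Y u p] metric_cmult_left[OF pt[OF p] t(1,1,2)]
      by (intro ext) (simp add: quarter_symmetric_connection_def algebra_simps)
    show "?Q X (\<lambda>q h. u q * Y q h) p = (\<lambda>h. X p u * Y p h + u p * ?Q X Y p h)"
      using connection_mult_right[OF U X Y u p] metric_cmult_left[OF pt[OF p] t(2,2,3)]
        metric_cmult_right[OF pt[OF p] t(2,2,1)]
      by (intro ext) (simp add: quarter_symmetric_connection_def algebra_simps)
  qed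
qed

lemma
  fixes k :: "real \<Rightarrow> real"
  assumes "open S" "smooth_on S k"
  shows smooth_on_has_real_derivative: "t \<in> S \<Longrightarrow> (k has_real_derivative deriv k t) (at t)"
    and smooth_on_deriv: "smooth_on S (deriv k)"
proof -
  have *: "(k has_real_derivative deriv k t) (at t)" if "t \<in> S" for t
    using smooth_on_imp_differentiable[OF assms(2) that] DERIV_deriv_iff_real_differentiable by blast
  then show "t \<in> S \<Longrightarrow> (k has_real_derivative deriv k t) (at t)" .
  have "frechet_derivative k (at t) 1 = deriv k t" if "t \<in> S" for t
    using frechet_derivative_at[OF *[OF that, unfolded has_field_derivative_def]] by (metis mult.right_neutral)
  then show "smooth_on S (deriv k)"
    using smooth_on_cong[OF assms(1) _ smooth_on_frechet_derivative[OF assms(2), of 1]] by blast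
qed

locale warped_product = interval_product F I
  for F :: "('a::{t2_space,second_countable_topology}, 'e::euclidean_space) chart set" and I +
  fixes gF :: "'a metric" and nablaF :: "'a connection" and f :: "real \<Rightarrow> real"
  assumes metric_F: "pseudo_riemannian_metric F gF"
    and levi_civita_F: "levi_civita_connection F gF nablaF"
    and smooth_f: "smooth_on I f" and f_pos: "t \<in> I \<Longrightarrow> f t > 0"
begin

abbreviation "g \<equiv> warped_metric F f gF"

abbreviation "lv \<equiv> lift_vector I F"

sublocale F: metric_connection F gF nablaF
  using metric_F levi_civita_F F.torsion_free_vector_field_lie_bracket
  by unfold_locales (auto simp: levi_civita_connection_def)

lemma warped_metric_apply:
  "g (t, x) v w = - (v fst * w fst) + (f t)\<^sup>2 * gF x (pushforward F snd (t, x) v) (pushforward F snd (t, x) w)"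
  by (simp add: warped_metric_def)

text \<open>The pushed-forward vectors vary with \<open>t\<close> and form no field on the fibre, so
  smoothness of \<open>gF\<close> does not apply to them directly. Expanded in the coordinate fields
  of a fibre chart, they leave coefficients smooth on the product and values of \<open>gF\<close> on
  genuine fields of the fibre.\<close>

lemma smooth_function_fibre_metric:
  assumes U: "open_part M U" and X: "vector_field M U X" and Y: "vector_field M U Y"
  shows "smooth_function M U (\<lambda>q. gF (snd q) (pushforward F snd q (X q)) (pushforward F snd q (Y q)))"
proof (rule M.smooth_function_local[OF U])
  fix p assume p: "p \<in> U"
  have "p \<in> I \<times> points F"
    using M.open_part_points[OF U p] by (simp add: points_product)
  then obtain t x where tx: "p = (t, x)" "t \<in> I" "x \<in> points F"
    by auto
  obtain V \<psi> where V: "(V, \<psi>) \<in> F" "x \<in> V"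
    using F.chart_at[OF tx(3)] .
  let ?N = "I \<times> V"
  let ?W = "U \<inter> ?N"
  have N: "open_part M ?N"
    by (rule open_part_product[OF F.open_part_chart[OF V(1)]])
  have oW: "open ?W"
    using U N by (auto simp: open_part_def)
  let ?c = "coordinate_field F (V, \<psi>)"
  let ?k = "\<lambda>b c q. gF q (?c b q) (?c c q)"
  have coord: "smooth_function M ?N (\<lambda>q. \<psi> (snd q) \<bullet> b)" for b
    by (rule smooth_function_snd[OF F.open_chart[OF V(1)] F.smooth_function_coord[OF V(1)]])
  have coeff: "smooth_function M ?W (\<lambda>q. X q (\<lambda>q. \<psi> (snd q) \<bullet> b))" if "vector_field M U X" for X b
    by (rule vector_field_smooth_function[OF that oW _ smooth_function_subset[OF coord]]) auto
  have k: "smooth_function M ?W (\<lambda>q. ?k b c (snd q))" for b c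
    by (rule smooth_function_subset[OF smooth_function_snd[OF F.open_chart[OF V(1)]
            F.metric_smooth[OF F.open_part_chart[OF V(1)] F.vector_field_coordinate_field[OF V(1)]
              F.vector_field_coordinate_field[OF V(1)]]]]) auto
  have "smooth_function M ?W (\<lambda>q. \<Sum>b\<in>Basis. X q (\<lambda>q. \<psi> (snd q) \<bullet> b) *
      (\<Sum>c\<in>Basis. Y q (\<lambda>q. \<psi> (snd q) \<bullet> c) * ?k b c (snd q)))"
    by (intro M.smooth_function_sum M.smooth_function_mult oW coeff k X Y)
  then have "smooth_function M ?W (\<lambda>q. gF (snd q) (pushforward F snd q (X q)) (pushforward F snd q (Y q)))"
  proof (rule M.smooth_function_cong[OF oW, rotated])
    fix q assume q: "q \<in> ?W"
    then obtain s y where sy: "q = (s, y)" "s \<in> I" "y \<in> V" by auto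
    have yF: "y \<in> points F"
      using F.chart_subset_points[OF V(1)] sy by auto
    have near: "smooth_near F y (\<lambda>y. \<psi> y \<bullet> b)" for b
      by (rule smooth_nearI[OF F.open_part_chart[OF V(1)] sy(3) F.smooth_function_coord[OF V(1)]])
    have T: "pushforward F snd q (X q) \<in> tangent_space F y" if "vector_field M U X" for X
      using pushforward_in_tangent_space[OF _ sy(2) yF] vector_fieldD[OF that, of q] q sy by simp
    have e: "pushforward F snd q (X q) = (\<lambda>h. \<Sum>b\<in>Basis. X q (\<lambda>q. \<psi> (snd q) \<bullet> b) * ?c b y h)"
      if "vector_field M U X" for X
      using F.tangent_expand[OF V(1) sy(3) T[OF that]] near sy(1)
      by (intro ext) (simp add: pushforward_def o_def)
    have ct: "?c b y \<in> tangent_space F y" for b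
      by (rule F.coordinate_field_in_tangent_space[OF V(1) sy(3)])
    show "(\<Sum>b\<in>Basis. X q (\<lambda>q. \<psi> (snd q) \<bullet> b) *
      (\<Sum>c\<in>Basis. Y q (\<lambda>q. \<psi> (snd q) \<bullet> c) * ?k b c (snd q))) =
      gF (snd q) (pushforward F snd q (X q)) (pushforward F snd q (Y q))"
      unfolding e[OF X] e[OF Y]
      by (simp add: sy(1) F.metric_sum_left[OF yF F.tangent_space_sum[OF yF ct] ct]
          F.metric_sum_right[OF yF ct ct])
  qed
  then show "\<exists>N. open N \<and> p \<in> N \<and> smooth_function M (U \<inter> N)
      (\<lambda>q. gF (snd q) (pushforward F snd q (X q)) (pushforward F snd q (Y q)))"
    using N tx V by (intro exI[of _ ?N]) (auto simp: open_part_def)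
qed

lemma
  assumes t: "t \<in> I" and x: "x \<in> points F"
  shows warped_metric_dt_left: "v \<in> tangent_space M (t, x) \<Longrightarrow> g (t, x) (dt (t, x)) v = - v fst"
    and warped_metric_dt_right: "v \<in> tangent_space M (t, x) \<Longrightarrow> g (t, x) v (dt (t, x)) = - v fst"
    and warped_metric_lift_right: "v \<in> tangent_space M (t, x) \<Longrightarrow> w \<in> tangent_space F x \<Longrightarrow>
      g (t, x) v (lv t x w) = (f t)\<^sup>2 * gF x (pushforward F snd (t, x) v) w"
proof -
  note z = F.metric_zero_left[OF x] and s = F.metric_sym[OF x _ F.tangent_space_zero[OF x]]
  show "v \<in> tangent_space M (t, x) \<Longrightarrow> g (t, x) (dt (t, x)) v = - v fst"
    using z[OF pushforward_in_tangent_space[OF _ t x]]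
    by (simp add: warped_metric_apply del_t_fst[OF t x] pushforward_del_t[OF t x])
  show "v \<in> tangent_space M (t, x) \<Longrightarrow> g (t, x) v (dt (t, x)) = - v fst"
    using z[OF pushforward_in_tangent_space[OF _ t x]] s[OF pushforward_in_tangent_space[OF _ t x]]
    by (simp add: warped_metric_apply del_t_fst[OF t x] pushforward_del_t[OF t x])
  show "v \<in> tangent_space M (t, x) \<Longrightarrow> w \<in> tangent_space F x \<Longrightarrow>
      g (t, x) v (lv t x w) = (f t)\<^sup>2 * gF x (pushforward F snd (t, x) v) w"
    by (simp add: warped_metric_apply lift_vector_fst[OF t x] pushforward_lift_vector[OF t x])
qed

lemma
  assumes t: "t \<in> I" and x: "x \<in> points F"
  shows warped_metric_dt_dt: "g (t, x) (dt (t, x)) (dt (t, x)) = -1"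
    and warped_metric_dt_lift: "w \<in> tangent_space F x \<Longrightarrow> g (t, x) (dt (t, x)) (lv t x w) = 0"
    and warped_metric_lift_dt: "w \<in> tangent_space F x \<Longrightarrow> g (t, x) (lv t x w) (dt (t, x)) = 0"
    and warped_metric_lift_lift: "v \<in> tangent_space F x \<Longrightarrow> w \<in> tangent_space F x \<Longrightarrow>
      g (t, x) (lv t x v) (lv t x w) = (f t)\<^sup>2 * gF x v w"
  using del_t_in_tangent_space[OF t x] lift_vector_in_tangent_space[OF t x]
  by (simp_all add: warped_metric_dt_left[OF t x] warped_metric_dt_right[OF t x]
      warped_metric_lift_right[OF t x] del_t_fst[OF t x] lift_vector_fst[OF t x] pushforward_lift_vector[OF t x]
      pushforward_del_t[OF t x] F.metric_zero_left[OF x])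

text \<open>Nondegeneracy of the warped metric in the form of a test: pairing with \<open>dt\<close>
  gives minus the \<open>dt\<close> part, and pairing with lifts gives \<open>f^2\<close> times the
  nondegenerate fibre metric, where \<open>f > 0\<close> cancels.\<close>

lemma warped_tangent_eqI:
  assumes t: "t \<in> I" and x: "x \<in> points F"
    and v: "v \<in> tangent_space M (t, x)" and w: "w \<in> tangent_space M (t, x)"
    and "g (t, x) v (dt (t, x)) = g (t, x) w (dt (t, x))"
    and eq: "\<And>u. u \<in> tangent_space F x \<Longrightarrow> g (t, x) v (lv t x u) = g (t, x) w (lv t x u)"
  shows "v = w"
proof (rule product_tangent_eqI[OF t x v w])
  show "v fst = w fst"
    using assms(5) by (simp add: warped_metric_dt_right[OF t x] v w)
  note T = pushforward_in_tangent_space[OF _ t x]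
  let ?a = "pushforward F snd (t, x) v" and ?b = "pushforward F snd (t, x) w"
  have "gF x ?a u = gF x ?b u" if "u \<in> tangent_space F x" for u
    using eq[OF that] f_pos[OF t] by (simp add: warped_metric_lift_right[OF t x] v w that)
  then have "gF x (\<lambda>h. ?a h - ?b h) u = 0" if "u \<in> tangent_space F x" for u
    using F.metric_diff_left[OF x T[OF v] T[OF w] that] that by simp
  moreover have "(\<lambda>h. ?a h - ?b h) \<in> tangent_space F x"
    using F.tangent_space_add[OF x T[OF v] F.tangent_space_cmult[OF x T[OF w], of "-1"]] by simp
  ultimately have 0: "(\<lambda>h. ?a h - ?b h) = (\<lambda>h. 0)"
    by (intro F.metric_nondegenerate[OF x])
  show "?a = ?b"
  proof
    fix h show "?a h = ?b h" using fun_cong[OF 0, of h] by simp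
  qed
qed

lemma pseudo_riemannian_warped: "pseudo_riemannian_metric M g"
  unfolding pseudo_riemannian_metric_def
proof (intro conjI ballI allI impI)
  fix p v assume "p \<in> points M" and v: "v \<in> tangent_space M p"
  then obtain t x where p: "p = (t, x)" and t: "t \<in> I" and x: "x \<in> points F"
    by (auto simp: points_product)
  note T = pushforward_in_tangent_space[OF _ t x]
  fix w assume w: "w \<in> tangent_space M p"
  show "g p v w = g p w v"
    unfolding p warped_metric_apply using F.metric_sym[OF x T T] v w p by simp
  fix u a b assume u: "u \<in> tangent_space M p"
  show "g p (\<lambda>h. a * v h + b * w h) u = a * g p v u + b * g p w u"
    unfolding p warped_metric_apply pushforward_lincomb
    using F.metric_lincomb[OF x T T T] v w u p by (simp add: algebra_simps)
next
  fix p v assume "p \<in> points M" and v: "v \<in> tangent_space M p" and 0: "\<forall>w\<in>tangent_space M p. g p v w = 0"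
  then obtain t x where p: "p = (t, x)" and t: "t \<in> I" and x: "x \<in> points F"
    by (auto simp: points_product)
  have pM: "(t, x) \<in> points M" using t x by (simp add: points_product)
  have z: "g (t, x) (\<lambda>h. 0) w = 0" if "w \<in> tangent_space M (t, x)" for w
    using F.metric_zero_left[OF x pushforward_in_tangent_space[OF that t x]]
    by (simp add: warped_metric_apply pushforward_def)
  show "v = (\<lambda>h. 0)"
    by (rule warped_tangent_eqI[OF t x])
      (use v 0 z p M.tangent_space_zero[OF pM] del_t_in_tangent_space[OF t x] lift_vector_in_tangent_space[OF t x] in auto)
next
  fix U X Y assume *: "open_part M U \<and> vector_field M U X \<and> vector_field M U Y"
  then have U: "open_part M U" and oU: "open U" and sub: "U \<subseteq> I \<times> points F"
    by (auto simp: open_part_def points_product)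
  have "open (points F)"
    using F.open_part_all by (simp add: open_part_def)
  then have 1: "smooth_function M U (\<lambda>q. k (fst q))" if "smooth_on I k" for k
    using smooth_function_subset[OF smooth_function_fst[OF _ that] sub] by blast
  have 2: "smooth_function M U (\<lambda>q. X q fst)" if "vector_field M U X" for X
    by (rule vector_field_smooth_function[OF that oU _ 1[of "\<lambda>x. x", simplified]])
      (auto intro: smooth_on_bounded_linear[OF open_interval bounded_linear_ident])
  have "smooth_function M U (\<lambda>q. (-1) * (X q fst * Y q fst) +
      (f (fst q) * f (fst q)) * gF (snd q) (pushforward F snd q (X q)) (pushforward F snd q (Y q)))"
    by (intro M.smooth_function_add M.smooth_function_cmult M.smooth_function_mult oU 1 2
        smooth_f smooth_function_fibre_metric U) (use * in auto)
  then show "smooth_function M U (\<lambda>p. g p (X p) (Y p))"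
    by (simp add: warped_metric_def power2_eq_square)
qed

sublocale M: pseudo_riemannian M g
  by unfold_locales (rule pseudo_riemannian_warped)

end

section \<open>The Levi-Civita connection of a warped product\<close>

context warped_product
begin

lemma product_point: "open_part F U \<Longrightarrow> (t, x) \<in> I \<times> U \<Longrightarrow> t \<in> I \<and> x \<in> U \<and> x \<in> points F"
  by (auto simp: open_part_def)

lemma lift_apply: "lift X (t, x) = lv t x (X x)"
  by (simp add: lift_field_def)

lemma smooth_function_separated:
  assumes U: "open_part F U" and k: "smooth_on I k" and u: "smooth_function F U u"
  shows "smooth_function M (I \<times> U) (\<lambda>q. k (fst q) * u (snd q))"
  using U open_interval
  by (intro M.smooth_function_mult smooth_function_fst smooth_function_snd k u)
    (auto simp: open_part_def intro: open_Times)

text \<open>On a separated function \<open>dt\<close> differentiates only the factor in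
  \<open>t\<close>, and a lift only the factor on the fibre. As tangent vectors are local,
  \<open>H\<close> has to be separated on \<open>I \<times> U\<close> only.\<close>

lemma
  assumes U: "open_part F U" and p: "(t, x) \<in> I \<times> U" and k: "smooth_on I k" and u: "smooth_function F U u"
    and H: "\<And>q. q \<in> I \<times> U \<Longrightarrow> H q = k (fst q) * u (snd q)"
  shows del_t_separated: "dt (t, x) H = deriv k t * u x"
    and lift_separated: "w \<in> tangent_space F x \<Longrightarrow> lv t x w H = k t * w u"
proof -
  have t: "t \<in> I" and x: "x \<in> U" and xF: "x \<in> points F"
    using product_point[OF U p] by auto
  note MU = open_part_product[OF U]
  have oMU: "open (I \<times> U)" and oU: "open U"
    using MU U by (auto simp: open_part_def)
  have "smooth_near M (t, x) (\<lambda>q. k (fst q) * u (snd q))"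
    by (rule smooth_nearI[OF MU p smooth_function_separated[OF U k u]])
  then have near: "smooth_near M (t, x) H"
    by (rule M.smooth_near_cong[OF oMU p, rotated]) (simp add: H)
  have "((\<lambda>s. k s * u x) has_real_derivative deriv k t * u x) (at t)"
    using smooth_on_has_real_derivative[OF open_interval k t] by (auto intro!: derivative_eq_intros)
  then have "((\<lambda>s. H (s, x)) has_real_derivative deriv k t * u x) (at t)"
    by (rule has_field_derivative_transform_within_open[OF _ open_interval t]) (use x H in auto)
  then show "dt (t, x) H = deriv k t * u x"
    using near by (simp add: del_t_apply DERIV_imp_deriv)
  show "lv t x w H = k t * w u" if w: "w \<in> tangent_space F x"
  proof -
    have "w (\<lambda>y. H (t, y)) = w (\<lambda>y. k t * u y)"
      by (rule F.tangent_local[OF w oU x xF]) (use t H in auto)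
    also have "\<dots> = w (\<lambda>y. k t) * u x + k t * w u"
      by (rule F.tangent_mult[OF w F.smooth_near_const[OF xF] smooth_nearI[OF U x u]])
    finally show ?thesis
      using near by (simp add: lift_vector_apply F.tangent_const[OF w xF])
  qed
qed

text \<open>Serves for the metric coefficients \<open>-1\<close> and \<open>0\<close> of pairs
  involving \<open>dt\<close>, which are constant only where the fields are defined.\<close>

lemma tangent_locally_const:
  assumes U: "open_part F U" and p: "(t, x) \<in> I \<times> U" and v: "v \<in> tangent_space M (t, x)"
    and H: "\<And>q. q \<in> I \<times> U \<Longrightarrow> H q = c"
  shows "v H = 0"
proof -
  note MU = open_part_product[OF U]
  have "open (I \<times> U)" using MU by (simp add: open_part_def)
  then have "v H = v (\<lambda>q. c)"
    by (rule M.tangent_local[OF v _ p M.open_part_points[OF MU p]]) (rule H)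
  then show ?thesis
    using M.tangent_const[OF v M.open_part_points[OF MU p]] by simp
qed

lemma smooth_on_interval_const: "smooth_on I (\<lambda>t. c::real)"
  by (rule smooth_on_const[OF open_interval])

lemma del_t_snd:
  assumes "s \<in> I" "y \<in> points F" shows "dt (s, y) (\<lambda>q. u (snd q)) = 0"
  by (simp add: del_t_apply)

lemma lift_field_snd:
  assumes "s \<in> I" "smooth_near F y u" shows "lift X (s, y) (\<lambda>q. u (snd q)) = X y u"
  using smooth_near_snd[OF assms(2,1)] by (simp add: lift_apply lift_vector_apply)

lemma smooth_near_open_part:
  assumes "smooth_near F x u" "open_part F U" "x \<in> U"
  obtains W where "open_part F W" "x \<in> W" "W \<subseteq> U" "smooth_function F W u"
    "\<And>y. y \<in> W \<Longrightarrow> smooth_near F y u"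
proof -
  obtain V where V: "open_part F V" "x \<in> V" "smooth_function F V u"
    using assms(1) by (auto simp: smooth_near_def)
  have 1: "smooth_function F (V \<inter> U) u" "open_part F (V \<inter> U)"
    using smooth_function_subset[OF V(3), of "V \<inter> U"] open_part_Int[OF V(1) assms(2)] by auto
  then show thesis
    using V(2) assms(3) by (intro that[of "V \<inter> U"] smooth_nearI) auto
qed

end

locale warped_levi_civita = warped_product F I gF nablaF f
  for F :: "('a::{t2_space,second_countable_topology}, 'e::euclidean_space) chart set"
    and I gF nablaF f +
  fixes nablaM :: "(real \<times> 'a) connection"
  assumes levi_civita_M: "levi_civita_connection M g nablaM"
begin

sublocale M: metric_connection M g nablaM
  using levi_civita_M M.torsion_free_vector_field_lie_bracket
  by unfold_locales (auto simp: levi_civita_connection_def)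

text \<open>The bracket is already known to be a tangent vector, so it is enough to apply it to
  \<open>fst\<close> and to functions \<open>u (snd q)\<close>. There the inner derivatives are
  constant or independent of \<open>t\<close>, and mixed partial derivatives never have to be
  exchanged.\<close>

lemma lie_bracket_dt_lift:
  assumes U: "open_part F U" and p: "(t, x) \<in> I \<times> U" and X: "vector_field F U X"
  shows "lie_bracket M dt (lift X) (t, x) = (\<lambda>h. 0)"
proof -
  have t: "t \<in> I" and x: "x \<in> U" and xF: "x \<in> points F"
    using product_point[OF U p] by auto
  note MU = open_part_product[OF U]
  have D: "vector_field M (I \<times> U) dt"
    using vector_field_subset[OF vector_field_del_t] MU by (auto simp: open_part_def)
  note L = vector_field_lift[OF U X]
  have TX: "X y \<in> tangent_space F y" if "y \<in> U" for y
    by (rule vector_fieldD[OF X that])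
  have pM: "(t, x) \<in> points M" by (rule M.open_part_points[OF MU p])
  have dtT: "dt (t, x) \<in> tangent_space M (t, x)"
    by (rule del_t_in_tangent_space[OF t xF])
  have lT: "lift X (t, x) \<in> tangent_space M (t, x)"
    by (rule vector_fieldD[OF L p])
  show ?thesis
  proof (rule product_tangent_eqI[OF t xF vector_fieldD[OF M.vector_field_lie_bracket[OF MU D L] p] M.tangent_space_zero[OF pM]])
    have "dt (t, x) (\<lambda>q. lift X q fst) = 0"
      by (rule tangent_locally_const[OF U p dtT, of _ 0])
        (use TX U in \<open>auto simp: lift_apply open_part_def intro!: lift_vector_fst\<close>)
    moreover have "lift X (t, x) (\<lambda>q. dt q fst) = 0"
      by (rule tangent_locally_const[OF U p lT])
        (use U in \<open>auto simp: open_part_def intro!: del_t_fst\<close>)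
    ultimately show "lie_bracket M dt (lift X) (t, x) fst = 0"
      by (simp add: lie_bracket_def)
    show "pushforward F snd (t, x) (lie_bracket M dt (lift X) (t, x)) = pushforward F snd (t, x) (\<lambda>h. 0)"
    proof
      fix u
      show "pushforward F snd (t, x) (lie_bracket M dt (lift X) (t, x)) u = pushforward F snd (t, x) (\<lambda>h. 0) u"
      proof (cases "smooth_near F x u")
        case True
        obtain W where W: "open_part F W" "x \<in> W" "W \<subseteq> U" "smooth_function F W u"
          "\<And>y. y \<in> W \<Longrightarrow> smooth_near F y u"
          using smooth_near_open_part[OF True U x] by metis
        have pW: "(t, x) \<in> I \<times> W" using t W by simp
        have XW: "smooth_function F W (\<lambda>y. X y u)"
          using W by (intro vector_field_smooth_function[OF X]) (auto simp: open_part_def)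
        \<comment> \<open>A function of the fibre alone is separated with the constant factor 1 in
          \<open>t\<close>, whose derivative is 0.\<close>
        have "dt (t, x) (\<lambda>q. lift X q (\<lambda>q. u (snd q))) = deriv (\<lambda>s. 1) t * X x u"
          by (rule del_t_separated[OF W(1) pW smooth_on_interval_const XW]) (use W(5) lift_field_snd in auto)
        moreover have "lift X (t, x) (\<lambda>q. dt q (\<lambda>q. u (snd q))) = 0"
          by (rule tangent_locally_const[OF W(1) pW lT])
            (use W in \<open>auto simp: open_part_def intro!: del_t_snd\<close>)
        ultimately show ?thesis
          by (simp add: pushforward_def lie_bracket_def o_def)
      qed (simp add: pushforward_def)
    qed
  qed
qed

lemma lie_bracket_lift_lift:
  assumes U: "open_part F U" and p: "(t, x) \<in> I \<times> U" and X: "vector_field F U X" and Y: "vector_field F U Y"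
  shows "lie_bracket M (lift X) (lift Y) (t, x) = lift (lie_bracket F X Y) (t, x)"
proof -
  have t: "t \<in> I" and x: "x \<in> U" and xF: "x \<in> points F"
    using product_point[OF U p] by auto
  note MU = open_part_product[OF U]
  note L = vector_field_lift[OF U]
  note B = F.vector_field_lie_bracket[OF U X Y]
  have TX: "X y \<in> tangent_space F y" if "y \<in> U" "vector_field F U X" for y X
    by (rule vector_fieldD[OF that(2,1)])
  have lT: "lift X (t, x) \<in> tangent_space M (t, x)" if "vector_field F U X" for X
    by (rule vector_fieldD[OF L[OF that] p])
  show ?thesis
  proof (rule product_tangent_eqI[OF t xF vector_fieldD[OF M.vector_field_lie_bracket[OF MU L[OF X] L[OF Y]] p]
        vector_fieldD[OF L[OF B] p]])
    have 0: "lift X (t, x) (\<lambda>q. lift Y q fst) = 0" if "vector_field F U X" "vector_field F U Y" for X Y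
      by (rule tangent_locally_const[OF U p lT[OF that(1)], of _ 0])
        (use TX U that in \<open>auto simp: lift_apply open_part_def intro!: lift_vector_fst\<close>)
    show "lie_bracket M (lift X) (lift Y) (t, x) fst = lift (lie_bracket F X Y) (t, x) fst"
      using 0[OF X Y] 0[OF Y X] lift_vector_fst[OF t xF vector_fieldD[OF B x]]
      by (simp add: lie_bracket_def lift_apply)
    show "pushforward F snd (t, x) (lie_bracket M (lift X) (lift Y) (t, x)) =
      pushforward F snd (t, x) (lift (lie_bracket F X Y) (t, x))"
    proof
      fix u
      show "pushforward F snd (t, x) (lie_bracket M (lift X) (lift Y) (t, x)) u =
        pushforward F snd (t, x) (lift (lie_bracket F X Y) (t, x)) u"
      proof (cases "smooth_near F x u")
        case True
        obtain W where W: "open_part F W" "x \<in> W" "W \<subseteq> U" "smooth_function F W u"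
          "\<And>y. y \<in> W \<Longrightarrow> smooth_near F y u"
          using smooth_near_open_part[OF True U x] by metis
        have pW: "(t, x) \<in> I \<times> W" using t W by simp
        have 1: "lift X (t, x) (\<lambda>q. lift Y q (\<lambda>q. u (snd q))) = X x (\<lambda>y. Y y u)"
          if X: "vector_field F U X" and Y: "vector_field F U Y" for X Y
        proof -
          have YW: "smooth_function F W (\<lambda>y. Y y u)"
            using W by (intro vector_field_smooth_function[OF Y]) (auto simp: open_part_def)
          have "lv t x (X x) (\<lambda>q. lift Y q (\<lambda>q. u (snd q))) = 1 * X x (\<lambda>y. Y y u)"
            by (rule lift_separated[OF W(1) pW smooth_on_interval_const YW _ TX[OF x X]])
              (use W(5) lift_field_snd in auto)
          then show ?thesis by (simp add: lift_apply)
        qed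
        have 2: "lift (lie_bracket F X Y) (t, x) (\<lambda>q. u (snd q)) = lie_bracket F X Y x u"
          by (rule lift_field_snd[OF t True])
        have "smooth_near M (t, x) (\<lambda>q. u (snd q))"
          by (rule smooth_near_snd[OF True t])
        then show ?thesis
          using 1[OF X Y] 1[OF Y X] True 2
          by (simp add: pushforward_def o_def) (simp add: lie_bracket_def)
      qed (simp add: pushforward_def)
    qed
  qed
qed

text \<open>These are the directional derivatives that enter the Koszul formula. Only pairs of lifts
  have a varying metric coefficient, and there \<open>f^2\<close> depends on \<open>t\<close> alone
  and \<open>gF\<close> on the fibre point alone.\<close>

lemma
  assumes U: "open_part F U" and p: "(t, x) \<in> I \<times> U" and X: "vector_field F U X" and Y: "vector_field F U Y"
  shows del_t_metric_lift_lift: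
      "dt (t, x) (\<lambda>q. g q (lift X q) (lift Y q)) = 2 * f t * deriv f t * gF x (X x) (Y x)"
    and lift_metric_lift_lift: "w \<in> tangent_space F x \<Longrightarrow>
      lv t x w (\<lambda>q. g q (lift X q) (lift Y q)) = (f t)\<^sup>2 * w (\<lambda>y. gF y (X y) (Y y))"
    and tangent_metric_dt_lift: "v \<in> tangent_space M (t, x) \<Longrightarrow> v (\<lambda>q. g q (dt q) (lift X q)) = 0"
    and tangent_metric_lift_dt: "v \<in> tangent_space M (t, x) \<Longrightarrow> v (\<lambda>q. g q (lift X q) (dt q)) = 0"
    and tangent_metric_dt_dt: "v \<in> tangent_space M (t, x) \<Longrightarrow> v (\<lambda>q. g q (dt q) (dt q)) = 0"
proof -
  have t: "t \<in> I" using p by simp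
  have TX: "X y \<in> tangent_space F y" "Y y \<in> tangent_space F y" if "y \<in> U" for y
    using vector_fieldD[OF X that] vector_fieldD[OF Y that] .
  have yF: "y \<in> points F" if "y \<in> U" for y
    using that U by (auto simp: open_part_def)
  have ff: "smooth_on I (\<lambda>t. f t * f t)"
    by (rule smooth_on_mult[OF open_interval smooth_f smooth_f])
  have "((\<lambda>t. f t * f t) has_real_derivative 2 * f t * deriv f t) (at t)"
    using smooth_on_has_real_derivative[OF open_interval smooth_f t] by (auto intro!: derivative_eq_intros)
  then have d: "deriv (\<lambda>t. f t * f t) t = 2 * f t * deriv f t"
    by (rule DERIV_imp_deriv)
  have H: "g q (lift X q) (lift Y q) = (f (fst q) * f (fst q)) * gF (snd q) (X (snd q)) (Y (snd q))"
    if "q \<in> I \<times> U" for q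
    using that TX yF by (auto simp: lift_apply warped_metric_lift_lift power2_eq_square)
  note * = U p ff F.metric_smooth[OF U X Y] H
  show "dt (t, x) (\<lambda>q. g q (lift X q) (lift Y q)) = 2 * f t * deriv f t * gF x (X x) (Y x)"
    using del_t_separated[OF *] d by simp
  show "lv t x w (\<lambda>q. g q (lift X q) (lift Y q)) = (f t)\<^sup>2 * w (\<lambda>y. gF y (X y) (Y y))"
    if "w \<in> tangent_space F x"
    using lift_separated[OF * that] by (simp add: power2_eq_square)
  show "v (\<lambda>q. g q (dt q) (lift X q)) = 0" if "v \<in> tangent_space M (t, x)"
    by (rule tangent_locally_const[OF U p that]) (use TX yF in \<open>auto simp: lift_apply warped_metric_dt_lift\<close>)
  show "v (\<lambda>q. g q (lift X q) (dt q)) = 0" if "v \<in> tangent_space M (t, x)"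
    by (rule tangent_locally_const[OF U p that]) (use TX yF in \<open>auto simp: lift_apply warped_metric_lift_dt\<close>)
  show "v (\<lambda>q. g q (dt q) (dt q)) = 0" if "v \<in> tangent_space M (t, x)"
    by (rule tangent_locally_const[OF U p that]) (use yF in \<open>auto simp: warped_metric_dt_dt\<close>)
qed

section \<open>Covariant derivatives of \<open>dt\<close> and of lifted fields\<close>

lemma vector_field_dt: "open_part M W \<Longrightarrow> vector_field M W dt"
  using vector_field_subset[OF vector_field_del_t] by (auto simp: open_part_def)

text \<open>The test vectors are single fibre vectors, while the Koszul formula needs fields. Each
  vector is therefore extended to a field \<open>W\<close> on a possibly smaller
  \<open>V\<close>.\<close>

lemma connection_eqI:
  assumes U: "open_part F U" and p: "(t, x) \<in> I \<times> U"
    and Z: "vector_field M (I \<times> U) Z1" "vector_field M (I \<times> U) Z2" and v: "v \<in> tangent_space M (t, x)"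
    and 1: "g (t, x) (nablaM Z1 Z2 (t, x)) (dt (t, x)) = g (t, x) v (dt (t, x))"
    and 2: "\<And>W V. open_part F V \<Longrightarrow> V \<subseteq> U \<Longrightarrow> x \<in> V \<Longrightarrow> vector_field F V W \<Longrightarrow>
      g (t, x) (nablaM Z1 Z2 (t, x)) (lift W (t, x)) = g (t, x) v (lift W (t, x))"
  shows "nablaM Z1 Z2 (t, x) = v"
proof -
  have t: "t \<in> I" and x: "x \<in> U" and xF: "x \<in> points F"
    using product_point[OF U p] by auto
  note MU = open_part_product[OF U]
  show ?thesis
  proof (rule warped_tangent_eqI[OF t xF vector_fieldD[OF M.connection_vector_field[OF MU Z] p] v 1])
    fix u assume u: "u \<in> tangent_space F x"
    obtain V W where V: "open_part F V" "x \<in> V" "vector_field F V W" "W x = u"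
      using F.vector_field_extension[OF xF u] .
    have "g (t, x) (nablaM Z1 Z2 (t, x)) (lift W (t, x)) = g (t, x) v (lift W (t, x))"
      by (rule 2[of "U \<inter> V"])
        (use V U x open_part_Int[OF U V(1)] vector_field_subset[OF V(3), of "U \<inter> V"] in auto)
    then show "g (t, x) (nablaM Z1 Z2 (t, x)) (lv t x u) = g (t, x) v (lv t x u)"
      by (simp add: lift_apply V(4))
  qed
qed

text \<open>Every term of the Koszul formula vanishes, since metric coefficients involving
  \<open>dt\<close> are constant and \<open>dt\<close> commutes with lifts. Geometrically, the
  curves in direction \<open>t\<close> are geodesics.\<close>

lemma nabla_dt_dt:
  assumes U: "open_part F U" and p: "(t, x) \<in> I \<times> U"
  shows "nablaM dt dt (t, x) = (\<lambda>h. 0)"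
proof (rule connection_eqI[OF U p])
  have t: "t \<in> I" and x: "x \<in> U" and xF: "x \<in> points F"
    using product_point[OF U p] by auto
  note MU = open_part_product[OF U]
  note D = vector_field_dt[OF MU]
  have dT: "dt (t, x) \<in> tangent_space M (t, x)" by (rule del_t_in_tangent_space[OF t xF])
  have pM: "(t, x) \<in> points M" by (rule M.open_part_points[OF MU p])
  have lie: "lie_bracket M dt dt (t, x) = (\<lambda>h. 0)"
    by (simp add: lie_bracket_def fun_eq_iff)
  show "vector_field M (I \<times> U) dt" "vector_field M (I \<times> U) dt" by (rule D)+
  show "(\<lambda>h. 0) \<in> tangent_space M (t, x)" by (rule M.tangent_space_zero[OF pM])
  note zero = M.metric_zero_left[OF pM]
  show "g (t, x) (nablaM dt dt (t, x)) (dt (t, x)) = g (t, x) (\<lambda>h. 0) (dt (t, x))"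
    using M.koszul[OF levi_civita_M MU p D D D] lie zero[OF dT]
      tangent_metric_dt_dt[OF U p F.vector_field_zero[OF U] F.vector_field_zero[OF U] dT] by simp
  fix V W assume V: "open_part F V" "V \<subseteq> U" "x \<in> V" and W: "vector_field F V W"
  have pV: "(t, x) \<in> I \<times> V" using V t by simp
  note MV = open_part_product[OF V(1)]
  have wT: "lift W (t, x) \<in> tangent_space M (t, x)"
    by (rule vector_fieldD[OF vector_field_lift[OF V(1) W] pV])
  show "g (t, x) (nablaM dt dt (t, x)) (lift W (t, x)) = g (t, x) (\<lambda>h. 0) (lift W (t, x))"
    using M.koszul[OF levi_civita_M MV pV vector_field_dt[OF MV] vector_field_dt[OF MV] vector_field_lift[OF V(1) W]]
      lie lie_bracket_dt_lift[OF V(1) pV W] zero[OF dT] zero[OF wT]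
      tangent_metric_dt_dt[OF V(1) pV W W wT] tangent_metric_dt_lift[OF V(1) pV W W dT] by simp
qed

text \<open>Against a lift, the only surviving Koszul term is the derivative of \<open>f^2\<close>
  along \<open>dt\<close>; dividing \<open>2 * f * deriv f\<close> by \<open>2 * f^2\<close> gives
  the factor.\<close>

lemma nabla_dt_lift:
  assumes U: "open_part F U" and p: "(t, x) \<in> I \<times> U" and X: "vector_field F U X"
  shows "nablaM dt (lift X) (t, x) = (\<lambda>h. deriv f t / f t * lift X (t, x) h)"
proof (rule connection_eqI[OF U p])
  have t: "t \<in> I" and x: "x \<in> U" and xF: "x \<in> points F"
    using product_point[OF U p] by auto
  note MU = open_part_product[OF U]
  note D = vector_field_dt[OF MU] and L = vector_field_lift[OF U X]
  have dT: "dt (t, x) \<in> tangent_space M (t, x)" by (rule del_t_in_tangent_space[OF t xF])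
  have xT: "lift X (t, x) \<in> tangent_space M (t, x)" by (rule vector_fieldD[OF L p])
  have pM: "(t, x) \<in> points M" by (rule M.open_part_points[OF MU p])
  have lie: "lie_bracket M dt dt (t, x) = (\<lambda>h. 0)"
    by (simp add: lie_bracket_def fun_eq_iff)
  have lie': "lie_bracket M (lift X) dt (t, x) = (\<lambda>h. 0)"
    using M.lie_bracket_antisym[OF MU p L D] lie_bracket_dt_lift[OF U p X] by (intro ext) simp
  show "vector_field M (I \<times> U) dt" "vector_field M (I \<times> U) (lift X)" by (rule D L)+
  show "(\<lambda>h. deriv f t / f t * lift X (t, x) h) \<in> tangent_space M (t, x)"
    by (rule M.tangent_space_cmult[OF pM xT])
  note zero = M.metric_zero_left[OF pM]
  have m0: "g (t, x) (lift X (t, x)) (dt (t, x)) = 0"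
    unfolding lift_apply by (rule warped_metric_lift_dt[OF t xF vector_fieldD[OF X x]])
  show "g (t, x) (nablaM dt (lift X) (t, x)) (dt (t, x)) =
      g (t, x) (\<lambda>h. deriv f t / f t * lift X (t, x) h) (dt (t, x))"
    using M.koszul[OF levi_civita_M MU p D L D] lie lie' lie_bracket_dt_lift[OF U p X] zero[OF dT] zero[OF xT]
      tangent_metric_dt_dt[OF U p X X xT] tangent_metric_lift_dt[OF U p X X dT] tangent_metric_dt_lift[OF U p X X dT]
      M.metric_cmult_left[OF pM xT xT dT, of "deriv f t / f t"] m0 by simp
  fix V W assume V: "open_part F V" "V \<subseteq> U" "x \<in> V" and W: "vector_field F V W"
  have pV: "(t, x) \<in> I \<times> V" using V t by simp
  note MV = open_part_product[OF V(1)]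
  have XV: "vector_field F V X" by (rule vector_field_subset[OF X V(2)])
  note WL = vector_field_lift[OF V(1) W] and XL = vector_field_lift[OF V(1) XV] and DV = vector_field_dt[OF MV]
  have wT: "lift W (t, x) \<in> tangent_space M (t, x)"
    by (rule vector_fieldD[OF WL pV])
  note BT = vector_fieldD[OF F.vector_field_lie_bracket[OF V(1) XV W] V(3)]
  have "2 * g (t, x) (nablaM dt (lift X) (t, x)) (lift W (t, x)) = 2 * f t * deriv f t * gF x (X x) (W x)"
    using M.koszul[OF levi_civita_M MV pV DV XL WL]
      lie_bracket_dt_lift[OF V(1) pV W] lie_bracket_dt_lift[OF V(1) pV XV] zero[OF xT] zero[OF wT]
      lie_bracket_lift_lift[OF V(1) pV XV W] warped_metric_lift_dt[OF t xF BT]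
      tangent_metric_dt_lift[OF V(1) pV W W xT] tangent_metric_dt_lift[OF V(1) pV XV XV wT]
      del_t_metric_lift_lift[OF V(1) pV XV W] by (simp add: lift_apply)
  moreover have "g (t, x) (\<lambda>h. deriv f t / f t * lift X (t, x) h) (lift W (t, x)) =
      deriv f t / f t * ((f t)\<^sup>2 * gF x (X x) (W x))"
    using M.metric_cmult_left[OF pM xT xT wT, of "deriv f t / f t"]
      warped_metric_lift_lift[OF t xF vector_fieldD[OF X x] vector_fieldD[OF W V(3)]] by (simp add: lift_apply)
  ultimately show "g (t, x) (nablaM dt (lift X) (t, x)) (lift W (t, x)) =
      g (t, x) (\<lambda>h. deriv f t / f t * lift X (t, x) h) (lift W (t, x))"
    using f_pos[OF t] by (simp add: power2_eq_square)
qed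

text \<open>The bracket of \<open>dt\<close> with a lift vanishes, so torsion-freeness identifies
  this with the previous derivative.\<close>

lemma nabla_lift_dt:
  assumes U: "open_part F U" and p: "(t, x) \<in> I \<times> U" and X: "vector_field F U X"
  shows "nablaM (lift X) dt (t, x) = (\<lambda>h. deriv f t / f t * lift X (t, x) h)"
proof
  fix h
  note MU = open_part_product[OF U]
  have "torsion_free M nablaM"
    using levi_civita_M by (simp add: levi_civita_connection_def)
  from this[unfolded torsion_free_def, THEN spec, THEN spec, THEN spec, THEN mp,
      OF conjI[OF MU conjI[OF vector_field_dt[OF MU] vector_field_lift[OF U X]]], THEN bspec, OF p]
  have "nablaM dt (lift X) (t, x) h - nablaM (lift X) dt (t, x) h = 0"
    using lie_bracket_dt_lift[OF U p X] by metis
  then show "nablaM (lift X) dt (t, x) h = deriv f t / f t * lift X (t, x) h"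
    using nabla_dt_lift[OF U p X] by simp
qed

text \<open>The \<open>dt\<close> part comes from the derivative of \<open>f^2\<close>; its minus
  sign in the Koszul formula is undone by \<open>dt\<close> having norm \<open>-1\<close>. Against
  lifts the formula is \<open>f^2\<close> times the Koszul formula of the fibre.\<close>

lemma nabla_lift_lift:
  assumes U: "open_part F U" and p: "(t, x) \<in> I \<times> U" and X: "vector_field F U X" and Y: "vector_field F U Y"
  shows "nablaM (lift X) (lift Y) (t, x) =
    (\<lambda>h. lift (nablaF X Y) (t, x) h + f t * deriv f t * gF x (X x) (Y x) * dt (t, x) h)"
    (is "_ = (\<lambda>h. ?A h + ?c * dt (t, x) h)")
proof (rule connection_eqI[OF U p])
  have t: "t \<in> I" and x: "x \<in> U" and xF: "x \<in> points F"
    using product_point[OF U p] by auto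
  note MU = open_part_product[OF U]
  note D = vector_field_dt[OF MU] and L = vector_field_lift[OF U]
  note N = F.connection_vector_field[OF U X Y]
  note NT = vector_fieldD[OF N x]
  have dT: "dt (t, x) \<in> tangent_space M (t, x)" by (rule del_t_in_tangent_space[OF t xF])
  have xT: "lift X (t, x) \<in> tangent_space M (t, x)" if "vector_field F U X" for X
    by (rule vector_fieldD[OF L[OF that] p])
  have pM: "(t, x) \<in> points M" by (rule M.open_part_points[OF MU p])
  have lie': "lie_bracket M (lift X) dt (t, x) = (\<lambda>h. 0)" if "vector_field F U X" for X
    using M.lie_bracket_antisym[OF MU p L[OF that] D] lie_bracket_dt_lift[OF U p that] by (intro ext) simp
  show "vector_field M (I \<times> U) (lift X)" "vector_field M (I \<times> U) (lift Y)" by (rule L X Y)+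
  note cT = M.tangent_space_cmult[OF pM dT, of ?c]
  show "(\<lambda>h. ?A h + ?c * dt (t, x) h) \<in> tangent_space M (t, x)"
    by (rule M.tangent_space_add[OF pM xT[OF N] cT])
  note zero = M.metric_zero_left[OF pM]
  have "2 * g (t, x) (nablaM (lift X) (lift Y) (t, x)) (dt (t, x)) = - 2 * ?c"
    using M.koszul[OF levi_civita_M MU p L[OF X] L[OF Y] D] lie'[OF X] lie'[OF Y] zero[OF xT[OF X]] zero[OF xT[OF Y]]
      tangent_metric_lift_dt[OF U p X X xT[OF Y]] tangent_metric_lift_dt[OF U p Y Y xT[OF X]]
      lie_bracket_lift_lift[OF U p X Y]
      warped_metric_lift_dt[OF t xF vector_fieldD[OF F.vector_field_lie_bracket[OF U X Y] x]]
      del_t_metric_lift_lift[OF U p X Y] by (simp add: lift_apply)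
  then show "g (t, x) (nablaM (lift X) (lift Y) (t, x)) (dt (t, x)) = g (t, x) (\<lambda>h. ?A h + ?c * dt (t, x) h) (dt (t, x))"
    using M.metric_add_left[OF pM xT[OF N] cT dT] M.metric_cmult_left[OF pM dT dT dT, of ?c]
      warped_metric_lift_dt[OF t xF NT] warped_metric_dt_dt[OF t xF] by (simp add: lift_apply)
  fix V W assume V: "open_part F V" "V \<subseteq> U" "x \<in> V" and W: "vector_field F V W"
  have pV: "(t, x) \<in> I \<times> V" using V t by simp
  note MV = open_part_product[OF V(1)]
  have XV: "vector_field F V X" and YV: "vector_field F V Y"
    by (rule vector_field_subset[OF X V(2)] vector_field_subset[OF Y V(2)])+
  note LV = vector_field_lift[OF V(1)] and ww = warped_metric_lift_lift[OF t xF]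
  have wT: "lift W (t, x) \<in> tangent_space M (t, x)"
    by (rule vector_fieldD[OF LV[OF W] pV])
  have T: "X x \<in> tangent_space F x" if "vector_field F V X" for X
    by (rule vector_fieldD[OF that V(3)])
  have lie: "g (t, x) (lie_bracket M (lift X) (lift Y) (t, x)) (lift Z (t, x)) = (f t)\<^sup>2 * gF x (lie_bracket F X Y x) (Z x)"
    if X: "vector_field F V X" and Y: "vector_field F V Y" and Z: "vector_field F V Z" for X Y Z
    unfolding lie_bracket_lift_lift[OF V(1) pV X Y] lift_apply
    by (rule ww[OF T[OF F.vector_field_lie_bracket[OF V(1) X Y]] T[OF Z]])
  have der: "lift X (t, x) (\<lambda>q. g q (lift Y q) (lift Z q)) = (f t)\<^sup>2 * X x (\<lambda>y. gF y (Y y) (Z y))"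
    if X: "vector_field F V X" and Y: "vector_field F V Y" and Z: "vector_field F V Z" for X Y Z
    unfolding lift_apply[of X] by (rule lift_metric_lift_lift[OF V(1) pV Y Z T[OF X]])
  have "2 * g (t, x) (nablaM (lift X) (lift Y) (t, x)) (lift W (t, x)) = (f t)\<^sup>2 * (2 * gF x (nablaF X Y x) (W x))"
    unfolding M.koszul[OF levi_civita_M MV pV LV[OF XV] LV[OF YV] LV[OF W]]
      F.koszul[OF levi_civita_F V(1,3) XV YV W]
    by (simp add: der lie XV YV W algebra_simps)
  moreover have "g (t, x) (\<lambda>h. ?A h + ?c * dt (t, x) h) (lift W (t, x)) = (f t)\<^sup>2 * gF x (nablaF X Y x) (W x)"
    using M.metric_add_left[OF pM xT[OF N] cT wT] M.metric_cmult_left[OF pM dT dT wT, of ?c]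
      warped_metric_dt_lift[OF t xF T[OF W]] ww[OF NT T[OF W]] by (simp add: lift_apply)
  ultimately show "g (t, x) (nablaM (lift X) (lift Y) (t, x)) (lift W (t, x)) =
      g (t, x) (\<lambda>h. ?A h + ?c * dt (t, x) h) (lift W (t, x))"
    by simp
qed

end

section \<open>The curvature of the quarter-symmetric connection\<close>

locale warped_quarter_symmetric = warped_levi_civita F I gF nablaF f nablaM
  for F :: "('a::{t2_space,second_countable_topology}, 'e::euclidean_space) chart set"
    and I gF nablaF f nablaM +
  fixes lam1 lam2 :: real
begin

abbreviation "Q \<equiv> quarter_symmetric_connection g nablaM dt lam1 lam2"

definition hubble :: "real \<Rightarrow> real" where "hubble t = deriv f t / f t"

sublocale Q: metric_connection M g Q
  using M.affine_quarter_symmetric_connection[OF vector_field_dt] M.vector_field_lie_bracket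
  by unfold_locales auto

lemma smooth_hubble: "smooth_on I hubble"
proof -
  have "smooth_on I (\<lambda>t. deriv f t * f t powr (-1))"
    by (intro smooth_on_mult smooth_on_powr smooth_on_deriv open_interval smooth_f f_pos)
  then show ?thesis
    by (rule smooth_on_cong[OF open_interval, rotated]) (use f_pos in \<open>simp add: hubble_def powr_minus_divide less_imp_le\<close>)
qed

text \<open>For \<open>P = dt\<close> the 1-form of the quarter-symmetric connection is
  \<open>-1\<close> on \<open>dt\<close> and \<open>0\<close> on lifts. This accounts for the signs
  with which \<open>lam1\<close> and \<open>lam2\<close> appear.\<close>

lemma
  assumes U: "open_part F U" and p: "(t, x) \<in> I \<times> U"
  shows Q_dt_dt: "Q dt dt (t, x) h = (lam2 - lam1) * dt (t, x) h"
    and Q_dt_lift: "vector_field F U X \<Longrightarrow> Q dt (lift X) (t, x) h = hubble t * lift X (t, x) h"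
    and Q_lift_dt: "vector_field F U X \<Longrightarrow> Q (lift X) dt (t, x) h = (hubble t - lam1) * lift X (t, x) h"
    and Q_lift_lift: "vector_field F U X \<Longrightarrow> vector_field F U Y \<Longrightarrow> Q (lift X) (lift Y) (t, x) h =
      lift (nablaF X Y) (t, x) h + (hubble t - lam2) * (f t)\<^sup>2 * gF x (X x) (Y x) * dt (t, x) h"
proof -
  have t: "t \<in> I" and x: "x \<in> U" and xF: "x \<in> points F"
    using product_point[OF U p] by auto
  have T: "X x \<in> tangent_space F x" if "vector_field F U X" for X
    by (rule vector_fieldD[OF that x])
  note s = quarter_symmetric_connection_def
  show "Q dt dt (t, x) h = (lam2 - lam1) * dt (t, x) h"
    by (simp add: s nabla_dt_dt[OF U p] warped_metric_dt_dt[OF t xF] algebra_simps)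
  show "Q dt (lift X) (t, x) h = hubble t * lift X (t, x) h"
    "Q (lift X) dt (t, x) h = (hubble t - lam1) * lift X (t, x) h" if X: "vector_field F U X" for X
    using warped_metric_dt_lift[OF t xF T[OF X]] warped_metric_lift_dt[OF t xF T[OF X]] warped_metric_dt_dt[OF t xF]
    by (simp_all add: s nabla_dt_lift[OF U p X] nabla_lift_dt[OF U p X] lift_apply hubble_def left_diff_distrib)
  show "Q (lift X) (lift Y) (t, x) h =
      lift (nablaF X Y) (t, x) h + (hubble t - lam2) * (f t)\<^sup>2 * gF x (X x) (Y x) * dt (t, x) h"
    if X: "vector_field F U X" and Y: "vector_field F U Y" for X Y
    using warped_metric_lift_dt[OF t xF T[OF Y]] warped_metric_lift_lift[OF t xF T[OF X] T[OF Y]] f_pos[OF t]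
    by (simp add: s nabla_lift_lift[OF U p X Y] lift_apply hubble_def field_simps power2_eq_square)
qed

lemma vector_field_separated:
  assumes "open_part F U" "smooth_on I k" "smooth_function F U u" "vector_field M (I \<times> U) Z"
  shows "vector_field M (I \<times> U) (\<lambda>q h. k (fst q) * u (snd q) * Z q h)"
  by (rule M.vector_field_mult[OF open_part_product[OF assms(1)] smooth_function_separated[OF assms(1-3)] assms(4)])

text \<open>The Leibniz rule for the coefficients that a first application of \<open>Q\<close> to
  \<open>dt\<close> and lifts leaves behind; the second application in the curvature needs
  it.\<close>

lemma
  assumes U: "open_part F U" and p: "(t, x) \<in> I \<times> U" and k: "smooth_on I k" and u: "smooth_function F U u"
    and Z: "vector_field M (I \<times> U) Z"
  shows Q_dt_separated: "Q dt (\<lambda>q h. k (fst q) * u (snd q) * Z q h) (t, x) h =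
      deriv k t * u x * Z (t, x) h + k t * u x * Q dt Z (t, x) h"
    and Q_lift_separated: "vector_field F U X \<Longrightarrow> Q (lift X) (\<lambda>q h. k (fst q) * u (snd q) * Z q h) (t, x) h =
      k t * X x u * Z (t, x) h + k t * u x * Q (lift X) Z (t, x) h"
proof -
  note MU = open_part_product[OF U]
  note r = Q.connection_mult_right[OF MU _ Z smooth_function_separated[OF U k u] p]
  show "Q dt (\<lambda>q h. k (fst q) * u (snd q) * Z q h) (t, x) h =
      deriv k t * u x * Z (t, x) h + k t * u x * Q dt Z (t, x) h"
    using r[OF vector_field_dt[OF MU]] del_t_separated[OF U p k u] by simp
  show "Q (lift X) (\<lambda>q h. k (fst q) * u (snd q) * Z q h) (t, x) h =
      k t * X x u * Z (t, x) h + k t * u x * Q (lift X) Z (t, x) h" if X: "vector_field F U X"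
    using r[OF vector_field_lift[OF U X]] lift_separated[OF U p k u _ vector_fieldD[OF X]] p by (simp add: lift_apply)
qed

lemma
  assumes U: "open_part F U" and p: "(t, x) \<in> I \<times> U" and k: "smooth_on I k"
    and Z: "vector_field M (I \<times> U) Z"
  shows Q_dt_scaled: "Q dt (\<lambda>q h. k (fst q) * Z q h) (t, x) h =
      deriv k t * Z (t, x) h + k t * Q dt Z (t, x) h"
    and Q_lift_scaled: "vector_field F U X \<Longrightarrow> Q (lift X) (\<lambda>q h. k (fst q) * Z q h) (t, x) h =
      k t * Q (lift X) Z (t, x) h"
    and vector_field_scaled: "vector_field M (I \<times> U) (\<lambda>q h. k (fst q) * Z q h)"
proof -
  have "open U" using U by (simp add: open_part_def)
  then have c: "smooth_function F U (\<lambda>x. 1)" by (rule F.smooth_function_const)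
  show "Q dt (\<lambda>q h. k (fst q) * Z q h) (t, x) h = deriv k t * Z (t, x) h + k t * Q dt Z (t, x) h"
    using Q_dt_separated[OF U p k c Z] by simp
  show "Q (lift X) (\<lambda>q h. k (fst q) * Z q h) (t, x) h = k t * Q (lift X) Z (t, x) h"
    if X: "vector_field F U X"
    using Q_lift_separated[OF U p k c Z X] F.tangent_const[OF vector_fieldD[OF X]] product_point[OF U p] by simp
  show "vector_field M (I \<times> U) (\<lambda>q h. k (fst q) * Z q h)"
    using vector_field_separated[OF U k c Z] by simp
qed

section \<open>Curvature on \<open>dt\<close> and on lifted fields\<close>

lemma Q_lie_bracket:
  assumes U: "open_part F U" and p: "(t, x) \<in> I \<times> U" and Z: "vector_field M (I \<times> U) Z"
    and X: "vector_field F U X" and Y: "vector_field F U Y"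
  shows "Q (lie_bracket M dt (lift X)) Z (t, x) h = 0"
    and "Q (lie_bracket M (lift X) (lift Y)) Z (t, x) h = Q (lift (lie_bracket F X Y)) Z (t, x) h"
proof -
  note MU = open_part_product[OF U]
  have oMU: "open (I \<times> U)" using MU by (simp add: open_part_def)
  have "Q (lie_bracket M dt (lift X)) Z (t, x) = Q (\<lambda>q h. 0 * dt q h) Z (t, x)"
    by (rule Q.connection_cong[OF MU M.vector_field_mult[OF MU M.smooth_function_const[OF oMU] vector_field_dt[OF MU]] Z _ _ p])
      (use lie_bracket_dt_lift[OF U _ X] in auto)
  then show "Q (lie_bracket M dt (lift X)) Z (t, x) h = 0"
    using Q.connection_mult_left[OF MU vector_field_dt[OF MU] Z M.smooth_function_const[OF oMU, of 0] p] by simp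
  have "Q (lie_bracket M (lift X) (lift Y)) Z (t, x) = Q (lift (lie_bracket F X Y)) Z (t, x)"
    by (rule Q.connection_cong[OF MU vector_field_lift[OF U F.vector_field_lie_bracket[OF U X Y]] Z _ _ p])
      (use lie_bracket_lift_lift[OF U _ X Y] in auto)
  then show "Q (lie_bracket M (lift X) (lift Y)) Z (t, x) h = Q (lift (lie_bracket F X Y)) Z (t, x) h"
    by simp
qed

lemma curvature_dt_lift_dt:
  assumes U: "open_part F U" and p: "(t, x) \<in> I \<times> U" and X: "vector_field F U X"
  shows "curvature M Q dt (lift X) dt (t, x) h =
    (deriv hubble t + (hubble t - lam1) * hubble t - (lam2 - lam1) * (hubble t - lam1)) * lift X (t, x) h"
proof -
  note MU = open_part_product[OF U]
  note D = vector_field_dt[OF MU] and L = vector_field_lift[OF U X]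
  have t: "t \<in> I" using p by simp
  have k: "smooth_on I (\<lambda>t. hubble t - lam1)"
    using smooth_on_add[OF open_interval smooth_hubble smooth_on_interval_const[of "-lam1"]] by simp
  have dk: "deriv (\<lambda>t. hubble t - lam1) t = deriv hubble t"
    using smooth_on_has_real_derivative[OF open_interval smooth_hubble t]
    by (intro DERIV_imp_deriv) (auto intro!: derivative_eq_intros)
  have "Q dt (Q (lift X) dt) (t, x) = Q dt (\<lambda>q h. (hubble (fst q) - lam1) * lift X q h) (t, x)"
    by (rule Q.connection_cong[OF MU D vector_field_scaled[OF U p k L] _ _ p])
      (use Q_lift_dt[OF U _ X] in auto)
  then have 1: "Q dt (Q (lift X) dt) (t, x) h = (deriv hubble t + (hubble t - lam1) * hubble t) * lift X (t, x) h"
    using Q_dt_scaled[OF U p k L] dk Q_dt_lift[OF U p X] by (simp add: algebra_simps)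
  have "Q (lift X) (Q dt dt) (t, x) = Q (lift X) (\<lambda>q h. (\<lambda>t. lam2 - lam1) (fst q) * dt q h) (t, x)"
    by (rule Q.connection_cong[OF MU L vector_field_scaled[OF U p smooth_on_interval_const D] _ _ p])
      (use Q_dt_dt[OF U] in auto)
  then have 2: "Q (lift X) (Q dt dt) (t, x) h = (lam2 - lam1) * ((hubble t - lam1) * lift X (t, x) h)"
    using Q_lift_scaled[OF U p smooth_on_interval_const[of "lam2 - lam1"] D X] Q_lift_dt[OF U p X] by simp
  show ?thesis
    using 1 2 Q_lie_bracket(1)[OF U p D X X] by (simp add: curvature_def algebra_simps)
qed

text \<open>The function of \<open>t\<close> in the \<open>dt\<close> part of
  \<open>Q (lift X) (lift Y)\<close>. The square is written as a product to fit the rules for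
  smoothness and differentiation.\<close>

lemma smooth_warp: "smooth_on I (\<lambda>t. (hubble t - lam2) * (f t * f t))"
proof -
  have k: "smooth_on I (\<lambda>t. hubble t - lam2)"
    using smooth_on_add[OF open_interval smooth_hubble smooth_on_interval_const[of "-lam2"]] by simp
  show ?thesis
    by (intro smooth_on_mult open_interval k smooth_f)
qed

lemma deriv_warp:
  assumes t: "t \<in> I"
  shows "deriv (\<lambda>t. (hubble t - lam2) * (f t * f t)) t =
    (deriv hubble t + 2 * hubble t * (hubble t - lam2)) * (f t)\<^sup>2"
proof -
  have h: "(hubble has_real_derivative deriv hubble t) (at t)"
    by (rule smooth_on_has_real_derivative[OF open_interval smooth_hubble t])
  have f: "(f has_real_derivative hubble t * f t) (at t)"
    using smooth_on_has_real_derivative[OF open_interval smooth_f t] f_pos[OF t] by (simp add: hubble_def)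
  have "((\<lambda>t. (hubble t - lam2) * (f t * f t)) has_real_derivative
      deriv hubble t * (f t * f t) + (hubble t * f t * f t + hubble t * f t * f t) * (hubble t - lam2)) (at t)"
    by (rule DERIV_cong[OF DERIV_mult[OF DERIV_diff[OF h DERIV_const] DERIV_mult[OF f f]]]) simp
  note * = DERIV_imp_deriv[OF this]
  show ?thesis
    unfolding * by (simp add: algebra_simps power2_eq_square)
qed

text \<open>Splits the inner derivative into its fibre part and its \<open>dt\<close> part before
  the next derivative is applied; this is allowed because the splitting holds on all of
  \<open>I \<times> U\<close> and not just at one point.\<close>

lemma Q_lift_lift_separated:
  assumes U: "open_part F U" and p: "(t, x) \<in> I \<times> U" and X: "vector_field F U X" and Y: "vector_field F U Y"
    and Z: "vector_field M (I \<times> U) Z"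
  shows "Q Z (Q (lift X) (lift Y)) (t, x) h = Q Z (lift (nablaF X Y)) (t, x) h +
    Q Z (\<lambda>q h. (\<lambda>t. (hubble t - lam2) * (f t * f t)) (fst q) * (\<lambda>x. gF x (X x) (Y x)) (snd q) * dt q h) (t, x) h"
proof -
  note MU = open_part_product[OF U]
  note L = vector_field_lift[OF U F.connection_vector_field[OF U X Y]]
  note S = vector_field_separated[OF U smooth_warp F.metric_smooth[OF U X Y] vector_field_dt[OF MU]]
  have "Q Z (Q (lift X) (lift Y)) (t, x) = Q Z (\<lambda>q h. lift (nablaF X Y) q h +
      (\<lambda>t. (hubble t - lam2) * (f t * f t)) (fst q) * (\<lambda>x. gF x (X x) (Y x)) (snd q) * dt q h) (t, x)"
    by (rule Q.connection_cong[OF MU Z M.vector_field_add[OF MU L S] _ _ p])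
      (use Q_lift_lift[OF U _ X Y] in \<open>auto simp: power2_eq_square\<close>)
  then show ?thesis
    using Q.connection_add_right[OF MU Z L S p] by simp
qed

text \<open>The lifted terms \<open>hubble t * lift (nablaF X Y)\<close> occur in both orders of
  differentiation and cancel, so the result points along \<open>dt\<close>.\<close>

lemma curvature_dt_lift_lift:
  assumes U: "open_part F U" and p: "(t, x) \<in> I \<times> U" and X: "vector_field F U X" and Y: "vector_field F U Y"
  shows "curvature M Q dt (lift X) (lift Y) (t, x) h =
    (deriv hubble t + (hubble t - lam2) * hubble t + (lam2 - lam1) * (hubble t - lam2)) * (f t)\<^sup>2 * gF x (X x) (Y x) * dt (t, x) h"
proof -
  note MU = open_part_product[OF U]
  note D = vector_field_dt[OF MU] and L = vector_field_lift[OF U]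
  have t: "t \<in> I" using p by simp
  note N = F.connection_vector_field[OF U X Y]
  have 1: "Q dt (Q (lift X) (lift Y)) (t, x) h = hubble t * lift (nablaF X Y) (t, x) h +
     (deriv hubble t + 2 * hubble t * (hubble t - lam2) + (hubble t - lam2) * (lam2 - lam1)) * (f t)\<^sup>2 * gF x (X x) (Y x) * dt (t, x) h"
    unfolding Q_lift_lift_separated[OF U p X Y D] Q_dt_separated[OF U p smooth_warp F.metric_smooth[OF U X Y] D]
      Q_dt_lift[OF U p N] deriv_warp[OF t] Q_dt_dt[OF U p]
    by (simp add: algebra_simps power2_eq_square)
  have "Q (lift X) (Q dt (lift Y)) (t, x) = Q (lift X) (\<lambda>q h. hubble (fst q) * lift Y q h) (t, x)"
    by (rule Q.connection_cong[OF MU L[OF X] vector_field_scaled[OF U p smooth_hubble L[OF Y]] _ _ p])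
      (use Q_dt_lift[OF U _ Y] in auto)
  then have 2: "Q (lift X) (Q dt (lift Y)) (t, x) h = hubble t * (lift (nablaF X Y) (t, x) h +
      (hubble t - lam2) * (f t)\<^sup>2 * gF x (X x) (Y x) * dt (t, x) h)"
    using Q_lift_scaled[OF U p smooth_hubble L[OF Y] X] Q_lift_lift[OF U p X Y] by simp
  show ?thesis
    unfolding curvature_def 1 2 Q_lie_bracket(1)[OF U p L[OF Y] X X] by (simp add: algebra_simps)
qed

lemma fibre_torsion_free:
  assumes U: "open_part F U" and x: "x \<in> U" and X: "vector_field F U X" and Y: "vector_field F U Y"
  shows "lie_bracket F X Y x = (\<lambda>h. nablaF X Y x h - nablaF Y X x h)"
proof -
  have "torsion_free F nablaF"
    using levi_civita_F by (simp add: levi_civita_connection_def)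
  from this[unfolded torsion_free_def, THEN spec, THEN spec, THEN spec, THEN mp,
      OF conjI[OF U conjI[OF X Y]], THEN bspec, OF x] show ?thesis by simp
qed

lemma lift_torsion_free:
  assumes U: "open_part F U" and p: "(t, x) \<in> I \<times> U" and X: "vector_field F U X" and Y: "vector_field F U Y"
  shows "lift (lie_bracket F X Y) (t, x) h = lift (nablaF X Y) (t, x) h - lift (nablaF Y X) (t, x) h"
  using fibre_torsion_free[OF U _ X Y, of x] p by (simp add: lift_apply lift_vector_apply)

text \<open>A Gauss equation for the slices. The \<open>dt\<close> parts cancel because
  \<open>nablaF\<close> is metric and torsion-free; what is added to the fibre curvature has the
  algebraic shape of a constant curvature tensor.\<close>

lemma curvature_lift_lift_lift:
  assumes U: "open_part F U" and p: "(t, x) \<in> I \<times> U" and X: "vector_field F U X" and Y: "vector_field F U Y"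
    and Z: "vector_field F U Z"
  shows "curvature M Q (lift X) (lift Y) (lift Z) (t, x) h = lift (curvature F nablaF X Y Z) (t, x) h +
    (hubble t - lam1) * (hubble t - lam2) * (f t)\<^sup>2 *
      (gF x (Y x) (Z x) * lift X (t, x) h - gF x (X x) (Z x) * lift Y (t, x) h)"
proof -
  note MU = open_part_product[OF U]
  note D = vector_field_dt[OF MU] and L = vector_field_lift[OF U] and N = F.connection_vector_field[OF U]
  have t: "t \<in> I" and x: "x \<in> U" and xF: "x \<in> points F"
    using product_point[OF U p] by auto
  note V = vector_fieldD[OF _ x]
  have c: "X x (\<lambda>y. gF y (Y y) (Z y)) = gF x (nablaF X Y x) (Z x) + gF x (Y x) (nablaF X Z x)"
    if "vector_field F U X" "vector_field F U Y" "vector_field F U Z" for X Y Z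
    using levi_civita_F[unfolded levi_civita_connection_def, THEN conjunct2, THEN conjunct2,
        unfolded metric_compatible_def, THEN spec, THEN spec, THEN spec, THEN spec, THEN mp,
        OF conjI[OF U conjI[OF that(1) conjI[OF that(2,3)]]], THEN bspec, OF x] .
  have 1: "Q (lift X) (Q (lift Y) (lift Z)) (t, x) h = lift (nablaF X (nablaF Y Z)) (t, x) h +
      (hubble t - lam2) * (f t)\<^sup>2 * (gF x (X x) (nablaF Y Z x) + gF x (nablaF X Y x) (Z x) + gF x (Y x) (nablaF X Z x)) * dt (t, x) h +
      (hubble t - lam1) * (hubble t - lam2) * (f t)\<^sup>2 * gF x (Y x) (Z x) * lift X (t, x) h"
    if X: "vector_field F U X" and Y: "vector_field F U Y" for X Y
    unfolding Q_lift_lift_separated[OF U p Y Z L[OF X]] Q_lift_separated[OF U p smooth_warp F.metric_smooth[OF U Y Z] D X]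
      Q_lift_lift[OF U p X N[OF Y Z]] Q_lift_dt[OF U p X] c[OF X Y Z]
    by (simp add: algebra_simps power2_eq_square)
  have 2: "Q (lie_bracket M (lift X) (lift Y)) (lift Z) (t, x) h = lift (nablaF (lie_bracket F X Y) Z) (t, x) h +
      (hubble t - lam2) * (f t)\<^sup>2 * (gF x (nablaF X Y x) (Z x) - gF x (nablaF Y X x) (Z x)) * dt (t, x) h"
    unfolding Q_lie_bracket(2)[OF U p L[OF Z] X Y] Q_lift_lift[OF U p F.vector_field_lie_bracket[OF U X Y] Z]
      fibre_torsion_free[OF U x X Y] F.metric_diff_left[OF xF V[OF N[OF X Y]] V[OF N[OF Y X]] V[OF Z]] ..
  have 3: "lift (curvature F nablaF X Y Z) (t, x) h = lift (nablaF X (nablaF Y Z)) (t, x) h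
      - lift (nablaF Y (nablaF X Z)) (t, x) h - lift (nablaF (lie_bracket F X Y) Z) (t, x) h"
    by (simp add: lift_apply lift_vector_apply curvature_def)
  show ?thesis
    unfolding curvature_def[of M] 1[OF X Y] 1[OF Y X] 2 3 by (simp add: algebra_simps)
qed

text \<open>The lifted parts cancel by torsion-freeness and the \<open>dt\<close> parts by symmetry
  of \<open>gF\<close>. The vanishing of the mixed component \<open>ricci_lift_dt\<close> relies on
  it.\<close>

lemma curvature_lift_lift_dt:
  assumes U: "open_part F U" and p: "(t, x) \<in> I \<times> U" and X: "vector_field F U X" and Y: "vector_field F U Y"
  shows "curvature M Q (lift X) (lift Y) dt (t, x) h = 0"
proof -
  note MU = open_part_product[OF U]
  note D = vector_field_dt[OF MU] and L = vector_field_lift[OF U] and N = F.connection_vector_field[OF U]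
  have x: "x \<in> U" and xF: "x \<in> points F"
    using product_point[OF U p] by auto
  have k: "smooth_on I (\<lambda>t. hubble t - lam1)"
    using smooth_on_add[OF open_interval smooth_hubble smooth_on_interval_const[of "-lam1"]] by simp
  have 1: "Q (lift X) (Q (lift Y) dt) (t, x) h = (hubble t - lam1) * (lift (nablaF X Y) (t, x) h +
      (hubble t - lam2) * (f t)\<^sup>2 * gF x (X x) (Y x) * dt (t, x) h)"
    if X: "vector_field F U X" and Y: "vector_field F U Y" for X Y
  proof -
    have "Q (lift X) (Q (lift Y) dt) (t, x) = Q (lift X) (\<lambda>q h. (hubble (fst q) - lam1) * lift Y q h) (t, x)"
      by (rule Q.connection_cong[OF MU L[OF X] vector_field_scaled[OF U p k L[OF Y]] _ _ p])
        (use Q_lift_dt[OF U _ Y] in auto)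
    then show ?thesis
      using Q_lift_scaled[OF U p k L[OF Y] X] Q_lift_lift[OF U p X Y] by simp
  qed
  have 2: "Q (lie_bracket M (lift X) (lift Y)) dt (t, x) h =
      (hubble t - lam1) * (lift (nablaF X Y) (t, x) h - lift (nablaF Y X) (t, x) h)"
    unfolding Q_lie_bracket(2)[OF U p D X Y] Q_lift_dt[OF U p F.vector_field_lie_bracket[OF U X Y]]
      lift_torsion_free[OF U p X Y] ..
  show ?thesis
    unfolding curvature_def 1[OF X Y] 1[OF Y X] 2
      F.metric_sym[OF xF vector_fieldD[OF X x] vector_fieldD[OF Y x]]
    by (simp add: algebra_simps)
qed

end

section \<open>The Einstein condition on a warped product\<close>

lemma (in metric_connection) ricci_eq_metric_if_frame:
  assumes U: "open_part A U" "p \<in> U" and E: "orthonormal_frame A g U \<epsilon> E"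
    and V: "open_part A V" "p \<in> V" and X: "vector_field A V X" and Y: "vector_field A V Y"
    and eq: "\<And>i j. i < DIM('e) \<Longrightarrow> j < DIM('e) \<Longrightarrow> ricci A g D (E i) (E j) p = \<alpha> * g p (E i p) (E j p)"
  shows "ricci A g D X Y p = \<alpha> * g p (X p) (Y p)"
proof -
  let ?N = "{..<DIM('e)}"
  let ?W = "U \<inter> V"
  have W: "open_part A ?W" "p \<in> ?W"
    using U V open_part_Int by auto
  have oW: "open ?W" and p: "p \<in> points A"
    using W by (auto simp: open_part_def)
  have EW: "vector_field A ?W (E k)" if "k \<in> ?N" for k
    using E that by (auto simp: orthonormal_frame_def intro: vector_field_subset)
  have sub: "vector_field A V Z \<Longrightarrow> vector_field A ?W Z" for Z
    using vector_field_subset by blast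
  have expand: "Z q h = (\<Sum>k\<in>?N. \<epsilon> k * g q (Z q) (E k q) * E k q h)"
    if "vector_field A V Z" "q \<in> ?W" for Z q h
    by (rule orthonormal_frame_expand[OF E U(1)]) (use that vector_fieldD[OF that(1)] in auto)
  have sm: "smooth_function A ?W (\<lambda>q. \<epsilon> k * g q (Z q) (E k q))" if "vector_field A V Z" "k \<in> ?N" for Z k
    by (intro smooth_function_cmult oW metric_smooth[OF W(1)] sub EW that)
  note T = vector_fieldD[OF EW W(2)]
  have "ricci A g D X Y p = (\<Sum>i\<in>?N. \<epsilon> i * g p (X p) (E i p) * ricci A g D (E i) Y p)"
    by (rule tensorial_at_expand[OF ricci_tensorial_1[OF V Y] W _ sm[OF X] EW expand[OF X]]) auto
  also have "\<dots> = (\<Sum>i\<in>?N. \<epsilon> i * g p (X p) (E i p) * (\<alpha> * g p (E i p) (Y p)))"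
  proof (rule sum.cong[OF refl])
    fix i assume i: "i \<in> ?N"
    have "ricci A g D (E i) Y p = (\<Sum>j\<in>?N. \<epsilon> j * g p (Y p) (E j p) * ricci A g D (E i) (E j) p)"
      by (rule tensorial_at_expand[OF ricci_tensorial_2[OF W EW[OF i]] W _ sm[OF Y] EW expand[OF Y]]) auto
    also have "\<dots> = \<alpha> * (\<Sum>j\<in>?N. \<epsilon> j * g p (Y p) (E j p) * g p (E i p) (E j p))"
      using i by (simp add: eq sum_distrib_left algebra_simps)
    also have "(\<Sum>j\<in>?N. \<epsilon> j * g p (Y p) (E j p) * g p (E i p) (E j p)) =
        g p (E i p) (\<lambda>h. \<Sum>j\<in>?N. \<epsilon> j * g p (Y p) (E j p) * E j p h)"
      by (rule metric_sum_right[OF p T[OF i] T, symmetric])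
    also have "(\<lambda>h. \<Sum>j\<in>?N. \<epsilon> j * g p (Y p) (E j p) * E j p h) = Y p"
      using expand[OF Y W(2)] by (intro ext) simp
    finally show "\<epsilon> i * g p (X p) (E i p) * ricci A g D (E i) Y p =
        \<epsilon> i * g p (X p) (E i p) * (\<alpha> * g p (E i p) (Y p))" by simp
  qed
  also have "\<dots> = \<alpha> * (\<Sum>i\<in>?N. \<epsilon> i * g p (X p) (E i p) * g p (E i p) (Y p))"
    by (simp add: sum_distrib_left algebra_simps)
  also have "(\<Sum>i\<in>?N. \<epsilon> i * g p (X p) (E i p) * g p (E i p) (Y p)) =
      g p (\<lambda>h. \<Sum>i\<in>?N. \<epsilon> i * g p (X p) (E i p) * E i p h) (Y p)"
    by (rule metric_sum_left[OF p vector_fieldD[OF Y V(2)] T, symmetric])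
  also have "(\<lambda>h. \<Sum>i\<in>?N. \<epsilon> i * g p (X p) (E i p) * E i p h) = X p"
    using expand[OF X W(2)] by (intro ext) simp
  finally show ?thesis .
qed

context warped_quarter_symmetric
begin

text \<open>The factor by which \<open>curvature M Q dt (lift X) dt\<close> multiplies
  \<open>lift X\<close>. It is the same for all fibre directions, so the trace multiplies it by
  \<open>DIM('e)\<close>.\<close>

definition time_coeff :: "real \<Rightarrow> real" where
  "time_coeff t = deriv hubble t + (hubble t - lam1) * hubble t - (lam2 - lam1) * (hubble t - lam1)"

text \<open>The first line of terms is the share of the direction \<open>dt\<close> in the trace.
  The multiple of \<open>DIM('e) - 1\<close> is what the constant-curvature correction along the
  slice contributes.\<close>

definition fibre_coeff :: "real \<Rightarrow> real" where
  "fibre_coeff t = deriv hubble t + (hubble t - lam2) * hubble t + (lam2 - lam1) * (hubble t - lam2)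
    + (real DIM('e) - 1) * (hubble t - lam1) * (hubble t - lam2)"

definition inv_f :: "real \<Rightarrow> real" where "inv_f t = f t powr (-1)"

text \<open>Index 0 is \<open>dt\<close>, whose sign is \<open>-1\<close>. The fibre frame is
  shifted by one and rescaled, since a lift has \<open>f^2\<close> times the norm of its fibre
  vector.\<close>

definition product_frame :: "(nat \<Rightarrow> 'a vfield) \<Rightarrow> nat \<Rightarrow> (real \<times> 'a) vfield" where
  "product_frame E k = (case k of 0 \<Rightarrow> dt | Suc k \<Rightarrow> (\<lambda>q h. inv_f (fst q) * lift (E k) q h))"

lemma product_frame_simps:
  "product_frame E 0 = dt"
  "product_frame E (Suc k) = (\<lambda>q h. inv_f (fst q) * lift (E k) q h)"
  by (simp_all add: product_frame_def)

lemma smooth_inv_f: "smooth_on I inv_f"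
  unfolding inv_f_def by (rule smooth_on_powr[OF open_interval smooth_f f_pos])

lemma inv_f: "t \<in> I \<Longrightarrow> inv_f t = 1 / f t"
  using f_pos by (simp add: inv_f_def powr_minus_divide less_imp_le)

lemma orthonormal_product_frame:
  assumes U: "open_part F U" and E: "orthonormal_frame F gF U \<epsilon> E"
  shows "orthonormal_frame M g (I \<times> U) (case_nat (-1) \<epsilon>) (product_frame E)"
  unfolding orthonormal_frame_def
proof (intro conjI allI impI ballI)
  note MU = open_part_product[OF U]
  have E': "vector_field F U (E k)" "\<epsilon> k = 1 \<or> \<epsilon> k = -1" if "k < DIM('e)" for k
    using E that by (auto simp: orthonormal_frame_def)
  fix k assume k: "k < DIM(real \<times> 'e)"
  show "case_nat (-1) \<epsilon> k = 1 \<or> case_nat (-1) \<epsilon> k = -1"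
    using k E'(2) by (cases k) auto
  have oU: "open U" using U by (simp add: open_part_def)
  show "vector_field M (I \<times> U) (product_frame E k)"
  proof (cases k)
    case 0
    then show ?thesis by (simp add: product_frame_simps vector_field_dt[OF MU])
  next
    case (Suc j)
    have "vector_field M (I \<times> U) (lift (E j))"
      by (rule vector_field_lift[OF U E'(1)]) (use k Suc in simp)
    then show ?thesis
      unfolding Suc product_frame_simps
      by (rule M.vector_field_mult[OF MU smooth_function_fst[OF oU smooth_inv_f]])
  qed
next
  fix p i j assume p: "p \<in> I \<times> U" and ij: "i < DIM(real \<times> 'e)" "j < DIM(real \<times> 'e)"
  obtain t x where tx: "p = (t, x)" "t \<in> I" "x \<in> U" using p by auto
  have xF: "x \<in> points F" using product_point[OF U] tx by auto
  have T: "E k x \<in> tangent_space F x" if "k < DIM('e)" for k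
    by (rule vector_fieldD[OF _ tx(3)]) (use E that in \<open>auto simp: orthonormal_frame_def\<close>)
  have on: "gF x (E i x) (E j x) = (if i = j then \<epsilon> i else 0)" if "i < DIM('e)" "j < DIM('e)" for i j
    using E that tx(3) by (auto simp: orthonormal_frame_def)
  have dT: "dt (t, x) \<in> tangent_space M (t, x)" by (rule del_t_in_tangent_space[OF tx(2) xF])
  have lT: "lv t x (E k x) \<in> tangent_space M (t, x)" if "k < DIM('e)" for k
    by (rule lift_vector_in_tangent_space[OF tx(2) xF T[OF that]])
  have pM: "(t, x) \<in> points M" using tx xF by (simp add: points_product)
  have f0: "f t \<noteq> 0" using f_pos[OF tx(2)] by simp
  note cl = M.metric_cmult_left[OF pM] and cr = M.metric_cmult_right[OF pM]
  show "g p (product_frame E i p) (product_frame E j p) = (if i = j then case_nat (-1) \<epsilon> i else 0)"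
  proof (cases i)
    case i: 0
    show ?thesis
    proof (cases j)
      case 0
      then show ?thesis
        using i by (simp add: tx(1) product_frame_simps warped_metric_dt_dt[OF tx(2) xF])
    next
      case (Suc m)
      then have m: "m < DIM('e)" using ij by simp
      show ?thesis
        using cr[OF lT[OF m] lT[OF m] dT] warped_metric_dt_lift[OF tx(2) xF T[OF m]]
        by (simp add: i Suc tx(1) product_frame_simps lift_apply)
    qed
  next
    case i: (Suc n)
    then have n: "n < DIM('e)" using ij by simp
    show ?thesis
    proof (cases j)
      case 0
      then show ?thesis
        using cl[OF lT[OF n] lT[OF n] dT] warped_metric_lift_dt[OF tx(2) xF T[OF n]]
        by (simp add: i tx(1) product_frame_simps lift_apply)
    next
      case (Suc m)
      then have m: "m < DIM('e)" using ij by simp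
      have "g p (product_frame E i p) (product_frame E j p) =
          inv_f t * (inv_f t * ((f t)\<^sup>2 * gF x (E n x) (E m x)))"
        using cl[OF lT[OF n] lT[OF n] M.tangent_space_cmult[OF pM lT[OF m]]] cr[OF lT[OF m] lT[OF m] lT[OF n]]
          warped_metric_lift_lift[OF tx(2) xF T[OF n] T[OF m]]
        by (simp add: i Suc tx(1) product_frame_simps lift_apply)
      then show ?thesis
        using on[OF n m] f0 by (simp add: i Suc inv_f[OF tx(2)] power2_eq_square)
    qed
  qed
qed

text \<open>In each fibre term the factor \<open>1 / f\<close> occurs twice, inside the curvature by
  tensoriality and in the pairing; the sign of \<open>dt\<close> gives the subtraction. What remains
  involves plain lifts, on which the curvature is known.\<close>

lemma ricci_warped:
  assumes U: "open_part F U" and E: "orthonormal_frame F gF U \<epsilon> E" and p: "(t, x) \<in> I \<times> U"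
    and X: "vector_field M (I \<times> U) X" and Y: "vector_field M (I \<times> U) Y"
  shows "ricci M g Q X Y (t, x) =
    (\<Sum>k<DIM('e). \<epsilon> k * g (t, x) (curvature M Q X (lift (E k)) Y (t, x)) (lift (E k) (t, x))) / (f t)\<^sup>2
    - g (t, x) (curvature M Q X dt Y (t, x)) (dt (t, x))"
proof -
  note MU = open_part_product[OF U]
  have t: "t \<in> I" using p by simp
  have oU: "open U" using U by (simp add: open_part_def)
  have pM: "(t, x) \<in> points M" by (rule M.open_part_points[OF MU p])
  have L: "vector_field M (I \<times> U) (lift (E k))" if "k < DIM('e)" for k
    by (rule vector_field_lift[OF U]) (use E that in \<open>auto simp: orthonormal_frame_def\<close>)
  note r = smooth_function_fst[OF oU smooth_inv_f]
  let ?r = "inv_f t"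
  have 1: "g (t, x) (curvature M Q X (product_frame E (Suc k)) Y (t, x)) (product_frame E (Suc k) (t, x)) =
      g (t, x) (curvature M Q X (lift (E k)) Y (t, x)) (lift (E k) (t, x)) / (f t)\<^sup>2"
    if k: "k < DIM('e)" for k
  proof -
    note lT = vector_fieldD[OF L[OF k] p] and cT = vector_fieldD[OF Q.vector_field_curvature[OF MU X L[OF k] Y] p]
    have "g (t, x) (curvature M Q X (product_frame E (Suc k)) Y (t, x)) (product_frame E (Suc k) (t, x)) =
       ?r * g (t, x) (curvature M Q X (lift (E k)) Y (t, x)) (\<lambda>h. ?r * lift (E k) (t, x) h)"
      unfolding product_frame_simps
      using M.tensorial_at_mult[OF Q.curvature_tensorial_2[OF MU p X Y M.tangent_space_cmult[OF pM lT]] MU p L[OF k] r]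
      by simp
    also have "\<dots> = ?r * (?r * g (t, x) (curvature M Q X (lift (E k)) Y (t, x)) (lift (E k) (t, x)))"
      using M.metric_cmult_right[OF pM lT lT cT] by simp
    finally show ?thesis
      by (simp add: inv_f[OF t] power2_eq_square)
  qed
  have "DIM(real \<times> 'e) = Suc DIM('e)" by simp
  then have "ricci M g Q X Y (t, x) = (\<Sum>k<Suc DIM('e). case_nat (-1) \<epsilon> k *
      g (t, x) (curvature M Q X (product_frame E k) Y (t, x)) (product_frame E k (t, x)))"
    using Q.ricci_frame[OF MU p orthonormal_product_frame[OF U E] MU p X Y] by simp
  also have "\<dots> = - g (t, x) (curvature M Q X dt Y (t, x)) (dt (t, x)) +
      (\<Sum>k<DIM('e). \<epsilon> k * (g (t, x) (curvature M Q X (lift (E k)) Y (t, x)) (lift (E k) (t, x)) / (f t)\<^sup>2))"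
    unfolding sum.lessThan_Suc_shift using 1 by (simp add: product_frame_simps)
  finally show ?thesis
    by (simp add: sum_divide_distrib)
qed

lemma
  assumes U: "open_part F U" and E: "orthonormal_frame F gF U \<epsilon> E" and p: "(t, x) \<in> I \<times> U"
  shows ricci_dt_dt: "ricci M g Q dt dt (t, x) = real DIM('e) * time_coeff t"
    and ricci_dt_lift: "vector_field F U Y \<Longrightarrow> ricci M g Q dt (lift Y) (t, x) = 0"
    and ricci_lift_dt: "vector_field F U X \<Longrightarrow> ricci M g Q (lift X) dt (t, x) = 0"
    and ricci_lift_lift: "vector_field F U X \<Longrightarrow> vector_field F U Y \<Longrightarrow>
      ricci M g Q (lift X) (lift Y) (t, x) = ricci F gF nablaF X Y x - fibre_coeff t * (f t)\<^sup>2 * gF x (X x) (Y x)"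
proof -
  let ?N = "{..<DIM('e)}"
  note MU = open_part_product[OF U]
  note D = vector_field_dt[OF MU] and L = vector_field_lift[OF U]
  have t: "t \<in> I" and x: "x \<in> U" and xF: "x \<in> points F"
    using product_point[OF U p] by auto
  have pM: "(t, x) \<in> points M" by (rule M.open_part_points[OF MU p])
  have f0: "f t \<noteq> 0" using f_pos[OF t] by simp
  have EU: "vector_field F U (E k)" and \<epsilon>: "\<epsilon> k * \<epsilon> k = 1" and on: "gF x (E k x) (E k x) = \<epsilon> k" if "k \<in> ?N" for k
    using E that x by (auto simp: orthonormal_frame_def)
  have dT: "dt (t, x) \<in> tangent_space M (t, x)" by (rule del_t_in_tangent_space[OF t xF])
  have V: "Z x \<in> tangent_space F x" if "vector_field F U Z" for Z
    by (rule vector_fieldD[OF that x])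
  have lT: "lift Z (t, x) \<in> tangent_space M (t, x)" if "vector_field F U Z" for Z
    by (rule vector_fieldD[OF L[OF that] p])
  have ll: "g (t, x) (lift Z (t, x)) (lift W (t, x)) = (f t)\<^sup>2 * gF x (Z x) (W x)"
    if "vector_field F U Z" "vector_field F U W" for Z W
    unfolding lift_apply by (rule warped_metric_lift_lift[OF t xF V[OF that(1)] V[OF that(2)]])
  have dl: "g (t, x) (dt (t, x)) (lift Z (t, x)) = 0" "g (t, x) (lift Z (t, x)) (dt (t, x)) = 0"
    if "vector_field F U Z" for Z
    unfolding lift_apply
    using warped_metric_dt_lift[OF t xF V[OF that]] warped_metric_lift_dt[OF t xF V[OF that]] .
  have dtdt: "curvature M Q dt dt Z (t, x) = (\<lambda>h. 0)" if "vector_field M (I \<times> U) Z" for Z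
  proof
    fix h show "curvature M Q dt dt Z (t, x) h = 0"
      using Q.curvature_antisym[OF MU p D D that, of h] by simp
  qed
  have zero: "g (t, x) (\<lambda>h. 0) w = 0" if "w \<in> tangent_space M (t, x)" for w
    by (rule M.metric_zero_left[OF pM that])
  note cl = M.metric_cmult_left[OF pM]
  have c1: "curvature M Q dt (lift Z) dt (t, x) = (\<lambda>h. time_coeff t * lift Z (t, x) h)"
    if "vector_field F U Z" for Z
    using curvature_dt_lift_dt[OF U p that] by (intro ext) (simp add: time_coeff_def)
  \<comment> \<open>The share of the direction \<open>dt\<close> in
    \<open>fibre_coeff\<close>.\<close>
  define k where "k = deriv hubble t + (hubble t - lam2) * hubble t + (lam2 - lam1) * (hubble t - lam2)"
  have c2: "curvature M Q dt (lift Z) (lift W) (t, x) = (\<lambda>h. k * (f t)\<^sup>2 * gF x (Z x) (W x) * dt (t, x) h)"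
    if "vector_field F U Z" "vector_field F U W" for Z W
    using curvature_dt_lift_lift[OF U p that] by (intro ext) (simp add: k_def)
  show "ricci M g Q dt dt (t, x) = real DIM('e) * time_coeff t"
  proof -
    have "\<epsilon> k * g (t, x) (curvature M Q dt (lift (E k)) dt (t, x)) (lift (E k) (t, x)) = time_coeff t * (f t)\<^sup>2"
      if "k \<in> ?N" for k
      using cl[OF lT lT lT, OF EU EU EU, OF that that that, of "time_coeff t"] c1[OF EU[OF that]] ll[OF EU EU, OF that that] on[OF that] \<epsilon>[OF that]
      by (simp add: algebra_simps)
    then have "(\<Sum>k\<in>?N. \<epsilon> k * g (t, x) (curvature M Q dt (lift (E k)) dt (t, x)) (lift (E k) (t, x))) =
        (\<Sum>k\<in>?N. time_coeff t * (f t)\<^sup>2)"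
      by (rule sum.cong[OF refl])
    then show ?thesis
      unfolding ricci_warped[OF U E p D D] using dtdt[OF D] zero[OF dT] f0 by simp
  qed
  show "ricci M g Q dt (lift Y) (t, x) = 0" if Y: "vector_field F U Y" for Y
  proof -
    have "g (t, x) (curvature M Q dt (lift (E k)) (lift Y) (t, x)) (lift (E k) (t, x)) = 0" if "k \<in> ?N" for k
      unfolding c2[OF EU[OF that] Y] using cl[OF dT dT lT[OF EU[OF that]]] dl(1)[OF EU[OF that]] by simp
    then show ?thesis
      unfolding ricci_warped[OF U E p D L[OF Y]] using dtdt[OF L[OF Y]] zero[OF dT] by simp
  qed
  show "ricci M g Q (lift X) dt (t, x) = 0" if X: "vector_field F U X" for X
  proof -
    have 1: "curvature M Q (lift X) (lift (E k)) dt (t, x) = (\<lambda>h. 0)" if "k \<in> ?N" for k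
      using curvature_lift_lift_dt[OF U p X EU[OF that]] by (intro ext)
    have "g (t, x) (curvature M Q (lift X) (lift (E k)) dt (t, x)) (lift (E k) (t, x)) = 0" if "k \<in> ?N" for k
      unfolding 1[OF that] by (rule zero[OF lT[OF EU[OF that]]])
    moreover have "curvature M Q (lift X) dt dt (t, x) = (\<lambda>h. (- time_coeff t) * lift X (t, x) h)"
      using Q.curvature_antisym[OF MU p L[OF X] D D] c1[OF X] by (intro ext) simp
    moreover have "g (t, x) (\<lambda>h. (- time_coeff t) * lift X (t, x) h) (dt (t, x)) = 0"
      using cl[OF lT[OF X] lT[OF X] dT, of "- time_coeff t"] dl(2)[OF X] by simp
    ultimately show ?thesis
      unfolding ricci_warped[OF U E p L[OF X] D] by simp
  qed
  show "ricci M g Q (lift X) (lift Y) (t, x) = ricci F gF nablaF X Y x - fibre_coeff t * (f t)\<^sup>2 * gF x (X x) (Y x)"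
    if X: "vector_field F U X" and Y: "vector_field F U Y" for X Y
  proof -
    let ?G = "gF x (X x) (Y x)"
    define b where "b = (hubble t - lam1) * (hubble t - lam2)"
    have "curvature M Q (lift X) dt (lift Y) (t, x) = (\<lambda>h. (- k * (f t)\<^sup>2 * ?G) * dt (t, x) h)"
      using Q.curvature_antisym[OF MU p L[OF X] D L[OF Y]] c2[OF X Y] by (intro ext) simp
    then have 1: "g (t, x) (curvature M Q (lift X) dt (lift Y) (t, x)) (dt (t, x)) = k * (f t)\<^sup>2 * ?G"
      using cl[OF dT dT dT, of "- k * (f t)\<^sup>2 * ?G"] warped_metric_dt_dt[OF t xF] by simp
    have 2: "\<epsilon> j * g (t, x) (curvature M Q (lift X) (lift (E j)) (lift Y) (t, x)) (lift (E j) (t, x)) / (f t)\<^sup>2 =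
        \<epsilon> j * gF x (curvature F nablaF X (E j) Y x) (E j x) +
        b * (f t)\<^sup>2 * (\<epsilon> j * gF x (X x) (E j x) * gF x (E j x) (Y x) - ?G)"
      if j: "j \<in> ?N" for j
    proof -
      note Ej = EU[OF j]
      note C = F.vector_field_curvature[OF U X Ej Y]
      let ?s = "b * (f t)\<^sup>2 * gF x (E j x) (Y x)" and ?r = "- (b * (f t)\<^sup>2 * ?G)"
      have "curvature M Q (lift X) (lift (E j)) (lift Y) (t, x) =
         (\<lambda>h. lift (curvature F nablaF X (E j) Y) (t, x) h + (?s * lift X (t, x) h + ?r * lift (E j) (t, x) h))"
        using curvature_lift_lift_lift[OF U p X Ej Y] by (intro ext) (simp add: b_def algebra_simps)
      moreover have "g (t, x) (\<lambda>h. lift (curvature F nablaF X (E j) Y) (t, x) h + (?s * lift X (t, x) h + ?r * lift (E j) (t, x) h)) (lift (E j) (t, x))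
          = g (t, x) (lift (curvature F nablaF X (E j) Y) (t, x)) (lift (E j) (t, x)) +
            (?s * g (t, x) (lift X (t, x)) (lift (E j) (t, x)) + ?r * g (t, x) (lift (E j) (t, x)) (lift (E j) (t, x)))"
        unfolding M.metric_lincomb[OF pM lT[OF X] lT[OF Ej] lT[OF Ej], symmetric]
        by (rule M.metric_add_left[OF pM lT[OF C] M.tangent_space_add[OF pM M.tangent_space_cmult[OF pM lT[OF X]] M.tangent_space_cmult[OF pM lT[OF Ej]]] lT[OF Ej]])
      ultimately have v: "g (t, x) (curvature M Q (lift X) (lift (E j)) (lift Y) (t, x)) (lift (E j) (t, x)) =
          (f t)\<^sup>2 * (gF x (curvature F nablaF X (E j) Y x) (E j x) + ?s * gF x (X x) (E j x) + ?r * \<epsilon> j)"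
        using ll[OF C Ej] ll[OF X Ej] ll[OF Ej Ej] on[OF j] by (simp add: algebra_simps)
      \<comment> \<open>Division by \<open>f^2\<close> removes the common factor; the last summand
        carries the sign \<open>e\<close> a second time, and the square \<open>e * e\<close> will be
        1.\<close>
      have cancel: "e * (c * (a + b + r * e)) / c = e * (a + b) + r * (e * e)" if "c \<noteq> 0" for a b c e r :: real
        using that by (simp add: field_simps)
      have "\<epsilon> j * g (t, x) (curvature M Q (lift X) (lift (E j)) (lift Y) (t, x)) (lift (E j) (t, x)) / (f t)\<^sup>2 =
        \<epsilon> j * (gF x (curvature F nablaF X (E j) Y x) (E j x) + ?s * gF x (X x) (E j x)) + ?r * (\<epsilon> j * \<epsilon> j)"
        unfolding v by (rule cancel) (use f0 in simp)
      then show ?thesis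
        unfolding \<epsilon>[OF j] by (simp add: algebra_simps)
    qed
    \<comment> \<open>Expanding \<open>X\<close> in the frame collapses the sum of products to
      \<open>?G\<close>. Against it stand \<open>DIM('e)\<close> copies of \<open>- ?G\<close>,
      whence the factor \<open>1 - DIM('e)\<close>.\<close>
    have "?G = gF x (\<lambda>h. \<Sum>j\<in>?N. \<epsilon> j * gF x (X x) (E j x) * E j x h) (Y x)"
      using F.orthonormal_frame_expand[OF E U x V[OF X]] by metis
    also have "\<dots> = (\<Sum>j\<in>?N. \<epsilon> j * gF x (X x) (E j x) * gF x (E j x) (Y x))"
      by (rule F.metric_sum_left[OF xF V[OF Y] V[OF EU]])
    finally have 3: "(\<Sum>j\<in>?N. \<epsilon> j * gF x (X x) (E j x) * gF x (E j x) (Y x)) = ?G" ..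
    have "(\<Sum>j\<in>?N. \<epsilon> j * g (t, x) (curvature M Q (lift X) (lift (E j)) (lift Y) (t, x)) (lift (E j) (t, x))) / (f t)\<^sup>2 =
       (\<Sum>j\<in>?N. \<epsilon> j * gF x (curvature F nablaF X (E j) Y x) (E j x) +
        b * (f t)\<^sup>2 * (\<epsilon> j * gF x (X x) (E j x) * gF x (E j x) (Y x) - ?G))"
      unfolding sum_divide_distrib by (rule sum.cong[OF refl 2])
    also have "\<dots> = ricci F gF nablaF X Y x + b * (f t)\<^sup>2 * (?G - real DIM('e) * ?G)"
      using 3 F.ricci_frame[OF U x E U x X Y]
      by (simp add: sum.distrib sum_subtractf sum_distrib_left[symmetric])
    finally show ?thesis
      unfolding ricci_warped[OF U E p L[OF X] L[OF Y]] 1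
      by (simp add: fibre_coeff_def k_def b_def algebra_simps)
  qed
qed

text \<open>The mixed components vanish on both sides, so two conditions remain. For each
  \<open>t\<close> the second makes the Ricci tensor of the fibre a multiple of \<open>gF\<close>;
  as the fibre does not know \<open>t\<close>, the multiple is the same for all
  \<open>t\<close>.\<close>

lemma einstein_warped_iff:
  "einstein M g Q \<alpha> \<longleftrightarrow> (\<exists>\<alpha>F. einstein F gF nablaF \<alpha>F \<and>
    (\<forall>t\<in>I. real DIM('e) * time_coeff t = - \<alpha> \<and> \<alpha>F = (f t)\<^sup>2 * (\<alpha> + fibre_coeff t)))"
proof
  assume ein: "einstein M g Q \<alpha>"
  have eq: "ricci M g Q X Y p = \<alpha> * g p (X p) (Y p)"
    if "open_part M U" "vector_field M U X" "vector_field M U Y" "p \<in> U" for U X Y p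
    using ein that unfolding einstein_def by blast
  have fibre: "ricci F gF nablaF X Y x = (f t)\<^sup>2 * (\<alpha> + fibre_coeff t) * gF x (X x) (Y x)"
    if t: "t \<in> I" and U: "open_part F U" "x \<in> U" and X: "vector_field F U X" and Y: "vector_field F U Y" for t U x X Y
  proof -
    have xF: "x \<in> points F" by (rule F.open_part_points[OF U])
    obtain V \<epsilon> E where V: "open_part F V" "x \<in> V" "orthonormal_frame F gF V \<epsilon> E"
      using F.orthonormal_frame_exists[OF xF] .
    let ?W = "U \<inter> V"
    have W: "open_part F ?W" "x \<in> ?W" using open_part_Int[OF U(1) V(1)] U(2) V(2) by auto
    have E: "orthonormal_frame F gF ?W \<epsilon> E"
      using V(3) unfolding orthonormal_frame_def by (auto intro: vector_field_subset)
    have XW: "vector_field F ?W X" and YW: "vector_field F ?W Y"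
      using X Y by (auto intro: vector_field_subset)
    have p: "(t, x) \<in> I \<times> ?W" using t W by simp
    note TX = vector_fieldD[OF X U(2)] and TY = vector_fieldD[OF Y U(2)]
    have "ricci F gF nablaF X Y x - fibre_coeff t * (f t)\<^sup>2 * gF x (X x) (Y x) = \<alpha> * ((f t)\<^sup>2 * gF x (X x) (Y x))"
      using eq[OF open_part_product[OF W(1)] vector_field_lift[OF W(1) XW] vector_field_lift[OF W(1) YW] p]
        ricci_lift_lift[OF W(1) E p XW YW] warped_metric_lift_lift[OF t xF TX TY] by (simp add: lift_apply)
    then show ?thesis by (simp add: algebra_simps)
  qed
  obtain t0 where t0: "t0 \<in> I" using interval_nonempty by auto
  obtain x0 where x0: "x0 \<in> points F"
    using F.smooth_manifold by (auto simp: smooth_manifold_def)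
  obtain U \<epsilon> E where U: "open_part F U" "x0 \<in> U" and E: "orthonormal_frame F gF U \<epsilon> E"
    using F.orthonormal_frame_exists[OF x0] .
  \<comment> \<open>A frame vector is not null, so the multiple of \<open>gF\<close> can be read off
    from it; this yields independence of \<open>t\<close>.\<close>
  have "vector_field F U (E 0)" "\<epsilon> 0 = 1 \<or> \<epsilon> 0 = -1" "gF x0 (E 0 x0) (E 0 x0) = \<epsilon> 0"
    using E U(2) DIM_positive[where 'a='e] unfolding orthonormal_frame_def by auto
  then have E0: "vector_field F U (E 0)" "gF x0 (E 0 x0) (E 0 x0) \<noteq> 0"
    by auto
  show "\<exists>\<alpha>F. einstein F gF nablaF \<alpha>F \<and>
    (\<forall>t\<in>I. real DIM('e) * time_coeff t = - \<alpha> \<and> \<alpha>F = (f t)\<^sup>2 * (\<alpha> + fibre_coeff t))"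
  proof (intro exI[of _ "(f t0)\<^sup>2 * (\<alpha> + fibre_coeff t0)"] conjI ballI)
    show "einstein F gF nablaF ((f t0)\<^sup>2 * (\<alpha> + fibre_coeff t0))"
      unfolding einstein_def using fibre[OF t0] by blast
    fix t assume t: "t \<in> I"
    have p: "(t, x0) \<in> I \<times> U" using t U by simp
    note D = vector_field_dt[OF open_part_product[OF U(1)]]
    show "real DIM('e) * time_coeff t = - \<alpha>"
      using eq[OF open_part_product[OF U(1)] D D p] ricci_dt_dt[OF U(1) E p] warped_metric_dt_dt[OF t x0] by simp
    show "(f t0)\<^sup>2 * (\<alpha> + fibre_coeff t0) = (f t)\<^sup>2 * (\<alpha> + fibre_coeff t)"
      using fibre[OF t0 U E0(1) E0(1)] fibre[OF t U E0(1) E0(1)] E0(2) by simp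
  qed
next
  assume "\<exists>\<alpha>F. einstein F gF nablaF \<alpha>F \<and>
    (\<forall>t\<in>I. real DIM('e) * time_coeff t = - \<alpha> \<and> \<alpha>F = (f t)\<^sup>2 * (\<alpha> + fibre_coeff t))"
  then obtain \<alpha>F where ein: "einstein F gF nablaF \<alpha>F"
    and A: "\<And>t. t \<in> I \<Longrightarrow> real DIM('e) * time_coeff t = - \<alpha>"
    and B: "\<And>t. t \<in> I \<Longrightarrow> \<alpha>F = (f t)\<^sup>2 * (\<alpha> + fibre_coeff t)" by blast
  show "einstein M g Q \<alpha>"
    unfolding einstein_def
  proof (intro allI impI ballI, elim conjE)
    fix U X Y p
    assume U: "open_part M U" and X: "vector_field M U X" and Y: "vector_field M U Y" and p: "p \<in> U"
    have "p \<in> I \<times> points F"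
      using M.open_part_points[OF U p] by (simp add: points_product)
    then obtain t x where tx: "p = (t, x)" "t \<in> I" "x \<in> points F" by auto
    obtain V \<epsilon> E where V: "open_part F V" "x \<in> V" and E: "orthonormal_frame F gF V \<epsilon> E"
      using F.orthonormal_frame_exists[OF tx(3)] .
    note MV = open_part_product[OF V(1)]
    have pV: "(t, x) \<in> I \<times> V" using tx V by simp
    have oV: "open V" using V(1) by (simp add: open_part_def)
    have EV: "vector_field F V (E k)" if "k < DIM('e)" for k
      using E that by (auto simp: orthonormal_frame_def)
    note L = vector_field_lift[OF V(1) EV] and D = vector_field_dt[OF MV]
      and r = smooth_function_fst[OF oV smooth_inv_f]
    note lT = vector_fieldD[OF L pV]
    have dT: "dt (t, x) \<in> tangent_space M (t, x)" by (rule del_t_in_tangent_space[OF tx(2,3)])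
    have pM: "(t, x) \<in> points M" by (rule M.open_part_points[OF MV pV])
    have T: "E k x \<in> tangent_space F x" if "k < DIM('e)" for k
      by (rule vector_fieldD[OF EV[OF that] V(2)])
    have basic: "ricci M g Q dt dt (t, x) = \<alpha> * g (t, x) (dt (t, x)) (dt (t, x))"
      "ricci M g Q dt (lift (E k)) (t, x) = \<alpha> * g (t, x) (dt (t, x)) (lift (E k) (t, x))"
      "ricci M g Q (lift (E k)) dt (t, x) = \<alpha> * g (t, x) (lift (E k) (t, x)) (dt (t, x))"
      "ricci M g Q (lift (E k)) (lift (E m)) (t, x) = \<alpha> * g (t, x) (lift (E k) (t, x)) (lift (E m) (t, x))"
      if k: "k < DIM('e)" and m: "m < DIM('e)" for k m
    proof -
      show "ricci M g Q dt dt (t, x) = \<alpha> * g (t, x) (dt (t, x)) (dt (t, x))"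
        using ricci_dt_dt[OF V(1) E pV] A[OF tx(2)] warped_metric_dt_dt[OF tx(2,3)] by simp
      show "ricci M g Q dt (lift (E k)) (t, x) = \<alpha> * g (t, x) (dt (t, x)) (lift (E k) (t, x))"
        using ricci_dt_lift[OF V(1) E pV EV[OF k]] warped_metric_dt_lift[OF tx(2,3) T[OF k]] by (simp add: lift_apply)
      show "ricci M g Q (lift (E k)) dt (t, x) = \<alpha> * g (t, x) (lift (E k) (t, x)) (dt (t, x))"
        using ricci_lift_dt[OF V(1) E pV EV[OF k]] warped_metric_lift_dt[OF tx(2,3) T[OF k]] by (simp add: lift_apply)
      have "ricci F gF nablaF (E k) (E m) x = \<alpha>F * gF x (E k x) (E m x)"
        using ein V EV[OF k] EV[OF m] unfolding einstein_def by blast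
      then show "ricci M g Q (lift (E k)) (lift (E m)) (t, x) = \<alpha> * g (t, x) (lift (E k) (t, x)) (lift (E m) (t, x))"
        using ricci_lift_lift[OF V(1) E pV EV[OF k] EV[OF m]] B[OF tx(2)] warped_metric_lift_lift[OF tx(2,3) T[OF k] T[OF m]]
        by (simp add: lift_apply algebra_simps)
    qed
    \<comment> \<open>\<open>basic\<close> asks for two fibre indices even where only one or none
      occurs; index 0 fills the gap.\<close>
    have F0: "0 < DIM('e)" by simp
    have PF: "vector_field M (I \<times> V) (product_frame E i)" if "i < DIM(real \<times> 'e)" for i
      using orthonormal_product_frame[OF V(1) E] that by (auto simp: orthonormal_frame_def)
    note PT = vector_fieldD[OF PF pV]
    have r1: "ricci M g Q (product_frame E (Suc k)) Z (t, x) = inv_f t * ricci M g Q (lift (E k)) Z (t, x)"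
      if "k < DIM('e)" "vector_field M (I \<times> V) Z" for k Z
      unfolding product_frame_simps
      using M.tensorial_at_mult[OF Q.ricci_tensorial_1[OF MV pV that(2)] MV pV L[OF that(1)] r] by simp
    have r2: "ricci M g Q Z (product_frame E (Suc k)) (t, x) = inv_f t * ricci M g Q Z (lift (E k)) (t, x)"
      if "k < DIM('e)" "vector_field M (I \<times> V) Z" for k Z
      unfolding product_frame_simps
      using M.tensorial_at_mult[OF Q.ricci_tensorial_2[OF MV pV that(2)] MV pV L[OF that(1)] r] by simp
    have g1: "g (t, x) (product_frame E (Suc k) (t, x)) w = inv_f t * g (t, x) (lift (E k) (t, x)) w"
      if "k < DIM('e)" "w \<in> tangent_space M (t, x)" for k w
      unfolding product_frame_simps using M.metric_cmult_left[OF pM lT[OF that(1)] lT[OF that(1)] that(2)] by simp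
    have g2: "g (t, x) w (product_frame E (Suc k) (t, x)) = inv_f t * g (t, x) w (lift (E k) (t, x))"
      if "k < DIM('e)" "w \<in> tangent_space M (t, x)" for k w
      unfolding product_frame_simps using M.metric_cmult_right[OF pM lT[OF that(1)] lT[OF that(1)] that(2)] by simp
    \<comment> \<open>Trades a frame field in the first argument for \<open>dt\<close> or a lift;
      the factor \<open>inv_f t\<close> appears on both sides.\<close>
    have left: "ricci M g Q (product_frame E i) Z (t, x) = \<alpha> * g (t, x) (product_frame E i (t, x)) (Z (t, x))"
      if i: "i < DIM(real \<times> 'e)" and Z: "vector_field M (I \<times> V) Z"
        and "ricci M g Q dt Z (t, x) = \<alpha> * g (t, x) (dt (t, x)) (Z (t, x))"
        and "\<And>k. k < DIM('e) \<Longrightarrow> ricci M g Q (lift (E k)) Z (t, x) = \<alpha> * g (t, x) (lift (E k) (t, x)) (Z (t, x))" for i Z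
    proof (cases i)
      case 0
      then show ?thesis using that(3) by (simp add: product_frame_simps)
    next
      case (Suc k)
      then have k: "k < DIM('e)" using i by simp
      show ?thesis
        unfolding Suc r1[OF k Z] g1[OF k vector_fieldD[OF Z pV]] that(4)[OF k] by simp
    qed
    show "ricci M g Q X Y p = \<alpha> * g p (X p) (Y p)"
      unfolding tx(1)
    proof (rule Q.ricci_eq_metric_if_frame[OF MV pV orthonormal_product_frame[OF V(1) E] U p[unfolded tx(1)] X Y])
      fix i j assume i: "i < DIM(real \<times> 'e)" and j: "j < DIM(real \<times> 'e)"
      show "ricci M g Q (product_frame E i) (product_frame E j) (t, x) =
          \<alpha> * g (t, x) (product_frame E i (t, x)) (product_frame E j (t, x))"
      proof (rule left[OF i PF[OF j]])
        show "ricci M g Q dt (product_frame E j) (t, x) = \<alpha> * g (t, x) (dt (t, x)) (product_frame E j (t, x))"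
        proof (cases j)
          case 0
          then show ?thesis using basic(1)[OF F0 F0] by (simp add: product_frame_simps)
        next
          case (Suc k)
          then have k: "k < DIM('e)" using j by simp
          show ?thesis
            unfolding Suc r2[OF k D] g2[OF k dT] basic(2)[OF k F0] by simp
        qed
        fix m assume m: "m < DIM('e)"
        show "ricci M g Q (lift (E m)) (product_frame E j) (t, x) = \<alpha> * g (t, x) (lift (E m) (t, x)) (product_frame E j (t, x))"
        proof (cases j)
          case 0
          then show ?thesis using basic(3)[OF m F0] by (simp add: product_frame_simps)
        next
          case (Suc k)
          then have k: "k < DIM('e)" using j by simp
          show ?thesis
            unfolding Suc r2[OF k L[OF m]] g2[OF k lT[OF m]] basic(4)[OF m k] by simp
        qed
      qed
    qed
  qed
qed

end

section \<open>The warping equations\<close>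

text \<open>\<open>f1\<close> and \<open>f2\<close> stand for the first two derivatives of
  \<open>f\<close>, and \<open>l\<close> is a real number: the analysis is detached from the
  geometry.\<close>

locale warping_ode =
  fixes I :: "real set" and f f1 f2 :: "real \<Rightarrow> real" and l lam1 lam2 \<alpha> \<alpha>F :: real
  assumes open_I: "open I" and interval: "is_interval I" and nonempty: "I \<noteq> {}"
    and f1: "t \<in> I \<Longrightarrow> (f has_real_derivative f1 t) (at t)"
    and f2: "t \<in> I \<Longrightarrow> (f1 has_real_derivative f2 t) (at t)"
    and pos: "t \<in> I \<Longrightarrow> f t > 0" and l: "l > 1" and lam1: "lam1 \<noteq> 0" and lam2: "lam2 \<noteq> 0"
begin

text \<open>The condition \<open>l * time_coeff t = - \<alpha>\<close> multiplied by
  \<open>f t / l\<close>, which makes it linear in \<open>f\<close>.\<close>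

definition time_eq :: "real \<Rightarrow> bool" where
  "time_eq t \<longleftrightarrow> f2 t - lam2 * f1 t + lam1 * (lam2 - lam1) * f t = - (\<alpha> / l) * f t"

text \<open>The condition on \<open>\<alpha>F\<close> from \<open>einstein_warped_iff\<close> with
  the factor \<open>f^2\<close> multiplied out, which removes all quotients by
  \<open>f\<close>.\<close>

definition fibre_eq :: "real \<Rightarrow> bool" where
  "fibre_eq t \<longleftrightarrow> \<alpha>F = \<alpha> * (f t)\<^sup>2 + f t * f2 t + (l - 1) * (f1 t)\<^sup>2
     - (l * lam1 + (l - 1) * lam2) * f t * f1 t + (l * lam1 * lam2 - lam2\<^sup>2) * (f t)\<^sup>2"

text \<open>Lets an identity that holds on the open set \<open>I\<close> be differentiated.\<close>

lemma derivative_unique_on: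
  assumes "t \<in> I" "\<And>s. s \<in> I \<Longrightarrow> u s = v s"
    "(u has_real_derivative a) (at t)" "(v has_real_derivative b) (at t)"
  shows "a = b"
proof -
  have "(v has_real_derivative a) (at t)"
    by (rule has_field_derivative_transform_within_open[OF assms(3) open_I assms(1)]) (use assms(2) in auto)
  then show ?thesis
    using assms(4) DERIV_unique by blast
qed

lemma constant_on_interval:
  assumes "\<And>t. t \<in> I \<Longrightarrow> (u has_real_derivative 0) (at t)"
  obtains c where "\<And>t. t \<in> I \<Longrightarrow> u t = c"
proof -
  have "convex I"
    using interval by (simp add: is_interval_convex)
  then show thesis
    using has_field_derivative_zero_constant[of I u] assms has_field_derivative_at_within that by metis
qed

text \<open>Integrating factor: \<open>u t * exp (- k * t)\<close> has derivative 0 on the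
  interval.\<close>

lemma exponential_solution:
  assumes "\<And>t. t \<in> I \<Longrightarrow> (u has_real_derivative k * u t) (at t)"
  obtains c where "\<And>t. t \<in> I \<Longrightarrow> u t = c * exp (k * t)"
proof -
  have "((\<lambda>t. u t * exp (- k * t)) has_real_derivative 0) (at t)" if "t \<in> I" for t
    by (rule DERIV_cong[OF DERIV_mult[OF assms[OF that] DERIV_chain2[OF DERIV_exp DERIV_cmult[OF DERIV_ident]]]]) simp
  then obtain c where c: "\<And>t. t \<in> I \<Longrightarrow> u t * exp (- k * t) = c"
    using constant_on_interval[of "\<lambda>t. u t * exp (- k * t)"] by metis
  have "u t = c * exp (k * t)" if "t \<in> I" for t
    unfolding c[OF that, symmetric] by (simp add: mult.assoc exp_add[symmetric])
  then show thesis by (rule that)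
qed

lemma exponential_derivatives:
  assumes f: "\<forall>t\<in>I. f t = c * exp (k * t)" and t: "t \<in> I"
  shows "f1 t = k * f t" "f2 t = k\<^sup>2 * f t"
proof -
  have 1: "f1 t = k * f t" if "t \<in> I" for t
  proof (rule derivative_unique_on[OF that _ f1[OF that]])
    show "((\<lambda>t. c * exp (k * t)) has_real_derivative k * f t) (at t)"
      using f that by (auto intro!: derivative_eq_intros)
  qed (use f in simp)
  then show "f1 t = k * f t" using t by blast
  have "f2 t = k * f1 t"
    by (rule derivative_unique_on[OF t 1 f2[OF t] DERIV_cmult[OF f1[OF t]]])
  then show "f2 t = k\<^sup>2 * f t"
    using 1[OF t] by (simp add: power2_eq_square)
qed

text \<open>For an exponential the linear equation amounts to its characteristic equation, assumed
  here. Eliminating \<open>\<alpha>\<close> with it cancels the terms in \<open>k^2\<close> of the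
  fibre equation, so that the rate enters only linearly.\<close>

lemma exponential_equations:
  assumes f: "\<forall>t\<in>I. f t = c * exp (k * t)" and t: "t \<in> I"
    and k: "l * (k\<^sup>2 - lam2 * k + lam1 * (lam2 - lam1)) = - \<alpha>"
  shows "time_eq t" "fibre_eq t \<longleftrightarrow> \<alpha>F = (l * lam1\<^sup>2 - lam2\<^sup>2 - (l * lam1 - lam2) * k) * (f t)\<^sup>2"
proof -
  note e = exponential_derivatives[OF f t]
  have quotient: "\<alpha> / l = - (k\<^sup>2 - lam2 * k + lam1 * (lam2 - lam1))"
    using k l by (simp add: field_simps)
  show "time_eq t"
    unfolding time_eq_def e quotient by (simp add: algebra_simps)
  have a: "\<alpha> = - (l * (k\<^sup>2 - lam2 * k + lam1 * (lam2 - lam1)))"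
    using k by simp
  have "\<alpha> * (f t)\<^sup>2 + f t * f2 t + (l - 1) * (f1 t)\<^sup>2
     - (l * lam1 + (l - 1) * lam2) * f t * f1 t + (l * lam1 * lam2 - lam2\<^sup>2) * (f t)\<^sup>2 =
     (l * lam1\<^sup>2 - lam2\<^sup>2 - (l * lam1 - lam2) * k) * (f t)\<^sup>2"
    unfolding e a by (simp add: power2_eq_square) algebra
  then show "fibre_eq t \<longleftrightarrow> \<alpha>F = (l * lam1\<^sup>2 - lam2\<^sup>2 - (l * lam1 - lam2) * k) * (f t)\<^sup>2"
    unfolding fibre_eq_def by simp
qed

text \<open>With \<open>lam2 = l * lam1\<close> the expression equals
  \<open>2 * l * (l - 1) * lam1^2\<close>, which is nonzero. Hence the rate of case (3) still makes
  sense in case (4).\<close>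

lemma lam2_ne_if_special:
  assumes "lam2\<^sup>2 - 2 * l * lam1\<^sup>2 + l * lam1 * lam2 = 0"
  shows "lam2 \<noteq> l * lam1"
proof
  assume "lam2 = l * lam1"
  then have "l * (l - 1) * (lam1 * lam1) = 0"
    using assms by (simp add: power2_eq_square algebra_simps)
  then show False using l lam1 by simp
qed

text \<open>The condition of case (4) says precisely that the rate of case (3) is
  \<open>lam2 / 2\<close>, which as a root of the characteristic polynomial is a double one.\<close>

lemma special_exponent:
  assumes "lam2\<^sup>2 - 2 * l * lam1\<^sup>2 + l * lam1 * lam2 = 0"
  shows "(l * lam1\<^sup>2 - lam2\<^sup>2) / (l * lam1 - lam2) = lam2 / 2"
proof -
  have "2 * (l * lam1\<^sup>2 - lam2\<^sup>2) = lam2 * (l * lam1 - lam2)"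
    using assms by (simp add: power2_eq_square algebra_simps)
  then show ?thesis
    using lam2_ne_if_special[OF assms] by (simp add: field_simps)
qed

text \<open>Origin of the value of \<open>\<alpha>\<close> in case (3): the characteristic equation
  at the rate \<open>k\<close> that annihilates the fibre equation. Multiplication by
  \<open>d^2\<close> leaves \<open>k\<close> only in the product \<open>k * d\<close>, which is
  known.\<close>

lemma general_constant:
  assumes "lam2 \<noteq> l * lam1" and k: "k = (l * lam1\<^sup>2 - lam2\<^sup>2) / (l * lam1 - lam2)"
  shows "l * (k\<^sup>2 - lam2 * k + lam1 * (lam2 - lam1)) = - (((3 * l\<^sup>2 + l) * lam1\<^sup>2 * lam2\<^sup>2 - (l\<^sup>2 + l) * lam1 * lam2 ^ 3
                 - 2 * l\<^sup>2 * lam1 ^ 3 * lam2) / (l * lam1 - lam2)\<^sup>2)"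
proof -
  define d where "d = l * lam1 - lam2"
  have d: "d \<noteq> 0" using assms(1) by (simp add: d_def)
  have kd: "k * d = l * lam1\<^sup>2 - lam2\<^sup>2" using d by (simp add: k d_def)
  have "l * (k\<^sup>2 - lam2 * k + lam1 * (lam2 - lam1)) * d\<^sup>2 =
      l * ((k * d)\<^sup>2 - lam2 * (k * d) * d + lam1 * (lam2 - lam1) * d\<^sup>2)"
    by (simp add: power2_eq_square algebra_simps)
  also have "\<dots> = - ((3 * l\<^sup>2 + l) * lam1\<^sup>2 * lam2\<^sup>2 - (l\<^sup>2 + l) * lam1 * lam2 ^ 3
                 - 2 * l\<^sup>2 * lam1 ^ 3 * lam2)"
    unfolding kd by (simp add: d_def power2_eq_square power3_eq_cube algebra_simps)
  finally show ?thesis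
    using d by (simp add: d_def[symmetric] field_simps)
qed

lemma key_identity:
  assumes "\<forall>t\<in>I. time_eq t \<and> fibre_eq t" and t: "t \<in> I"
  shows "l * (lam2 - lam1) * (f1 t)\<^sup>2 + l * (lam1 - lam2) * (2 * lam1 + lam2) * f t * f1 t
    + (l * lam1 + (l - 2) * lam2) * (\<alpha> / l + lam1 * lam2 - lam1\<^sup>2) * (f t)\<^sup>2 = 0"
proof -
  have A: "time_eq t" and B: "fibre_eq t" if "t \<in> I" for t
    using assms(1) that by auto
  \<comment> \<open>Chosen so that the linear equation reads
    \<open>f2 t = lam2 * f1 t - \<beta> * f t\<close>. After differentiation the
    \<open>\<beta>\<close> terms with \<open>f t * f1 t\<close> cancel, so \<open>\<alpha>\<close>
    survives only in the coefficient of \<open>f^2\<close>.\<close>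
  define \<beta> where "\<beta> = \<alpha> / l + lam1 * lam2 - lam1\<^sup>2"
  have \<alpha>: "\<alpha> = l * (\<beta> - lam1 * lam2 + lam1\<^sup>2)"
    using l by (simp add: \<beta>_def field_simps)
  have f2': "f2 t = lam2 * f1 t - \<beta> * f t" if "t \<in> I" for t
    using A[OF that] by (simp add: time_eq_def \<beta>_def algebra_simps power2_eq_square)
  define b where "b = l * lam1 + (l - 2) * lam2"
  define \<gamma> where "\<gamma> = (l - 1) * \<beta> + l * lam1\<^sup>2 - lam2\<^sup>2"
  have B': "\<alpha>F = (l - 1) * (f1 t * f1 t) - b * (f t * f1 t) + \<gamma> * (f t * f t)" if "t \<in> I" for t
    using B[OF that, unfolded fibre_eq_def f2'[OF that], unfolded \<alpha>] unfolding b_def \<gamma>_def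
    by (simp add: power2_eq_square algebra_simps)
  have "0 = (l - 1) * (f2 t * f1 t + f2 t * f1 t) - b * (f1 t * f1 t + f2 t * f t) + \<gamma> * (f1 t * f t + f1 t * f t)"
  proof (rule derivative_unique_on[OF t B' DERIV_const])
    note f1' = f1[OF t] and f2' = f2[OF t]
    show "((\<lambda>t. (l - 1) * (f1 t * f1 t) - b * (f t * f1 t) + \<gamma> * (f t * f t)) has_real_derivative
      (l - 1) * (f2 t * f1 t + f2 t * f1 t) - b * (f1 t * f1 t + f2 t * f t) + \<gamma> * (f1 t * f t + f1 t * f t)) (at t)"
      by (intro DERIV_add DERIV_diff DERIV_cmult DERIV_mult f1' f2')
  qed
  then show ?thesis
    unfolding f2'[OF t] \<beta>_def[symmetric] b_def \<gamma>_def by (simp add: power2_eq_square algebra_simps)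
qed

lemma equations_iff_cases:
  "(\<forall>t\<in>I. time_eq t \<and> fibre_eq t) \<longleftrightarrow>
      ((\<exists>c2. \<alpha> = (lam1\<^sup>2 - lam1 * lam2) * l \<and> \<alpha>F = c2\<^sup>2 * (l * lam1\<^sup>2 - lam2\<^sup>2) \<and> (\<forall>t\<in>I. f t = c2)) \<or>
       (\<exists>c1 c2. lam1 = lam2 \<and> \<alpha> = 0 \<and> \<alpha>F = (l - 1) * c2\<^sup>2 * lam1\<^sup>2 \<and>
          (\<forall>t\<in>I. f t = c1 * exp (lam1 * t) + c2)) \<or>
       (\<exists>c0. lam2\<^sup>2 - 2 * l * lam1\<^sup>2 + l * lam1 * lam2 \<noteq> 0 \<and> lam2 \<noteq> l * lam1 \<and>
          \<alpha> = ((3 * l\<^sup>2 + l) * lam1\<^sup>2 * lam2\<^sup>2 - (l\<^sup>2 + l) * lam1 * lam2 ^ 3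
                 - 2 * l\<^sup>2 * lam1 ^ 3 * lam2) / (l * lam1 - lam2)\<^sup>2 \<and>
          \<alpha>F = 0 \<and>
          (\<forall>t\<in>I. f t = c0 * exp ((l * lam1\<^sup>2 - lam2\<^sup>2) * t / (l * lam1 - lam2)))) \<or>
       (\<exists>c1. lam2\<^sup>2 - 2 * l * lam1\<^sup>2 + l * lam1 * lam2 = 0 \<and>
          \<alpha> = l * (lam1 - lam2 / 2)\<^sup>2 \<and> \<alpha>F = 0 \<and>
          (\<forall>t\<in>I. f t = c1 * exp (lam2 / 2 * t))))"
  (is "?E \<longleftrightarrow> ?C1 \<or> ?C2 \<or> ?C3 \<or> ?C4")
proof
  assume E: ?E
  then have A: "\<And>t. t \<in> I \<Longrightarrow> time_eq t" and B: "\<And>t. t \<in> I \<Longrightarrow> fibre_eq t" by blast+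
  note key = key_identity[OF E]
  obtain t0 where t0: "t0 \<in> I" using nonempty by blast
  show "?C1 \<or> ?C2 \<or> ?C3 \<or> ?C4"
  proof (cases "lam1 = lam2")
    case True
    \<comment> \<open>For equal constants the first two coefficients of the quadratic identity
      vanish, and only the term in \<open>f^2\<close> is left.\<close>
    have "l * lam1 + (l - 2) * lam1 = 2 * (l - 1) * lam1"
      by (simp add: algebra_simps)
    then have "(2 * (l - 1) * lam1) * (\<alpha> / l) * (f t0)\<^sup>2 = 0"
      using key[OF t0] True by (simp add: power2_eq_square)
    then have \<alpha>: "\<alpha> = 0"
      using l lam1 pos[OF t0] by simp
    have "(f1 has_real_derivative lam1 * f1 t) (at t)" if "t \<in> I" for t
      using A[OF that, unfolded time_eq_def] f2[OF that] \<alpha> True by simp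
    then obtain d where d: "\<And>t. t \<in> I \<Longrightarrow> f1 t = d * exp (lam1 * t)"
      using exponential_solution[of f1 lam1] by metis
    \<comment> \<open>\<open>d / lam1 * exp (lam1 * t)\<close> is an antiderivative of
      \<open>f1\<close>; the remaining constant is \<open>c2\<close> of case (2).\<close>
    have "((\<lambda>t. f t - d / lam1 * exp (lam1 * t)) has_real_derivative 0) (at t)" if "t \<in> I" for t
      by (rule DERIV_cong[OF DERIV_diff[OF f1[OF that] DERIV_cmult[OF DERIV_chain2[OF DERIV_exp DERIV_cmult[OF DERIV_ident]]]]])
        (use d[OF that] lam1 in simp)
    then obtain c where c: "\<And>t. t \<in> I \<Longrightarrow> f t - d / lam1 * exp (lam1 * t) = c"
      using constant_on_interval[of "\<lambda>t. f t - d / lam1 * exp (lam1 * t)"] by metis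
    have fc: "f t = d / lam1 * exp (lam1 * t) + c" if "t \<in> I" for t
      using c[OF that] by simp
    have f1c: "f1 t = lam1 * (f t - c)" if "t \<in> I" for t
      using d[OF that] fc[OF that] lam1 by simp
    have f2c: "f2 t0 = lam1 * f1 t0"
      using A[OF t0, unfolded time_eq_def] \<alpha> True by simp
    have "\<alpha>F = (l - 1) * c\<^sup>2 * lam1\<^sup>2"
      using B[OF t0, unfolded fibre_eq_def f2c f1c[OF t0]] True \<alpha>
      by (simp add: power2_eq_square algebra_simps)
    then show ?thesis
      using True \<alpha> fc by blast
  next
    case False
    define h where "h t = f1 t / f t" for t
    let ?a = "l * (lam2 - lam1)" and ?b = "l * (lam1 - lam2) * (2 * lam1 + lam2)"
      and ?c = "(l * lam1 + (l - 2) * lam2) * (\<alpha> / l + lam1 * lam2 - lam1\<^sup>2)"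
    have root: "poly [:?c, ?b, ?a:] (h t) = 0" if "t \<in> I" for t
    proof -
      have "f1 t = h t * f t" using pos[OF that] by (simp add: h_def)
      then have "(poly [:?c, ?b, ?a:] (h t)) * (f t)\<^sup>2 = 0"
        using key[OF that] by (simp add: power2_eq_square algebra_simps)
      then show ?thesis
        using pos[OF that] by simp
    qed
    have "[:?c, ?b, ?a:] \<noteq> 0"
      using False l by simp
    then have "finite {x. poly [:?c, ?b, ?a:] x = 0}"
      by (rule poly_roots_finite)
    moreover have "h ` I \<subseteq> {x. poly [:?c, ?b, ?a:] x = 0}"
      using root by blast
    ultimately have "finite (h ` I)"
      by (rule finite_subset[rotated])
    moreover have "continuous_on I h"
      unfolding h_def
    proof (rule continuous_on_divide)
      show "continuous_on I f1" "continuous_on I f"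
        using f1 f2 by (auto intro!: continuous_at_imp_continuous_on DERIV_isCont)
    qed (use pos in force)
    moreover have "connected I"
      using interval is_interval_connected by blast
    ultimately have "h constant_on I"
      by (intro continuous_finite_range_constant)
    then obtain k where k: "\<And>t. t \<in> I \<Longrightarrow> h t = k"
      unfolding constant_on_def by blast
    have "f1 t = k * f t" if "t \<in> I" for t
      using k[OF that] pos[OF that] by (simp add: h_def field_simps)
    then have "(f has_real_derivative k * f t) (at t)" if "t \<in> I" for t
      using f1[OF that] that by simp
    then obtain c where c: "\<forall>t\<in>I. f t = c * exp (k * t)"
      using exponential_solution[of f k] by metis
    note e = exponential_derivatives[OF c]
    have "(k\<^sup>2 - lam2 * k + lam1 * (lam2 - lam1) + \<alpha> / l) * f t0 = 0"
      using A[OF t0] unfolding time_eq_def e[OF t0] by (simp add: algebra_simps)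
    then have "\<alpha> / l = - (k\<^sup>2 - lam2 * k + lam1 * (lam2 - lam1))"
      using pos[OF t0] by simp
    then have \<alpha>: "l * (k\<^sup>2 - lam2 * k + lam1 * (lam2 - lam1)) = - \<alpha>"
      using l by (simp add: field_simps)
    \<comment> \<open>The factor of \<open>f^2\<close> in the fibre equation. When \<open>f\<close>
      is not constant, it has to vanish because \<open>\<alpha>F\<close> is constant.\<close>
    define r where "r = l * lam1\<^sup>2 - lam2\<^sup>2 - (l * lam1 - lam2) * k"
    have \<alpha>F: "\<alpha>F = r * (f t)\<^sup>2" if "t \<in> I" for t
      using exponential_equations(2)[OF c that \<alpha>] B[OF that] by (simp add: r_def)
    show ?thesis
    proof (cases "k = 0")
      case True
      then have "\<alpha> = (lam1\<^sup>2 - lam1 * lam2) * l" "\<alpha>F = c\<^sup>2 * (l * lam1\<^sup>2 - lam2\<^sup>2)"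
        using \<alpha> \<alpha>F[OF t0] c t0 by (simp_all add: r_def power2_eq_square algebra_simps)
      then show ?thesis
        using c True by auto
    next
      case k0: False
      have "0 = r * (f1 t0 * f t0 + f1 t0 * f t0)"
      proof (rule derivative_unique_on[OF t0 _ DERIV_const DERIV_cmult[OF DERIV_mult[OF f1[OF t0] f1[OF t0]]]])
        show "\<alpha>F = r * (f s * f s)" if "s \<in> I" for s
          using \<alpha>F[OF that] by (simp add: power2_eq_square)
      qed
      then have r: "r = 0"
        using k0 pos[OF t0] by (simp add: e(1)[OF t0])
      then have F0: "\<alpha>F = 0"
        using \<alpha>F[OF t0] by simp
      \<comment> \<open>If the denominator vanished, \<open>r\<close> would be
        \<open>l * (1 - l) * lam1^2\<close>, contrary to \<open>r = 0\<close>.\<close>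
      have ne: "lam2 \<noteq> l * lam1"
      proof
        assume "lam2 = l * lam1"
        then have "l * (l - 1) * (lam1 * lam1) = 0"
          using r by (simp add: r_def power2_eq_square algebra_simps)
        then show False using l lam1 by simp
      qed
      then have k: "k = (l * lam1\<^sup>2 - lam2\<^sup>2) / (l * lam1 - lam2)"
        using r by (simp add: r_def field_simps)
      show ?thesis
      proof (cases "lam2\<^sup>2 - 2 * l * lam1\<^sup>2 + l * lam1 * lam2 = 0")
        case True
        have half: "k = lam2 / 2"
          unfolding k by (rule special_exponent[OF True])
        have "\<alpha> = l * (lam1 - lam2 / 2)\<^sup>2"
          using \<alpha> unfolding half by (simp add: power2_eq_square algebra_simps)
        then have ?C4
          using True F0 c half by auto
        then show ?thesis by blast
      next
        case D: False
        have "f t = c * exp ((l * lam1\<^sup>2 - lam2\<^sup>2) * t / (l * lam1 - lam2))" if "t \<in> I" for t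
          using c that by (simp add: k)
        moreover have "\<alpha> = ((3 * l\<^sup>2 + l) * lam1\<^sup>2 * lam2\<^sup>2 - (l\<^sup>2 + l) * lam1 * lam2 ^ 3
                 - 2 * l\<^sup>2 * lam1 ^ 3 * lam2) / (l * lam1 - lam2)\<^sup>2"
          using general_constant[OF ne k] \<alpha> by simp
        ultimately have ?C3
          using D ne F0 by blast
        then show ?thesis by blast
      qed
    qed
  qed
next
  assume "?C1 \<or> ?C2 \<or> ?C3 \<or> ?C4"
  then show ?E
  proof (elim disjE)
    assume ?C1
    then obtain c where \<alpha>: "\<alpha> = (lam1\<^sup>2 - lam1 * lam2) * l" and \<alpha>F: "\<alpha>F = c\<^sup>2 * (l * lam1\<^sup>2 - lam2\<^sup>2)"
      and f: "\<And>t. t \<in> I \<Longrightarrow> f t = c" by blast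
    \<comment> \<open>A constant is an exponential of rate 0, so the equations for exponentials
      apply to case (1) as well.\<close>
    have f': "\<forall>t\<in>I. f t = c * exp (0 * t)"
      using f by simp
    have k: "l * (0\<^sup>2 - lam2 * 0 + lam1 * (lam2 - lam1)) = - \<alpha>"
      by (simp add: \<alpha> power2_eq_square algebra_simps)
    show ?E
      using exponential_equations[OF f' _ k] \<alpha>F f by simp
  next
    assume ?C2
    then obtain c1 c2 where eq: "lam1 = lam2" and \<alpha>: "\<alpha> = 0" and \<alpha>F: "\<alpha>F = (l - 1) * c2\<^sup>2 * lam1\<^sup>2"
      and f: "\<And>t. t \<in> I \<Longrightarrow> f t = c1 * exp (lam1 * t) + c2" by blast
    have 1: "f1 t = lam1 * (f t - c2)" if "t \<in> I" for t
    proof (rule derivative_unique_on[OF that _ f1[OF that]])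
      show "((\<lambda>t. c1 * exp (lam1 * t) + c2) has_real_derivative lam1 * (f t - c2)) (at t)"
        using f[OF that] by (auto intro!: derivative_eq_intros)
    qed (rule f)
    have 2: "f2 t = lam1 * f1 t" if "t \<in> I" for t
      by (rule derivative_unique_on[OF that 1 f2[OF that]])
        (use f1[OF that] in \<open>auto intro!: derivative_eq_intros\<close>)
    show ?E
      unfolding time_eq_def fibre_eq_def
      by (simp add: 1 2 \<alpha> \<alpha>F eq power2_eq_square algebra_simps)
  next
    assume ?C3
    then obtain c where ne: "lam2 \<noteq> l * lam1"
      and \<alpha>: "\<alpha> = ((3 * l\<^sup>2 + l) * lam1\<^sup>2 * lam2\<^sup>2 - (l\<^sup>2 + l) * lam1 * lam2 ^ 3
                 - 2 * l\<^sup>2 * lam1 ^ 3 * lam2) / (l * lam1 - lam2)\<^sup>2" and F0: "\<alpha>F = 0"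
      and f: "\<And>t. t \<in> I \<Longrightarrow> f t = c * exp ((l * lam1\<^sup>2 - lam2\<^sup>2) * t / (l * lam1 - lam2))" by blast
    define k where "k = (l * lam1\<^sup>2 - lam2\<^sup>2) / (l * lam1 - lam2)"
    have f': "\<forall>t\<in>I. f t = c * exp (k * t)"
      using f by (simp add: k_def)
    have "l * lam1\<^sup>2 - lam2\<^sup>2 - (l * lam1 - lam2) * k = 0"
      using ne by (simp add: k_def)
    then show ?E
      using exponential_equations[OF f' _ general_constant[OF ne k_def, folded \<alpha>]] F0 by simp
  next
    assume ?C4
    then obtain c where D: "lam2\<^sup>2 - 2 * l * lam1\<^sup>2 + l * lam1 * lam2 = 0"
      and \<alpha>: "\<alpha> = l * (lam1 - lam2 / 2)\<^sup>2" and F0: "\<alpha>F = 0"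
      and f: "\<forall>t\<in>I. f t = c * exp (lam2 / 2 * t)" by blast
    have k: "l * ((lam2 / 2)\<^sup>2 - lam2 * (lam2 / 2) + lam1 * (lam2 - lam1)) = - \<alpha>"
      by (simp add: \<alpha> power2_eq_square algebra_simps)
    have "l * lam1\<^sup>2 - lam2\<^sup>2 - (l * lam1 - lam2) * (lam2 / 2) = 0"
      using D by (simp add: power2_eq_square field_simps)
    then show ?E
      using exponential_equations[OF f _ k] F0 by simp
  qed
qed

end

section \<open>From the geometric conditions to the warping equations\<close>

context warped_quarter_symmetric
begin

lemma derivatives_via_hubble:
  assumes t: "t \<in> I"
  shows "deriv f t = hubble t * f t" "deriv (deriv f) t = (deriv hubble t + (hubble t)\<^sup>2) * f t"
proof -
  have 1: "deriv f t = hubble t * f t" if "t \<in> I" for t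
    using f_pos[OF that] by (simp add: hubble_def)
  then show "deriv f t = hubble t * f t" using t by blast
  have "((\<lambda>t. hubble t * f t) has_real_derivative deriv hubble t * f t + deriv f t * hubble t) (at t)"
    by (intro DERIV_mult smooth_on_has_real_derivative[OF open_interval] smooth_hubble smooth_f t)
  then have "(deriv f has_real_derivative deriv hubble t * f t + deriv f t * hubble t) (at t)"
    by (rule has_field_derivative_transform_within_open[OF _ open_interval t]) (use 1 in simp)
  from DERIV_imp_deriv[OF this] show "deriv (deriv f) t = (deriv hubble t + (hubble t)\<^sup>2) * f t"
    using 1[OF t] by (simp add: power2_eq_square algebra_simps)
qed

lemma warping_ode_deriv:
  assumes "is_interval I" "DIM('e) > 1" "lam1 \<noteq> 0" "lam2 \<noteq> 0"
  shows "warping_ode I f (deriv f) (deriv (deriv f)) (real DIM('e)) lam1 lam2"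
  using assms open_interval interval_nonempty f_pos smooth_on_deriv[OF open_interval smooth_f]
  by unfold_locales (auto intro: smooth_on_has_real_derivative smooth_f)

text \<open>The first equation is multiplied by \<open>f t\<close>, which is reversible as
  \<open>f t > 0\<close>; the second only rewrites \<open>hubble\<close> and its derivative through
  the derivatives of \<open>f\<close>.\<close>

lemma einstein_equations_iff:
  assumes ode: "warping_ode I f (deriv f) (deriv (deriv f)) (real DIM('e)) lam1 lam2" and t: "t \<in> I"
  shows "real DIM('e) * time_coeff t = - \<alpha> \<longleftrightarrow>
      warping_ode.time_eq f (deriv f) (deriv (deriv f)) (real DIM('e)) lam1 lam2 \<alpha> t"
    and "\<alpha>F = (f t)\<^sup>2 * (\<alpha> + fibre_coeff t) \<longleftrightarrow>
      warping_ode.fibre_eq f (deriv f) (deriv (deriv f)) (real DIM('e)) lam1 lam2 \<alpha> \<alpha>F t"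
proof -
  have lhs: "(deriv hubble t + (hubble t)\<^sup>2) * f t - lam2 * (hubble t * f t) + lam1 * (lam2 - lam1) * f t = time_coeff t * f t"
    by (simp add: time_coeff_def power2_eq_square algebra_simps)
  have "time_coeff t * f t = - (\<alpha> / real DIM('e)) * f t \<longleftrightarrow> time_coeff t = - (\<alpha> / real DIM('e))"
    unfolding mult_cancel_right using f_pos[OF t] by auto
  also have "\<dots> \<longleftrightarrow> real DIM('e) * time_coeff t = - \<alpha>"
    by (auto simp: field_simps)
  finally show "real DIM('e) * time_coeff t = - \<alpha> \<longleftrightarrow>
      warping_ode.time_eq f (deriv f) (deriv (deriv f)) (real DIM('e)) lam1 lam2 \<alpha> t"
    unfolding warping_ode.time_eq_def[OF ode] derivatives_via_hubble[OF t] lhs ..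
  show "\<alpha>F = (f t)\<^sup>2 * (\<alpha> + fibre_coeff t) \<longleftrightarrow>
      warping_ode.fibre_eq f (deriv f) (deriv (deriv f)) (real DIM('e)) lam1 lam2 \<alpha> \<alpha>F t"
    unfolding warping_ode.fibre_eq_def[OF ode] derivatives_via_hubble[OF t] fibre_coeff_def
    by (simp add: power2_eq_square algebra_simps)
qed

end

theorem theorem3p16:
  fixes I :: "real set"
    and F :: "('a::{t2_space,second_countable_topology}, 'e::euclidean_space) chart set"
    and gF :: "'a metric"
    and f :: "real \<Rightarrow> real"
    and l :: nat
    and lam1 lam2 \<alpha> :: real
    and nablaF :: "'a connection"
    and nablaM :: "(real \<times> 'a) connection"
  defines "M \<equiv> warped_atlas I F"
    and "g \<equiv> warped_metric F f gF"
    and "P \<equiv> del_t I F"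
  assumes "open I" and "is_interval I" and "I \<noteq> {}"
    and "smooth_manifold F" and "pseudo_riemannian_metric F gF"
    and "DIM('e) = l" and "l > 1"
    and "smooth_on I f" and "\<forall>t\<in>I. f t > 0"
    and "lam1 \<noteq> 0" and "lam2 \<noteq> 0"
    and "levi_civita_connection F gF nablaF"
    and "levi_civita_connection M g nablaM"
  shows "einstein M g (quarter_symmetric_connection g nablaM P lam1 lam2) \<alpha> \<longleftrightarrow>
    (\<exists>\<alpha>F. einstein F gF nablaF \<alpha>F \<and>
      ((\<exists>c2. \<alpha> = (lam1\<^sup>2 - lam1 * lam2) * l \<and> \<alpha>F = c2\<^sup>2 * (l * lam1\<^sup>2 - lam2\<^sup>2) \<and> (\<forall>t\<in>I. f t = c2)) \<or>
       (\<exists>c1 c2. lam1 = lam2 \<and> \<alpha> = 0 \<and> \<alpha>F = (real l - 1) * c2\<^sup>2 * lam1\<^sup>2 \<and>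
          (\<forall>t\<in>I. f t = c1 * exp (lam1 * t) + c2)) \<or>
       (\<exists>c0. lam2\<^sup>2 - 2 * real l * lam1\<^sup>2 + l * lam1 * lam2 \<noteq> 0 \<and> lam2 \<noteq> l * lam1 \<and>
          \<alpha> = ((3 * (real l)\<^sup>2 + l) * lam1\<^sup>2 * lam2\<^sup>2 - ((real l)\<^sup>2 + l) * lam1 * lam2 ^ 3
                 - 2 * (real l)\<^sup>2 * lam1 ^ 3 * lam2) / (l * lam1 - lam2)\<^sup>2 \<and>
          \<alpha>F = 0 \<and>
          (\<forall>t\<in>I. f t = c0 * exp ((l * lam1\<^sup>2 - lam2\<^sup>2) * t / (l * lam1 - lam2)))) \<or>
       (\<exists>c1. lam2\<^sup>2 - 2 * real l * lam1\<^sup>2 + l * lam1 * lam2 = 0 \<and>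
          \<alpha> = l * (lam1 - lam2 / 2)\<^sup>2 \<and> \<alpha>F = 0 \<and>
          (\<forall>t\<in>I. f t = c1 * exp (lam2 / 2 * t)))))"
proof -
  interpret F: manifold_atlas F
    by unfold_locales fact
  interpret interval_product F I
    by unfold_locales fact+
  interpret warped_product F I gF nablaF f
    by unfold_locales (use assms in auto)
  interpret warped_quarter_symmetric F I gF nablaF f nablaM lam1 lam2
    by unfold_locales (use assms in auto)
  have ode: "warping_ode I f (deriv f) (deriv (deriv f)) (real DIM('e)) lam1 lam2"
    by (rule warping_ode_deriv) (use assms in auto)
  show ?thesis
    unfolding M_def g_def P_def einstein_warped_iff \<open>DIM('e) = l\<close>[symmetric]
      warping_ode.equations_iff_cases[OF ode, symmetric]
    using einstein_equations_iff[OF ode] by simp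
qed

end
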